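(* Let $n_1,\dots,n_k$ be positive integers with $n=n_1+\cdots+n_k\ge2$. The groups $\widetilde{\mathrm H}_*\left({}_{\Sigma_{n_1}\times\cdots\times\Sigma_{n_k}}\backslash|\Pi_n|\right)$ have $p$-primary torsion only for primes $p$ that satisfy $p\le\gcd(n_1,\ldots,n_k)$.
   Context: $\Pi_n$ is the poset of partitions of $\{1,\dots,n\}$ other than the one-block partition and the partition into singletons, ordered by refinement, with the natural $\Sigma_n$-action; $|\Pi_n|$ is the geometric realization of its order complex. $\Sigma_{n_1}\times\cdots\times\Sigma_{n_k}\subset\Sigma_n$ is the Young subgroup preserving the consecutive blocks of sizes $n_1,\dots,n_k$, and ${}_G\backslash X$ denotes the orbit space. $\widetilde{\mathrm H}_*$ is reduced integral homology. *)

theory Defs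
  imports
    "HOL-Homology.Homology"
    "HOL-Algebra.Sym_Groups"
    "HOL-Algebra.Group_Action"
    "HOL-Library.Disjoint_Sets"
    "HOL-Computational_Algebra.Primes"
begin

section \<open>The partition complex\<close>

definition order_complex :: "'v set \<Rightarrow> ('v \<Rightarrow> 'v \<Rightarrow> bool) \<Rightarrow> 'v set set" where
  "order_complex P r =
     {C. C \<subseteq> P \<and> finite C \<and> C \<noteq> {} \<and> Complete_Partial_Order.chain r C}"

text \<open>
  Points are given by their barycentric coordinates, extended by 0 outside the vertex set.
  The product topology induces the usual (coherent) topology when the vertex set is finite;
  this is the only case in which the definition is meant to be used.
\<close>
definition geometric_realization :: "'v set set \<Rightarrow> ('v \<Rightarrow> real) topology" where
  "geometric_realization K =
     subtopology (powertop_real UNIV)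
       {t. (\<forall>v. 0 \<le> t v) \<and> {v. t v \<noteq> 0} \<in> K \<and> (\<Sum>v | t v \<noteq> 0. t v) = 1}"

definition proper_partitions :: "nat \<Rightarrow> nat set set set" where
  "proper_partitions n =
     {P. partition_on {1..n} P \<and> P \<noteq> {{1..n}} \<and> P \<noteq> (\<lambda>i. {i}) ` {1..n}}"

definition partition_complex :: "nat \<Rightarrow> (nat set set \<Rightarrow> real) topology" where
  "partition_complex n =
     geometric_realization (order_complex (proper_partitions n) (refines {1..n}))"

definition permute_partition :: "(nat \<Rightarrow> nat) \<Rightarrow> nat set set \<Rightarrow> nat set set" where
  "permute_partition \<sigma> P = (\<lambda>B. \<sigma> ` B) ` P"

text \<open>
  The simplicial extension of the action on vertices: the coordinate of \<open>\<sigma> t\<close> at \<open>\<sigma> P\<close> is the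
  coordinate of \<open>t\<close> at \<open>P\<close>.
\<close>
definition partition_complex_action ::
    "nat \<Rightarrow> (nat \<Rightarrow> nat) \<Rightarrow> (nat set set \<Rightarrow> real) \<Rightarrow> (nat set set \<Rightarrow> real)" where
  "partition_complex_action n \<sigma> =
     (\<lambda>t \<in> topspace (partition_complex n). \<lambda>P. t (permute_partition (inv' \<sigma>) P))"

section \<open>Young subgroups\<close>

definition young_block :: "nat list \<Rightarrow> nat \<Rightarrow> nat set" where
  "young_block ns i = {sum_list (take i ns) <.. sum_list (take (Suc i) ns)}"

definition young_subgroup :: "nat list \<Rightarrow> (nat \<Rightarrow> nat) set" where
  "young_subgroup ns =
     {\<sigma> \<in> carrier (sym_group (sum_list ns)).
        \<forall>i<length ns. \<sigma> ` young_block ns i = young_block ns i}"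

definition young_group :: "nat list \<Rightarrow> (nat \<Rightarrow> nat) monoid" where
  "young_group ns = (sym_group (sum_list ns))\<lparr>carrier := young_subgroup ns\<rparr>"

section \<open>Orbit spaces\<close>

definition quotient_topology :: "'a topology \<Rightarrow> ('a \<Rightarrow> 'b) \<Rightarrow> 'b topology" where
  "quotient_topology X f =
     topology (\<lambda>U. U \<subseteq> f ` topspace X \<and> openin X {x \<in> topspace X. f x \<in> U})"

definition orbit_space ::
    "('g, 'm) monoid_scheme \<Rightarrow> ('g \<Rightarrow> 'a \<Rightarrow> 'a) \<Rightarrow> 'a topology \<Rightarrow> 'a set topology" where
  "orbit_space G \<phi> X = quotient_topology X (orbit G \<phi>)"

section \<open>Primary torsion\<close>

definition primary_torsion :: "nat \<Rightarrow> ('a, 'm) monoid_scheme \<Rightarrow> 'a set" where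
  "primary_torsion p G = {x \<in> carrier G. \<exists>m::nat. x [^]\<^bsub>G\<^esub> (p ^ m) = \<one>\<^bsub>G\<^esub>}"

section \<open>Well-definedness\<close>

lemma openin_quotient_topology:
  "openin (quotient_topology X f) U \<longleftrightarrow>
     U \<subseteq> f ` topspace X \<and> openin X {x \<in> topspace X. f x \<in> U}"
proof -
  have "istopology (\<lambda>U. U \<subseteq> f ` topspace X \<and> openin X {x \<in> topspace X. f x \<in> U})"
    unfolding istopology_def
  proof (intro conjI allI impI)
    fix S T assume "S \<subseteq> f ` topspace X \<and> openin X {x \<in> topspace X. f x \<in> S}"
      and "T \<subseteq> f ` topspace X \<and> openin X {x \<in> topspace X. f x \<in> T}"
    moreover have "{x \<in> topspace X. f x \<in> S \<inter> T} =
        {x \<in> topspace X. f x \<in> S} \<inter> {x \<in> topspace X. f x \<in> T}" by auto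
    ultimately show "S \<inter> T \<subseteq> f ` topspace X" "openin X {x \<in> topspace X. f x \<in> S \<inter> T}"
      by (auto simp: openin_Int)
  next
    fix \<K> assume K: "\<forall>K\<in>\<K>. K \<subseteq> f ` topspace X \<and> openin X {x \<in> topspace X. f x \<in> K}"
    have "{x \<in> topspace X. f x \<in> \<Union>\<K>} = (\<Union>K\<in>\<K>. {x \<in> topspace X. f x \<in> K})" by auto
    with K show "\<Union>\<K> \<subseteq> f ` topspace X" "openin X {x \<in> topspace X. f x \<in> \<Union>\<K>}"
      by (auto intro!: openin_Union)
  qed
  then show ?thesis
    by (simp add: quotient_topology_def topology_inverse')
qed

lemma topspace_quotient_topology: "topspace (quotient_topology X f) = f ` topspace X"
proof
  show "topspace (quotient_topology X f) \<subseteq> f ` topspace X"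
    by (auto simp: topspace_def openin_quotient_topology)
  have "{x \<in> topspace X. f x \<in> f ` topspace X} = topspace X" by auto
  then have "openin (quotient_topology X f) (f ` topspace X)"
    by (simp add: openin_quotient_topology)
  then show "f ` topspace X \<subseteq> topspace (quotient_topology X f)"
    by (rule openin_subset)
qed

lemma quotient_map_quotient_topology: "quotient_map X (quotient_topology X f) f"
  by (auto simp: quotient_map_def topspace_quotient_topology openin_quotient_topology)

lemma topspace_orbit_space: "topspace (orbit_space G \<phi> X) = orbits G (topspace X) \<phi>"
  by (auto simp: orbit_space_def topspace_quotient_topology orbits_def)

lemma topspace_partition_complex:
  "topspace (partition_complex n) =
     {t. (\<forall>v. 0 \<le> t v) \<and>
         {v. t v \<noteq> 0} \<in> order_complex (proper_partitions n) (refines {1..n}) \<and>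
         (\<Sum>v | t v \<noteq> 0. t v) = 1}"
  by (simp add: partition_complex_def geometric_realization_def)

lemma permute_partition_comp:
  "permute_partition (\<sigma> \<circ> \<tau>) P = permute_partition \<sigma> (permute_partition \<tau> P)"
  by (simp add: permute_partition_def image_image image_comp)

lemma permute_partition_id: "permute_partition id P = P"
  by (simp add: permute_partition_def)

lemma permute_partition_inv:
  assumes "\<sigma> permutes S"
  shows "permute_partition \<sigma> (permute_partition (inv' \<sigma>) P) = P"
    and "permute_partition (inv' \<sigma>) (permute_partition \<sigma> P) = P"
  by (simp_all add: permute_partition_comp [symmetric] permutes_inv_o [OF assms]
      permute_partition_id)

lemma inj_permute_partition:
  assumes "\<sigma> permutes S"
  shows "inj (permute_partition \<sigma>)"
  by (metis injI permute_partition_inv(2)[OF assms])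

lemma partition_on_permute_partition:
  assumes "\<sigma> permutes {1..n}" "partition_on {1..n} P"
  shows "partition_on {1..n} (permute_partition \<sigma> P)"
proof -
  have "inj_on \<sigma> {1..n}"
    using assms(1) permutes_inj_on by blast
  then have "partition_on (\<sigma> ` {1..n}) ((`) \<sigma> ` P - {{}})"
    by (intro partition_on_inj_image assms)
  moreover have "(`) \<sigma> ` P - {{}} = permute_partition \<sigma> P"
    using partition_onD3 [OF assms(2)] by (auto simp: permute_partition_def)
  ultimately show ?thesis
    by (simp only: permutes_image [OF assms(1)])
qed

lemma refines_permute_partition:
  assumes "\<sigma> permutes {1..n}" "refines {1..n} P Q"
  shows "refines {1..n} (permute_partition \<sigma> P) (permute_partition \<sigma> Q)"
proof -
  have "\<exists>C\<in>permute_partition \<sigma> Q. B \<subseteq> C" if B: "B \<in> permute_partition \<sigma> P" for B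
  proof -
    obtain B' where B': "B' \<in> P" "B = \<sigma> ` B'"
      using B by (auto simp: permute_partition_def)
    then obtain C' where "C' \<in> Q" "B' \<subseteq> C'"
      using assms(2) by (auto simp: refines_def)
    with B' show ?thesis
      by (auto simp: permute_partition_def intro!: bexI [of _ C'])
  qed
  then show ?thesis
    using assms partition_on_permute_partition [OF assms(1)] by (auto simp: refines_def)
qed

lemma permute_partition_proper:
  assumes "\<sigma> permutes {1..n}" "P \<in> proper_partitions n"
  shows "permute_partition \<sigma> P \<in> proper_partitions n"
proof -
  have im: "\<sigma> ` {1..n} = {1..n}"
    by (rule permutes_image [OF assms(1)])
  have "permute_partition \<sigma> {{1..n}} = {{1..n}}"
    by (simp only: permute_partition_def image_insert image_empty im)
  then have "permute_partition \<sigma> P \<noteq> {{1..n}}"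
    using assms(2) injD [OF inj_permute_partition [OF assms(1)], of P "{{1..n}}"]
    unfolding proper_partitions_def by fastforce
  moreover have "permute_partition \<sigma> ((\<lambda>i. {i}) ` {1..n}) = (\<lambda>i. {i}) ` \<sigma> ` {1..n}"
    by (simp add: permute_partition_def image_image)
  then have "permute_partition \<sigma> P \<noteq> (\<lambda>i. {i}) ` {1..n}"
    using assms(2) injD [OF inj_permute_partition [OF assms(1)], of P "(\<lambda>i. {i}) ` {1..n}"]
    unfolding proper_partitions_def im by fastforce
  ultimately show ?thesis
    using assms partition_on_permute_partition [OF assms(1)]
    unfolding proper_partitions_def by blast
qed

lemma order_complex_permute_partition:
  assumes "\<sigma> permutes {1..n}"
    and "C \<in> order_complex (proper_partitions n) (refines {1..n})"
  shows "permute_partition \<sigma> ` C \<in> order_complex (proper_partitions n) (refines {1..n})"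
proof -
  have "refines {1..n} (permute_partition \<sigma> P) (permute_partition \<sigma> Q) \<or>
      refines {1..n} (permute_partition \<sigma> Q) (permute_partition \<sigma> P)"
    if "P \<in> C" "Q \<in> C" for P Q
    using assms(2) that refines_permute_partition [OF assms(1)]
    unfolding order_complex_def Complete_Partial_Order.chain_def by blast
  then have "Complete_Partial_Order.chain (refines {1..n}) (permute_partition \<sigma> ` C)"
    unfolding Complete_Partial_Order.chain_def by blast
  moreover have "permute_partition \<sigma> ` C \<subseteq> proper_partitions n"
    using assms permute_partition_proper [OF assms(1)] unfolding order_complex_def by blast
  ultimately show ?thesis
    using assms(2) unfolding order_complex_def by blast
qed

lemma partition_complex_action_closed:
  assumes \<sigma>: "\<sigma> permutes {1..n}" and t: "t \<in> topspace (partition_complex n)"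
  shows "partition_complex_action n \<sigma> t \<in> topspace (partition_complex n)"
proof -
  let ?s = "\<lambda>P. t (permute_partition (inv' \<sigma>) P)"
  have supp: "{P. ?s P \<noteq> 0} = permute_partition \<sigma> ` {P. t P \<noteq> 0}"
    using permute_partition_inv [OF \<sigma>] by (auto simp: image_iff)
  have "(\<Sum>P | ?s P \<noteq> 0. ?s P) = (\<Sum>P | t P \<noteq> 0. t P)"
    unfolding supp
    by (subst sum.reindex [OF inj_on_subset [OF inj_permute_partition [OF \<sigma>]]])
      (simp_all add: permute_partition_inv(2) [OF \<sigma>])
  then show ?thesis
    using t order_complex_permute_partition [OF \<sigma>, of "{P. t P \<noteq> 0}"]
    by (simp add: partition_complex_action_def topspace_partition_complex supp)
qed

lemma group_action_partition_complex:
  "group_action (sym_group n) (topspace (partition_complex n)) (partition_complex_action n)"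
proof -
  let ?E = "topspace (partition_complex n)" and ?a = "partition_complex_action n"
  have comp: "?a (\<sigma> \<circ> \<tau>) t = ?a \<sigma> (?a \<tau> t)"
    if "\<sigma> permutes {1..n}" "\<tau> permutes {1..n}" "t \<in> ?E" for \<sigma> \<tau> t
    using that partition_complex_action_closed [of \<tau> n t]
    by (simp add: partition_complex_action_def permute_partition_comp [symmetric]
        o_inv_distrib permutes_bij)
  have one: "?a id t = t" if "t \<in> ?E" for t
    using that by (simp add: partition_complex_action_def permute_partition_id)
  have bij: "bij_betw (?a \<sigma>) ?E ?E" if \<sigma>: "\<sigma> permutes {1..n}" for \<sigma>
  proof (rule bij_betw_byWitness [where f' = "?a (inv' \<sigma>)"])
    have \<sigma>': "inv' \<sigma> permutes {1..n}"
      by (rule permutes_inv [OF \<sigma>])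
    show "\<forall>t\<in>?E. ?a (inv' \<sigma>) (?a \<sigma> t) = t"
      by (metis comp [OF \<sigma>' \<sigma>] permutes_inv_o(2) [OF \<sigma>] one)
    show "\<forall>t\<in>?E. ?a \<sigma> (?a (inv' \<sigma>) t) = t"
      by (metis comp [OF \<sigma> \<sigma>'] permutes_inv_o(1) [OF \<sigma>] one)
    show "?a \<sigma> ` ?E \<subseteq> ?E" "?a (inv' \<sigma>) ` ?E \<subseteq> ?E"
      using partition_complex_action_closed \<sigma> \<sigma>' by blast+
  qed
  have ext: "?a \<sigma> \<in> extensional ?E" for \<sigma>
    by (simp add: partition_complex_action_def)
  have "?a \<in> hom (sym_group n) (BijGroup ?E)"
  proof (rule homI)
    fix \<sigma> assume "\<sigma> \<in> carrier (sym_group n)"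
    then show "?a \<sigma> \<in> carrier (BijGroup ?E)"
      by (simp add: sym_group_carrier BijGroup_def Bij_def bij ext)
  next
    fix \<sigma> \<tau> assume *: "\<sigma> \<in> carrier (sym_group n)" "\<tau> \<in> carrier (sym_group n)"
    then have "?a (\<sigma> \<circ> \<tau>) = compose ?E (?a \<sigma>) (?a \<tau>)"
      by (intro extensionalityI [OF ext compose_extensional])
        (simp add: sym_group_carrier compose_eq comp)
    with * show "?a (\<sigma> \<otimes>\<^bsub>sym_group n\<^esub> \<tau>) = ?a \<sigma> \<otimes>\<^bsub>BijGroup ?E\<^esub> ?a \<tau>"
      by (simp add: sym_group_carrier sym_group_mult BijGroup_def Bij_def bij ext)
  qed
  then show ?thesis
    by (simp add: group_action_def group_hom_def group_hom_axioms_def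
        sym_group_is_group group_BijGroup)
qed

lemma subgroup_young_subgroup: "subgroup (young_subgroup ns) (sym_group (sum_list ns))"
proof (rule group.subgroupI [OF sym_group_is_group])
  show "young_subgroup ns \<subseteq> carrier (sym_group (sum_list ns))"
    by (auto simp: young_subgroup_def)
  have "id \<in> young_subgroup ns"
    by (simp add: young_subgroup_def sym_group_carrier permutes_id)
  then show "young_subgroup ns \<noteq> {}" by blast
next
  fix \<sigma> assume *: "\<sigma> \<in> young_subgroup ns"
  then have \<sigma>: "\<sigma> permutes {1..sum_list ns}"
    by (simp add: young_subgroup_def sym_group_carrier)
  have "inv' \<sigma> ` young_block ns i = young_block ns i" if "i < length ns" for i
  proof -
    have "\<sigma> ` young_block ns i = young_block ns i"
      using * that by (simp add: young_subgroup_def)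
    then have "inv' \<sigma> ` young_block ns i = inv' \<sigma> ` \<sigma> ` young_block ns i" by simp
    also have "\<dots> = young_block ns i"
      by (simp only: image_comp permutes_inv_o [OF \<sigma>] image_id id_apply)
    finally show ?thesis .
  qed
  moreover have "inv\<^bsub>sym_group (sum_list ns)\<^esub> \<sigma> = inv' \<sigma>"
    using \<sigma> by (intro group.inv_equality [OF sym_group_is_group])
      (simp_all add: sym_group_carrier sym_group_mult sym_group_one permutes_inv
        permutes_inv_o [OF \<sigma>])
  ultimately show "inv\<^bsub>sym_group (sum_list ns)\<^esub> \<sigma> \<in> young_subgroup ns"
    using \<sigma> by (simp add: young_subgroup_def sym_group_carrier permutes_inv)
next
  fix \<sigma> \<tau> assume *: "\<sigma> \<in> young_subgroup ns" "\<tau> \<in> young_subgroup ns"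
  have "(\<sigma> \<circ> \<tau>) ` young_block ns i = young_block ns i" if "i < length ns" for i
    unfolding image_comp [symmetric] using * that by (simp add: young_subgroup_def)
  with * show "\<sigma> \<otimes>\<^bsub>sym_group (sum_list ns)\<^esub> \<tau> \<in> young_subgroup ns"
    by (simp add: young_subgroup_def sym_group_carrier sym_group_mult permutes_compose)
qed

end

theory Submission
  imports Defs "HOL-Analysis.Urysohn"
begin

text \<open>
  If \<open>p\<close> does not divide some \<open>n\<^sub>i\<close>, let \<open>x\<close> be a point of the \<open>i\<close>-th block. Its stabiliser in the
  Young subgroup has index \<open>n\<^sub>i\<close>, so by a transfer argument it suffices that the quotient of the
  partition complex by any group fixing \<open>x\<close> has torsion-free homology. In fact such a quotient is
  acyclic below the top dimension \<open>n - 3\<close>: iterating the homotopy complementation formula at the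
  partition \<open>{{x}, - {x}}\<close> gives a matching on the chains of partitions which is equivariant under
  all permutations fixing \<open>x\<close> and whose only critical chains are maximal. Hence \<open>p\<close> even has to
  divide every \<open>n\<^sub>i\<close>.

  These arguments take place in the coinvariants of the complex of strict chains of partitions,
  which compute the singular homology of the orbit space because the latter is glued from finitely
  many simplices with disjoint, injectively mapped interiors.
\<close>

section \<open>Attaching a simplex\<close>

text \<open>Chains are kept as lists ordered by refinement. Permutations preserve refinement, so one
  that maps a chain to itself fixes each of its members. Hence the coinvariants are free on the
  orbits of chains, with no torsion from signs, and the orbit space is glued from the chains
  themselves, without subdivision. Freeness also settles the top degree: nothing bounds there, so
  there is no torsion. In the interval above a flag ending in the block B, taking meets with {B, -B}
  contracts all chains except those through a complement of {B, -B}. Each complement enlarges B by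
  one point and is minimal in the interval, so the same problem recurs above it with a larger block.
  A chain escapes only when the block has reached \<open>n - 1\<close> points. The only choice made
  is that of x, whence the equivariance. On coinvariants the matching is used as a homotopy operator
  whose error lowers a weight, so no orbit representatives have to be compared.\<close>

abbreviation simplex_topology :: "nat \<Rightarrow> (nat \<Rightarrow> real) topology" where
  "simplex_topology m \<equiv> subtopology (powertop_real UNIV) (standard_simplex m)"

definition simplex_frontier :: "nat \<Rightarrow> (nat \<Rightarrow> real) set" where
  "simplex_frontier m = {x \<in> standard_simplex m. \<exists>i\<le>m. x i = 0}"

text \<open>On the simplex this is a continuous function vanishing exactly on the frontier. The
  recursion, rather than a minimum over a set, lets continuity follow by induction.\<close>

primrec min_coord :: "nat \<Rightarrow> (nat \<Rightarrow> real) \<Rightarrow> real" where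
  "min_coord 0 x = x 0"
| "min_coord (Suc m) x = min (min_coord m x) (x (Suc m))"

lemma min_coord_le: "i \<le> m \<Longrightarrow> min_coord m x \<le> x i"
proof (induction m)
  case (Suc m)
  then show ?case by (cases "i = Suc m") (auto simp: min_le_iff_disj)
qed auto

lemma min_coord_attained: "\<exists>i\<le>m. min_coord m x = x i"
proof (induction m)
  case (Suc m)
  then obtain i where "i \<le> m" "min_coord m x = x i" by blast
  then show ?case
    by (metis le_Suc_eq min_coord.simps(2) min_def order_refl)
qed auto

lemma min_coord_nonneg: "x \<in> standard_simplex m \<Longrightarrow> 0 \<le> min_coord m x"
  using min_coord_attained [of m x] by (auto simp: standard_simplex_def)

lemma simplex_frontier_min_coord:
  "x \<in> standard_simplex m \<Longrightarrow> x \<in> simplex_frontier m \<longleftrightarrow> min_coord m x = 0"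
  using min_coord_nonneg [of x m] min_coord_attained [of m x] min_coord_le [of _ m x]
  by (fastforce simp: simplex_frontier_def)

text \<open>The average coordinate is \<open>1 / (m + 1)\<close>, and the minimum cannot exceed
  it.\<close>

lemma min_coord_sum: "x \<in> standard_simplex m \<Longrightarrow> (real m + 1) * min_coord m x \<le> 1"
  using sum_mono [of "{..m}" "\<lambda>_. min_coord m x" x] min_coord_le [of _ m x]
  by (auto simp: standard_simplex_def algebra_simps)

lemma continuous_map_coord: "continuous_map (powertop_real UNIV) euclideanreal (\<lambda>x. x i)"
  by (rule continuous_map_product_projection) simp

lemma continuous_map_min_coord: "continuous_map (powertop_real UNIV) euclideanreal (min_coord m)"
proof (induction m)
  case 0
  then show ?case using continuous_map_coord [of 0] by (rule continuous_map_eq) simp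
next
  case (Suc m)
  have "continuous_map (powertop_real UNIV) euclideanreal (\<lambda>x. min (min_coord m x) (x (Suc m)))"
    by (intro continuous_map_real_min Suc continuous_map_coord)
  then show ?case by simp
qed

text \<open>
  The radial push away from the barycentre, cut off at half the inradius so that it is defined on
  the whole simplex; at time 1 it carries a neighbourhood of the frontier to the frontier.
\<close>
definition simplex_push :: "nat \<Rightarrow> real \<Rightarrow> (nat \<Rightarrow> real) \<Rightarrow> nat \<Rightarrow> real" where
  "simplex_push m s x =
     (let \<nu> = s * min (min_coord m x) (1 / (2 * (real m + 1)))
      in (\<lambda>i. if i \<le> m then (x i - \<nu>) / (1 - (real m + 1) * \<nu>) else 0))"

text \<open>Here the cut-off in \<open>simplex_push\<close> is inactive, so at time 1 the smallest
  coordinate becomes 0. The strict inequality makes the set open, as excision requires.\<close>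

definition simplex_collar :: "nat \<Rightarrow> (nat \<Rightarrow> real) set" where
  "simplex_collar m = {x \<in> standard_simplex m. min_coord m x < 1 / (2 * (real m + 1))}"

lemma simplex_push_0: "x \<in> standard_simplex m \<Longrightarrow> simplex_push m 0 x = x"
  by (auto simp: simplex_push_def standard_simplex_def)

lemma simplex_push_frontier: "x \<in> simplex_frontier m \<Longrightarrow> simplex_push m s x = x"
  using simplex_frontier_min_coord [of x m]
  by (auto simp: simplex_push_def simplex_frontier_def standard_simplex_def Let_def fun_eq_iff)

text \<open>These bounds keep the denominator in \<open>simplex_push\<close> at least 1/2 and all
  numerators nonnegative.\<close>

lemma simplex_push_denominator:
  assumes "0 \<le> s" "s \<le> 1" "x \<in> standard_simplex m"
  shows "0 \<le> s * min (min_coord m x) (1 / (2 * (real m + 1)))"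
    and "(real m + 1) * (s * min (min_coord m x) (1 / (2 * (real m + 1)))) \<le> 1/2"
    and "s * min (min_coord m x) (1 / (2 * (real m + 1))) \<le> min_coord m x"
proof -
  let ?n = "min (min_coord m x) (1 / (2 * (real m + 1)))"
  have n0: "0 \<le> ?n" using min_coord_nonneg[OF assms(3)] by simp
  then show "0 \<le> s * ?n" using assms by simp
  have le: "s * ?n \<le> ?n" using mult_left_le_one_le [OF n0 assms(1,2)] .
  then show "s * ?n \<le> min_coord m x" by linarith
  have "(real m + 1) * (s * ?n) \<le> (real m + 1) * (1 / (2 * (real m + 1)))"
    using le by (intro mult_left_mono) auto
  also have "\<dots> = 1/2" by (simp add: field_simps)
  finally show "(real m + 1) * (s * ?n) \<le> 1/2" .
qed

lemma simplex_push_in_simplex: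
  assumes "0 \<le> s" "s \<le> 1" "x \<in> standard_simplex m"
  shows "simplex_push m s x \<in> standard_simplex m"
proof -
  define n where "n = s * min (min_coord m x) (1 / (2 * (real m + 1)))"
  note d = simplex_push_denominator [OF assms, folded n_def]
  let ?d = "1 - (real m + 1) * n"
  have dpos: "0 < ?d" using d(2) by linarith
  have eq: "simplex_push m s x = (\<lambda>i. if i \<le> m then (x i - n) / ?d else 0)"
    unfolding simplex_push_def n_def Let_def ..
  have ge: "0 \<le> simplex_push m s x i" for i
    using d(3) min_coord_le [of i m x] dpos by (auto simp: eq)
  have "(\<Sum>i\<le>m. simplex_push m s x i) = (\<Sum>i\<le>m. (x i - n)) / ?d"
    by (simp add: eq sum_divide_distrib)
  also have "(\<Sum>i\<le>m. (x i - n)) = ?d"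
    using assms(3) by (simp add: sum_subtractf standard_simplex_def algebra_simps)
  finally have sum1: "(\<Sum>i\<le>m. simplex_push m s x i) = 1" using dpos by simp
  have "simplex_push m s x i \<le> 1" for i
  proof (cases "i \<le> m")
    case True
    then have "simplex_push m s x i \<le> (\<Sum>i\<le>m. simplex_push m s x i)"
      by (intro member_le_sum) (auto simp: ge)
    then show ?thesis using sum1 by simp
  qed (simp add: eq)
  then show ?thesis
    using ge sum1 by (auto simp: standard_simplex_def eq)
qed

text \<open>A coordinate not exceeding that of the barycentre moves away from it, hence decreases;
  so the collar is never left.\<close>

lemma simplex_push_coord_mono:
  assumes "0 \<le> s" "s \<le> 1" "x \<in> standard_simplex m" "i \<le> m" "(real m + 1) * x i \<le> 1"
  shows "simplex_push m s x i \<le> x i"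
proof -
  define n where "n = s * min (min_coord m x) (1 / (2 * (real m + 1)))"
  note d = simplex_push_denominator [OF assms(1-3), folded n_def]
  let ?d = "1 - (real m + 1) * n"
  have dpos: "0 < ?d" using d(2) by linarith
  have "x i - n \<le> x i * ?d"
    using mult_right_mono [OF assms(5) d(1)] by (simp add: algebra_simps)
  moreover have "simplex_push m s x i = (x i - n) / ?d"
    unfolding simplex_push_def n_def Let_def using assms(4) by (rule if_P)
  ultimately show ?thesis
    using dpos by (simp only: pos_divide_le_eq)
qed

lemma simplex_push_collar:
  assumes "0 \<le> s" "s \<le> 1" "x \<in> simplex_collar m"
  shows "simplex_push m s x \<in> simplex_collar m"
proof -
  have x: "x \<in> standard_simplex m" and mu: "min_coord m x < 1 / (2 * (real m + 1))"
    using assms by (auto simp: simplex_collar_def)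
  obtain i where i: "i \<le> m" "min_coord m x = x i"
    using min_coord_attained by blast
  have "(real m + 1) * x i \<le> 1"
    using min_coord_sum [OF x] i by simp
  then have "simplex_push m s x i \<le> x i"
    using simplex_push_coord_mono assms x i by blast
  then have "min_coord m (simplex_push m s x) \<le> min_coord m x"
    using min_coord_le [OF i(1), of "simplex_push m s x"] i by simp
  then show ?thesis
    using mu simplex_push_in_simplex [OF assms(1,2) x] by (simp add: simplex_collar_def)
qed

lemma simplex_push_1_collar:
  assumes "x \<in> simplex_collar m"
  shows "simplex_push m 1 x \<in> simplex_frontier m"
proof -
  have x: "x \<in> standard_simplex m" and mu: "min_coord m x < 1 / (2 * (real m + 1))"
    using assms by (auto simp: simplex_collar_def)
  obtain i where i: "i \<le> m" "min_coord m x = x i"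
    using min_coord_attained by blast
  have "simplex_push m 1 x i = 0"
    using i mu by (simp add: simplex_push_def Let_def)
  then show ?thesis
    using simplex_push_in_simplex [OF _ _ x, of 1] i by (auto simp: simplex_frontier_def)
qed

lemma simplex_frontier_subset_collar: "simplex_frontier m \<subseteq> simplex_collar m"
  proof
  fix x assume x: "x \<in> simplex_frontier m"
  then have "x \<in> standard_simplex m" by (simp add: simplex_frontier_def)
  moreover from this x have "min_coord m x = 0" using simplex_frontier_min_coord by blast
  ultimately show "x \<in> simplex_collar m" by (simp add: simplex_collar_def)
qed

lemma continuous_map_simplex_push:
  "continuous_map (prod_topology (top_of_set {0..1}) (simplex_topology m)) (simplex_topology m)
     (\<lambda>(s, x). simplex_push m s x)"
proof -
  let ?P = "prod_topology (top_of_set {0..1::real}) (simplex_topology m)"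
  let ?nu = "\<lambda>p. fst p * min (min_coord m (snd p)) (1 / (2 * (real m + 1)))"
  have c1: "continuous_map ?P euclideanreal fst"
    using continuous_map_fst continuous_map_into_fulltopology by blast
  have c2: "continuous_map ?P (powertop_real UNIV) snd"
    using continuous_map_snd continuous_map_into_fulltopology by blast
  have c3: "continuous_map ?P euclideanreal (\<lambda>p. min_coord m (snd p))"
    using continuous_map_compose [OF c2 continuous_map_min_coord] by (simp add: o_def)
  have c4: "continuous_map ?P euclideanreal (\<lambda>p. snd p i)" for i
    using continuous_map_compose [OF c2 continuous_map_coord] by (simp add: o_def)
  have nu: "continuous_map ?P euclideanreal ?nu"
    by (intro continuous_map_real_mult c1 continuous_map_real_min c3 continuous_map_const [THEN iffD2]) auto
  have nz: "1 - (real m + 1) * ?nu p \<noteq> 0" if "p \<in> topspace ?P" for p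
    using that simplex_push_denominator(2) [of "fst p" "snd p" m] by (auto simp: topspace_standard_simplex)
  have "continuous_map ?P euclideanreal (\<lambda>p. simplex_push m (fst p) (snd p) i)" for i
  proof (cases "i \<le> m")
    case True
    have "continuous_map ?P euclideanreal (\<lambda>p. (snd p i - ?nu p) / (1 - (real m + 1) * ?nu p))"
      by (intro continuous_map_real_divide continuous_map_diff c4 nu continuous_map_real_mult_left
          continuous_map_const [THEN iffD2] nz) auto
    then show ?thesis using True by (simp add: simplex_push_def Let_def)
  qed (simp add: simplex_push_def Let_def)
  then have "continuous_map ?P (powertop_real UNIV) (\<lambda>p. simplex_push m (fst p) (snd p))"
    by (simp add: continuous_map_componentwise_UNIV)
  then show ?thesis
    using simplex_push_in_simplex
    by (auto simp: continuous_map_in_subtopology case_prod_unfold topspace_standard_simplex)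
qed


lemma compact_space_simplex_topology: "compact_space (simplex_topology m)"
  using compactin_standard_simplex compact_space_subtopology by blast

lemma Hausdorff_space_simplex_topology: "Hausdorff_space (simplex_topology m)"
  by (intro Hausdorff_space_subtopology) (simp add: Hausdorff_space_product_topology)

lemma simplex_topology_subset: "S \<subseteq> standard_simplex m \<Longrightarrow>
    subtopology (simplex_topology m) S = subtopology (powertop_real UNIV) S"
  by (simp add: subtopology_subtopology inf.absorb2)

lemma closedin_simplex_frontier: "closedin (simplex_topology m) (simplex_frontier m)"
proof -
  have "closedin (simplex_topology m) {x \<in> topspace (simplex_topology m). min_coord m x \<in> {0}}"
    by (rule closedin_continuous_map_preimage
        [OF continuous_map_from_subtopology [OF continuous_map_min_coord]]) simp
  also have "{x \<in> topspace (simplex_topology m). min_coord m x \<in> {0}} = simplex_frontier m"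
    using simplex_frontier_min_coord by (auto simp: simplex_frontier_def)
  finally show ?thesis .
qed

lemma openin_simplex_collar: "openin (simplex_topology m) (simplex_collar m)"
proof -
  have "openin (simplex_topology m)
          {x \<in> topspace (simplex_topology m). min_coord m x \<in> {..<1 / (2 * (real m + 1))}}"
    by (rule openin_continuous_map_preimage
        [OF continuous_map_from_subtopology [OF continuous_map_min_coord]]) simp
  also have "{x \<in> topspace (simplex_topology m). min_coord m x \<in> {..<1 / (2 * (real m + 1))}}
      = simplex_collar m"
    by (auto simp: simplex_collar_def)
  finally show ?thesis .
qed

lemma iso_imp_bij_betw: "h \<in> iso G H \<Longrightarrow> bij_betw h (carrier G) (carrier H)"
  by (simp add: iso_def)

text \<open>
  The excision and homotopy comparisons are natural in the characteristic map, so attaching a cell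
  changes homology by exactly the homology of the pair (simplex, frontier).
\<close>
locale attached_simplex =
  fixes X :: "'z topology" and A :: "'z set" and m :: nat and \<sigma> :: "(nat \<Rightarrow> real) \<Rightarrow> 'z"
  assumes Hausdorff: "Hausdorff_space X"
    and closedin_A: "closedin X A"
    and continuous: "continuous_map (simplex_topology m) X \<sigma>"
    and topspace_eq: "topspace X = A \<union> \<sigma> ` standard_simplex m"
    and frontier: "\<sigma> ` simplex_frontier m \<subseteq> A"
    and interior: "\<And>x. x \<in> standard_simplex m \<Longrightarrow> \<sigma> x \<in> A \<Longrightarrow> x \<in> simplex_frontier m"
    and inj: "inj_on \<sigma> (standard_simplex m - simplex_frontier m)"
begin

lemma A_iff: "x \<in> standard_simplex m \<Longrightarrow> \<sigma> x \<in> A \<longleftrightarrow> x \<in> simplex_frontier m"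
  using frontier interior by blast

lemma closed_map: "closed_map (simplex_topology m) X \<sigma>"
  by (rule continuous_imp_closed_map [OF continuous compact_space_simplex_topology Hausdorff])

text \<open>All identifications made by \<open>\<sigma>\<close> happen inside the frontier, where
  \<open>simplex_push\<close> is the identity; therefore the push descends to
  \<open>X\<close>.\<close>

lemma respects_fibres:
  assumes "x \<in> standard_simplex m" "y \<in> standard_simplex m" "\<sigma> x = \<sigma> y"
  shows "x = y \<or> x \<in> simplex_frontier m \<and> y \<in> simplex_frontier m"
  using assms A_iff [of x] A_iff [of y] inj by (metis DiffI inj_onD)

text \<open>Off \<open>A\<close> the preimage under \<open>\<sigma>\<close> is unique, so the
  inverse chosen here is harmless; \<open>push_simplex\<close> gives the usable form.\<close>

definition push :: "real \<Rightarrow> 'z \<Rightarrow> 'z" where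
  "push s z = (if z \<in> A then z else \<sigma> (simplex_push m s (inv_into (standard_simplex m) \<sigma> z)))"

lemma push_A: "z \<in> A \<Longrightarrow> push s z = z"
  by (simp add: push_def)

lemma push_simplex:
  assumes "x \<in> standard_simplex m"
  shows "push s (\<sigma> x) = \<sigma> (simplex_push m s x)"
proof (cases "\<sigma> x \<in> A")
  case True
  then show ?thesis using A_iff [OF assms] simplex_push_frontier by (simp add: push_def)
next
  case False
  have "inv_into (standard_simplex m) \<sigma> (\<sigma> x) = x"
    using respects_fibres [of x "inv_into (standard_simplex m) \<sigma> (\<sigma> x)"] assms False
      A_iff [OF assms] inv_into_into [of "\<sigma> x" \<sigma> "standard_simplex m"]
      f_inv_into_f [of "\<sigma> x" \<sigma> "standard_simplex m"] by auto
  then show ?thesis using False by (simp add: push_def)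
qed

text \<open>The preimage of a closed set is a union of two closed sets: one over \<open>A\<close>,
  where the homotopy is constant, and one that is the image of a closed set under the product of the
  interval with \<open>\<sigma>\<close>. That product map is closed, going from a compact to a
  Hausdorff space.\<close>

lemma continuous_map_push:
  "continuous_map (prod_topology (top_of_set {0..1}) X) X (\<lambda>(s, z). push s z)"
proof -
  let ?I = "top_of_set {0..1::real}" and ?D = "simplex_topology m"
  let ?q = "\<lambda>(s, x). (s, \<sigma> x)" and ?h = "\<lambda>(s, x). \<sigma> (simplex_push m s x)"
  have qcont: "continuous_map (prod_topology ?I ?D) (prod_topology ?I X) ?q"
    by (simp add: continuous_map_prod_top continuous)
  have qclosed: "closed_map (prod_topology ?I ?D) (prod_topology ?I X) ?q"
  proof (rule continuous_imp_closed_map [OF qcont])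
    show "compact_space (prod_topology ?I ?D)"
      by (simp add: compact_space_prod_topology compact_space_simplex_topology compact_space_subtopology)
    show "Hausdorff_space (prod_topology ?I X)"
      by (simp add: Hausdorff_space_prod_topology Hausdorff Hausdorff_space_subtopology)
  qed
  have hcont: "continuous_map (prod_topology ?I ?D) X ?h"
    using continuous_map_compose [OF continuous_map_simplex_push continuous]
    by (simp add: o_def case_prod_unfold)
  have sub: "push s z \<in> topspace X" if "0 \<le> s" "s \<le> 1" "z \<in> topspace X" for s z
    using that topspace_eq push_A push_simplex simplex_push_in_simplex by auto
  show ?thesis
    unfolding continuous_map_closedin
  proof (intro conjI allI impI)
    show "(\<lambda>(s, z). push s z) \<in> topspace (prod_topology ?I X) \<rightarrow> topspace X"
      using sub by auto
  next
    fix C assume C: "closedin X C"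
    have "{p \<in> topspace (prod_topology ?I X). (\<lambda>(s, z). push s z) p \<in> C} =
        {0..1} \<times> (A \<inter> C) \<union> ?q ` {p \<in> topspace (prod_topology ?I ?D). ?h p \<in> C}"
      (is "?L = ?R")
    proof
      show "?L \<subseteq> ?R"
      proof
        fix p assume p: "p \<in> ?L"
        then obtain s z where sz: "p = (s, z)" "0 \<le> s" "s \<le> 1" "z \<in> topspace X" "push s z \<in> C"
          by auto
        show "p \<in> ?R"
        proof (cases "z \<in> A")
          case True
          then show ?thesis using sz push_A by auto
        next
          case False
          then obtain x where x: "x \<in> standard_simplex m" "z = \<sigma> x" using sz topspace_eq by auto
          then have "(s, x) \<in> {p \<in> topspace (prod_topology ?I ?D). ?h p \<in> C}"
            using sz push_simplex by auto
          then have "?q (s, x) \<in> ?q ` {p \<in> topspace (prod_topology ?I ?D). ?h p \<in> C}"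
            by (rule imageI)
          then show ?thesis using sz x by simp
        qed
      qed
      show "?R \<subseteq> ?L"
        using topspace_eq push_A push_simplex by auto
    qed
    moreover have "closedin (prod_topology ?I X) ({0..1} \<times> (A \<inter> C))"
      using C closedin_A closedin_topspace [of ?I] by (auto simp: closedin_prod_Times_iff)
    moreover have "closedin (prod_topology ?I X) (?q ` {p \<in> topspace (prod_topology ?I ?D). ?h p \<in> C})"
      using qclosed closedin_continuous_map_preimage [OF hcont C] by (simp add: closed_map_def)
    ultimately show "closedin (prod_topology ?I X)
        {p \<in> topspace (prod_topology ?I X). (\<lambda>(s, z). push s z) p \<in> C}"
      by (simp only: closedin_Un)
  qed
qed

definition collar :: "'z set" where
  "collar = A \<union> \<sigma> ` simplex_collar m"

lemma collar_iff:
  assumes "x \<in> standard_simplex m"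
  shows "\<sigma> x \<in> collar \<longleftrightarrow> x \<in> simplex_collar m"
proof
  assume "\<sigma> x \<in> collar"
  then consider "\<sigma> x \<in> A" | y where "y \<in> simplex_collar m" "\<sigma> x = \<sigma> y"
    by (auto simp: collar_def)
  then show "x \<in> simplex_collar m"
  proof cases
    case 1
    then show ?thesis using A_iff [OF assms] simplex_frontier_subset_collar by auto
  next
    case 2
    moreover have "y \<in> standard_simplex m" using 2 by (simp add: simplex_collar_def)
    ultimately show ?thesis
      using respects_fibres [OF assms, of y] simplex_frontier_subset_collar [of m] by auto
  qed
qed (auto simp: collar_def)

lemma openin_collar: "openin X collar"
proof -
  have "closedin X (\<sigma> ` (standard_simplex m - simplex_collar m))"
    using closed_map openin_simplex_collar [of m]
    by (metis closed_map_def closedin_diff closedin_topspace topspace_standard_simplex)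
  moreover have "collar = topspace X - \<sigma> ` (standard_simplex m - simplex_collar m)"
  proof -
    have "z \<notin> \<sigma> ` (standard_simplex m - simplex_collar m)" if "z \<in> collar" for z
      using that collar_iff by auto
    moreover have "collar \<subseteq> topspace X"
      using topspace_eq by (auto simp: collar_def simplex_collar_def)
    moreover have "z \<in> collar" if "z \<in> topspace X" "z \<notin> \<sigma> ` (standard_simplex m - simplex_collar m)" for z
      using that topspace_eq by (auto simp: collar_def)
    ultimately show ?thesis by blast
  qed
  ultimately show ?thesis by (simp add: openin_diff)
qed

text \<open>\<open>push 1\<close> is a homotopy inverse of the inclusion of pairs: it sends the
  collar into \<open>A\<close>, and every \<open>push s\<close> preserves both subspaces.\<close>

lemma iso_hom_induced_collar:
  "hom_induced k X A X collar id
   \<in> iso (relative_homology_group k X A) (relative_homology_group k X collar)"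
proof -
  \<comment> \<open>The side condition \<open>P\<close> stays arbitrary because one composite has to
    preserve \<open>A\<close> and the other the collar.\<close>
  have push: "homotopic_with P X X (push 1) id"
    if "\<And>s. 0 \<le> s \<Longrightarrow> s \<le> 1 \<Longrightarrow> P (push s)"
      and P: "\<And>f g. (\<And>x. x \<in> topspace X \<Longrightarrow> f x = g x) \<Longrightarrow> P f \<longleftrightarrow> P g" for P
  proof -
    have "homotopic_with P X X (push 0) (push 1)"
      unfolding homotopic_with_def
      using continuous_map_push that(1)
      by (intro exI [of _ "\<lambda>(s, x). push s x"]) auto
    then have "homotopic_with P X X (push 1) (push 0)"
      by (simp add: homotopic_with_sym)
    moreover have "push 0 z = z" if "z \<in> topspace X" for z
      using that topspace_eq push_A push_simplex simplex_push_0 by auto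
    ultimately show ?thesis
      by (elim homotopic_with_eq [OF _ _ _ P]) simp_all
  qed
  have cont: "continuous_map X X (push 1)"
    using push [of "\<lambda>_. True"] homotopic_with_imp_continuous_maps by blast
  have coll: "push s \<in> collar \<rightarrow> collar" if "0 \<le> s" "s \<le> 1" for s
    using that push_A push_simplex simplex_push_collar by (auto simp: collar_def simplex_collar_def)
  have coll1: "push 1 \<in> collar \<rightarrow> A"
    using push_A push_simplex simplex_push_1_collar frontier by (auto simp: collar_def simplex_collar_def)
  have ss: "A \<subseteq> topspace X" "collar \<subseteq> topspace X"
    using topspace_eq by (auto simp: collar_def simplex_collar_def)
  show ?thesis
  proof (rule homotopy_equivalence_relative_homology_group_isomorphism [where g = "push 1"])
    show "homotopic_with (\<lambda>h. h \<in> A \<rightarrow> A) X X (push 1 \<circ> id) id"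
      unfolding o_id using ss by (intro push) (auto simp: push_A Pi_iff subset_eq)
    show "homotopic_with (\<lambda>h. h \<in> collar \<rightarrow> collar) X X (id \<circ> push 1) id"
      unfolding id_o using ss coll by (intro push) (auto simp: Pi_iff subset_eq)
  qed (use coll1 cont in \<open>auto simp: collar_def\<close>)
qed

end

text \<open>The simplex is itself attached to its own frontier by the identity.\<close>

lemma iso_hom_induced_simplex_collar:
  "hom_induced k (simplex_topology m) (simplex_frontier m) (simplex_topology m) (simplex_collar m) id
   \<in> iso (relative_homology_group k (simplex_topology m) (simplex_frontier m))
         (relative_homology_group k (simplex_topology m) (simplex_collar m))"
proof -
  interpret attached_simplex "simplex_topology m" "simplex_frontier m" m id
    by standard (use closedin_simplex_frontier [of m] in
        \<open>auto simp: Hausdorff_space_simplex_topology topspace_standard_simplex simplex_frontier_def\<close>)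
  show ?thesis
    using iso_hom_induced_collar [of k] simplex_frontier_subset_collar [of m]
    by (simp add: collar_def sup_absorb2)
qed

context attached_simplex
begin

text \<open>A closed map stays closed when restricted to the full preimage of a subset, and over the
  complement of \<open>A\<close> the map is bijective.\<close>

lemma homeomorphic_interior:
  "homeomorphic_map (subtopology (simplex_topology m) (standard_simplex m - simplex_frontier m))
     (subtopology X (topspace X - A)) \<sigma>"
proof -
  let ?D = "simplex_topology m" and ?U = "standard_simplex m - simplex_frontier m"
  have im: "\<sigma> ` ?U = topspace X - A"
    using topspace_eq A_iff frontier by (auto simp: image_iff)
  have "closed_map (subtopology ?D ?U) (subtopology X (topspace X - A)) \<sigma>"
  proof (rule closed_map_restriction [OF closed_map])
    show "{x \<in> topspace ?D. \<sigma> x \<in> topspace X - A} = ?U"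
      using topspace_eq A_iff by (auto simp: topspace_standard_simplex)
  qed
  moreover have "continuous_map (subtopology ?D ?U) (subtopology X (topspace X - A)) \<sigma>"
    using continuous im by (auto simp: continuous_map_in_subtopology continuous_map_from_subtopology)
  ultimately show ?thesis
    using im inj by (intro bijective_closed_imp_homeomorphic_map)
      (auto simp: topspace_standard_simplex inj_on_def)
qed

text \<open>After thickening to collars, the frontier and \<open>A\<close> can be excised, since
  each is closed in an open collar; what remains on the two sides is related by a homeomorphism.
  Naturality then allows the comparison isomorphisms to be cancelled, first for the collars and then
  for the frontier and \<open>A\<close>.\<close>

lemma iso_hom_induced_simplex:
  "hom_induced k (simplex_topology m) (simplex_frontier m) X A \<sigma>
   \<in> iso (relative_homology_group k (simplex_topology m) (simplex_frontier m))
         (relative_homology_group k X A)"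
proof -
  let ?D = "simplex_topology m" and ?F = "simplex_frontier m" and ?C = "simplex_collar m"
  let ?D' = "subtopology ?D (standard_simplex m - ?F)" and ?X' = "subtopology X (topspace X - A)"
  note FC = simplex_frontier_subset_collar [of m]
  have CS: "?C \<subseteq> standard_simplex m" by (auto simp: simplex_collar_def)
  have AX: "A \<subseteq> topspace X" and AC: "A \<subseteq> collar" and CX: "collar \<subseteq> topspace X"
    using topspace_eq CS by (auto simp: collar_def)
  have e1: "hom_induced k ?D' (?C - ?F) ?D ?C id
      \<in> iso (relative_homology_group k ?D' (?C - ?F)) (relative_homology_group k ?D ?C)"
    using homology_excision_axiom [of ?D ?F ?C "standard_simplex m" k] FC CS
      closedin_simplex_frontier [of m] openin_simplex_collar [of m]
    by (simp add: closure_of_closedin interior_of_openin subtopology_subtopology)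
  have e2: "hom_induced k ?X' (collar - A) X collar id
      \<in> iso (relative_homology_group k ?X' (collar - A)) (relative_homology_group k X collar)"
    using homology_excision_axiom [of X A collar "topspace X" k] AC CX closedin_A openin_collar
    by (simp add: closure_of_closedin interior_of_openin)
  have "\<sigma> ` (?C - ?F) = collar - A"
  proof
    show "\<sigma> ` (?C - ?F) \<subseteq> collar - A"
      using CS A_iff by (auto simp: collar_def)
    show "collar - A \<subseteq> \<sigma> ` (?C - ?F)"
      using frontier by (auto simp: collar_def)
  qed
  then have f: "hom_induced k ?D' (?C - ?F) ?X' (collar - A) \<sigma>
      \<in> iso (relative_homology_group k ?D' (?C - ?F)) (relative_homology_group k ?X' (collar - A))"
    using CS by (intro homeomorphic_map_relative_homology_iso [OF homeomorphic_interior])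
      (auto simp: topspace_standard_simplex)
  have cD: "continuous_map ?D' ?D id" "continuous_map ?X' X id" "continuous_map ?D' ?X' \<sigma>"
    using homeomorphic_interior homeomorphic_imp_continuous_map
    by (auto simp: continuous_map_from_subtopology)
  have sC: "\<sigma> \<in> ?C \<rightarrow> collar" "\<sigma> \<in> ?F \<rightarrow> A" "\<sigma> \<in> ?C - ?F \<rightarrow> collar - A"
    using \<open>\<sigma> ` (?C - ?F) = collar - A\<close> frontier by (auto simp: collar_def)
  let ?s = "hom_induced k ?D ?C X collar \<sigma>"
  have eq1: "?s \<circ> hom_induced k ?D' (?C - ?F) ?D ?C id =
      hom_induced k ?X' (collar - A) X collar id \<circ> hom_induced k ?D' (?C - ?F) ?X' (collar - A) \<sigma>"
    using cD continuous sC by (simp flip: hom_induced_compose)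
  have bij1: "bij_betw (hom_induced k ?X' (collar - A) X collar id \<circ> hom_induced k ?D' (?C - ?F) ?X' (collar - A) \<sigma>)
      (carrier (relative_homology_group k ?D' (?C - ?F))) (carrier (relative_homology_group k X collar))"
    by (rule bij_betw_trans [OF iso_imp_bij_betw [OF f] iso_imp_bij_betw [OF e2]])
  have s: "bij_betw ?s (carrier (relative_homology_group k ?D ?C)) (carrier (relative_homology_group k X collar))"
    by (rule iffD2 [OF bij_betw_comp_iff [OF iso_imp_bij_betw [OF e1]]]) (simp only: eq1 bij1)
  let ?t = "hom_induced k ?D ?F X A \<sigma>"
  have eq2: "hom_induced k X A X collar id \<circ> ?t = ?s \<circ> hom_induced k ?D ?F ?D ?C id"
    using continuous sC FC AC by (simp add: subset_eq Pi_iff flip: hom_induced_compose)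
  have bij2: "bij_betw (?s \<circ> hom_induced k ?D ?F ?D ?C id)
      (carrier (relative_homology_group k ?D ?F)) (carrier (relative_homology_group k X collar))"
    by (rule bij_betw_trans [OF iso_imp_bij_betw [OF iso_hom_induced_simplex_collar] s])
  have im: "?t ` carrier (relative_homology_group k ?D ?F) \<subseteq> carrier (relative_homology_group k X A)"
    using hom_induced_carrier by blast
  have "bij_betw ?t (carrier (relative_homology_group k ?D ?F)) (carrier (relative_homology_group k X A))"
    by (rule iffD2 [OF bij_betw_comp_iff2 [OF iso_imp_bij_betw [OF iso_hom_induced_collar] im]])
      (simp only: eq2 bij2)
  then show ?thesis
    by (simp add: iso_def hom_induced_hom)
qed

end

section \<open>Relative homology of a simplex and its frontier\<close>

text \<open>Chain-level form of: the relative homology is infinite cyclic on the class of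
  \<open>\<sigma>\<close> in degree \<open>m\<close>, and zero in all other degrees. Forcing
  \<open>a = 0\<close> for \<open>k \<noteq> m\<close> merges the two cases, so that later diagram
  chases need no case split.\<close>

definition generated_by_cell where
  "generated_by_cell X A m \<sigma> \<longleftrightarrow>
     (\<forall>k z. singular_relcycle k X A z \<longrightarrow>
        (\<exists>a. (k \<noteq> m \<longrightarrow> a = 0) \<and> homologous_rel k X A z (frag_cmul a (frag_of \<sigma>)))) \<and>
     (\<forall>a. singular_relboundary m X A (frag_cmul a (frag_of \<sigma>)) \<longrightarrow> a = 0)"

abbreviation id_simplex :: "nat \<Rightarrow> (nat \<Rightarrow> real) \<Rightarrow> nat \<Rightarrow> real" where
  "id_simplex m \<equiv> restrict id (standard_simplex m)"

lemma singular_simplex_id_simplex: "singular_simplex m (simplex_topology m) (id_simplex m)"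
  by (simp add: singular_simplex_def continuous_map_eq [OF continuous_map_id] topspace_standard_simplex)

lemma simplical_face_frontier:
  assumes "i \<le> Suc m" "y \<in> standard_simplex m"
  shows "simplical_face i y \<in> simplex_frontier (Suc m)"
  using assms simplical_face_in_standard_simplex [of "Suc m" i y]
  by (auto simp: simplex_frontier_def intro!: exI [of _ i]) (simp add: simplical_face_def)

text \<open>The coordinate inserted at \<open>i\<close> is 0 and the others are reindexed by
  skipping \<open>i\<close>. No simplex membership enters, so the lemma also applies to coordinates
  filtered by a vertex in \<open>chain_point_simplical_face\<close>.\<close>

lemma sum_simplical_face:
  fixes y :: "nat \<Rightarrow> real"
  assumes "i \<le> Suc m"
  shows "(\<Sum>j\<le>Suc m. simplical_face i y j) = (\<Sum>j\<le>m. y j)"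
proof -
  let ?skip = "\<lambda>j. if j < i then j else Suc j"
  have inj: "inj_on ?skip {..m}" by (auto simp: inj_on_def split: if_splits)
  have "?skip ` {..m} = {..Suc m} - {i}"
  proof
    show "{..Suc m} - {i} \<subseteq> ?skip ` {..m}"
    proof
      fix j assume j: "j \<in> {..Suc m} - {i}"
      then have "j = ?skip (if j < i then j else j - 1)" "(if j < i then j else j - 1) \<le> m"
        using assms by auto
      then show "j \<in> ?skip ` {..m}" by blast
    qed
  qed auto
  then have "(\<Sum>j\<in>{..Suc m} - {i}. simplical_face i y j) = (\<Sum>j\<le>m. simplical_face i y (?skip j))"
    using sum.reindex [OF inj, of "simplical_face i y"] by simp
  also have "\<dots> = (\<Sum>j\<le>m. y j)"
    by (intro sum.cong) (auto simp: simplical_face_def)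
  finally show ?thesis
    using assms by (subst sum.remove [of _ i]) (auto simp: simplical_face_def)
qed

lemma simplical_face_surj:
  assumes x: "x \<in> standard_simplex (Suc m)" and i: "i \<le> Suc m" "x i = 0"
  obtains y where "y \<in> standard_simplex m" "x = simplical_face i y"
proof
  let ?y = "\<lambda>j. if j < i then x j else x (Suc j)"
  show eq: "x = simplical_face i ?y"
    using i by (auto simp: simplical_face_def fun_eq_iff)
  have "(\<Sum>j\<le>m. ?y j) = 1"
    using sum_simplical_face [OF i(1), of ?y] x unfolding eq [symmetric] by (simp add: standard_simplex_def)
  then show "?y \<in> standard_simplex m"
    using x i by (auto simp: standard_simplex_def)
qed

lemma simplex_frontier_0: "simplex_frontier 0 = {}"
  by (auto simp: simplex_frontier_def standard_simplex_0)

lemma singular_relcycle_id_simplex: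
  "singular_relcycle m (simplex_topology m) (simplex_frontier m) (frag_of (id_simplex m))"
proof (cases m)
  case 0
  then show ?thesis
    using singular_simplex_id_simplex [of m]
    by (simp add: singular_relcycle_def singular_chain_of chain_boundary_def)
next
  case (Suc n)
  have "singular_simplex n (subtopology (simplex_topology m) (simplex_frontier m))
      (singular_face m i (id_simplex m))" if "i \<le> m" for i
    using singular_simplex_singular_face [OF singular_simplex_id_simplex, of m i] that Suc
      simplical_face_frontier [of i n] simplical_face_in_standard_simplex [of m i]
    by (auto simp: singular_simplex_subtopology singular_face_def)
  then have "singular_chain n (subtopology (simplex_topology m) (simplex_frontier m))
      (chain_boundary m (frag_of (id_simplex m)))"
    using Suc by (auto simp: chain_boundary_of singular_chain_of simp del: sum.atMost_Suc
        intro!: singular_chain_sum singular_chain_cmul)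
  then show ?thesis
    using singular_simplex_id_simplex [of m] Suc by (simp add: singular_relcycle singular_chain_of)
qed

text \<open>The isomorphism induced by \<open>\<sigma>\<close> carries the class of the identity
  simplex to that of \<open>\<sigma>\<close>: surjectivity transports the first clause, injectivity
  the second.\<close>

lemma (in attached_simplex) generated_by_cell:
  assumes gen: "generated_by_cell (simplex_topology m) (simplex_frontier m) m (id_simplex m)"
    and \<sigma>: "singular_simplex m X \<sigma>"
  shows "generated_by_cell X A m \<sigma>"
  unfolding generated_by_cell_def
proof (intro conjI allI impI)
  let ?D = "simplex_topology m" and ?F = "simplex_frontier m"
  have FA: "\<sigma> \<in> ?F \<rightarrow> A" using frontier by blast
  note bij = iso_imp_bij_betw [OF iso_hom_induced_simplex]
  have map_id: "chain_map m \<sigma> (frag_of (id_simplex m)) = frag_of \<sigma>"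
    by (rule singular_simplex_chain_map_id [OF \<sigma>])
  fix k z assume z: "singular_relcycle k X A z"
  then have "homologous_rel_set k X A z \<in> carrier (relative_homology_group (int k) X A)"
    by (simp add: carrier_relative_homology_group)
  also have "\<dots> = hom_induced (int k) ?D ?F X A \<sigma> ` carrier (relative_homology_group (int k) ?D ?F)"
    by (rule bij_betw_imp_surj_on [OF bij, symmetric])
  finally obtain c where c: "homologous_rel_set k X A z = hom_induced (int k) ?D ?F X A \<sigma> c"
      "c \<in> carrier (relative_homology_group (int k) ?D ?F)"
    by (rule imageE)
  from c(2) obtain y where y: "singular_relcycle k ?D ?F y" "c = homologous_rel_set k ?D ?F y"
    unfolding carrier_relative_homology_group by blast
  have "homologous_rel_set k X A z = homologous_rel_set k X A (chain_map k \<sigma> y)"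
    using c(1) hom_induced_chain_map [OF continuous FA y(1)] y(2) by simp
  then have zy: "homologous_rel k X A z (chain_map k \<sigma> y)"
    by (simp only: homologous_rel_set_eq)
  obtain a where a: "k \<noteq> m \<longrightarrow> a = 0" "homologous_rel k ?D ?F y (frag_cmul a (frag_of (id_simplex m)))"
    using gen y(1) unfolding generated_by_cell_def by blast
  have "homologous_rel k X A (chain_map k \<sigma> y) (frag_cmul a (frag_of \<sigma>))"
    using singular_relboundary_chain_map [OF a(2) [unfolded homologous_rel_def] continuous FA] a(1) map_id
    by (cases "k = m") (auto simp: homologous_rel_def chain_map_diff)
  with zy a(1) show "\<exists>a. (k \<noteq> m \<longrightarrow> a = 0) \<and> homologous_rel k X A z (frag_cmul a (frag_of \<sigma>))"
    using homologous_rel_trans by blast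
next
  let ?D = "simplex_topology m" and ?F = "simplex_frontier m"
  have FA: "\<sigma> \<in> ?F \<rightarrow> A" using frontier by blast
  fix a assume a: "singular_relboundary m X A (frag_cmul a (frag_of \<sigma>))"
  let ?c = "frag_cmul a (frag_of (id_simplex m))"
  have c: "singular_relcycle m ?D ?F ?c"
    by (intro singular_relcycle_cmul singular_relcycle_id_simplex)
  have "hom_induced (int m) ?D ?F X A \<sigma> (homologous_rel_set m ?D ?F ?c)
      = hom_induced (int m) ?D ?F X A \<sigma> (homologous_rel_set m ?D ?F 0)"
    using a unfolding hom_induced_chain_map [OF continuous FA c]
      hom_induced_chain_map [OF continuous FA singular_relcycle_0] homologous_rel_set_eq
    by (simp add: singular_simplex_chain_map_id [OF \<sigma>] del: chain_map_of) (simp add: homologous_rel_def)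
  moreover have "homologous_rel_set m ?D ?F ?c \<in> carrier (relative_homology_group (int m) ?D ?F)"
    "homologous_rel_set m ?D ?F 0 \<in> carrier (relative_homology_group (int m) ?D ?F)"
    using c unfolding carrier_relative_homology_group by (auto intro!: imageI)
  ultimately have "homologous_rel_set m ?D ?F ?c = homologous_rel_set m ?D ?F 0"
    using bij_betw_imp_inj_on [OF iso_imp_bij_betw [OF iso_hom_induced_simplex, of "int m"]]
    by (meson inj_onD)
  then have "singular_relboundary m ?D ?F ?c"
    unfolding homologous_rel_set_eq by (simp add: homologous_rel_def)
  then show "a = 0"
    using gen unfolding generated_by_cell_def by blast
qed

section \<open>Cycles in star-shaped sets\<close>

lemma homologous_rel_star:
  fixes S :: "(nat \<Rightarrow> real) set"
  assumes star: "\<And>x u. \<lbrakk>x \<in> S; 0 \<le> u; u \<le> 1\<rbrakk> \<Longrightarrow> (\<lambda>i. (1 - u) * x i + u * v i) \<in> S"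
    and z: "singular_relcycle k (subtopology (powertop_real UNIV) S) T z"
    and T: "T = {} \<or> k = 0"
  shows "homologous_rel k (subtopology (powertop_real UNIV) S) {} z (chain_map k (\<lambda>_. v) z)"
proof -
  let ?S = "subtopology (powertop_real UNIV) S"
  have z': "singular_relcycle k ?S {} z"
    using z T by (auto simp: singular_cycle singular_relcycle chain_boundary_def)
  let ?P = "prod_topology (top_of_set {0..1::real}) ?S"
  have c1: "continuous_map ?P euclideanreal fst"
    using continuous_map_fst continuous_map_into_fulltopology by blast
  have c2: "continuous_map ?P (powertop_real UNIV) snd"
    using continuous_map_snd continuous_map_into_fulltopology by blast
  have "continuous_map ?P euclideanreal (\<lambda>p. (1 - fst p) * snd p i + fst p * v i)" for i
    using continuous_map_compose [OF c2 continuous_map_coord]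
    by (intro continuous_map_add continuous_map_real_mult continuous_map_diff c1) (auto simp: o_def)
  then have "continuous_map ?P ?S (\<lambda>p i. (1 - fst p) * snd p i + fst p * v i)"
    using star by (auto simp: continuous_map_in_subtopology continuous_map_componentwise_UNIV)
  then have "homotopic_with (\<lambda>h. h \<in> {} \<rightarrow> {}) ?S ?S id (\<lambda>_. v)"
    unfolding homotopic_with_def
    by (intro exI [of _ "\<lambda>p i. (1 - fst p) * snd p i + fst p * v i"]) auto
  from homotopic_imp_homologous_rel_chain_maps [OF this z'] show ?thesis
    using chain_map_ident [of k ?S z] z' by (simp add: singular_cycle)
qed

text \<open>The straight-line homotopy moves the cycle to the point \<open>v\<close>, where cycles
  of positive degree bound. In degree 0 the coefficient sum must vanish; a filling of
  \<open>z\<close> in any space witnesses this, because the constant map pushes the filling to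
  \<open>v\<close> as well.\<close>

lemma star_cycle_bounds:
  fixes S :: "(nat \<Rightarrow> real) set"
  assumes star: "\<And>x u. \<lbrakk>x \<in> S; 0 \<le> u; u \<le> 1\<rbrakk> \<Longrightarrow> (\<lambda>i. (1 - u) * x i + u * v i) \<in> S"
    and v: "v \<in> S"
    and z: "singular_relcycle k (subtopology (powertop_real UNIV) S) {} z"
    and k0: "k = 0 \<Longrightarrow> \<exists>X d. singular_chain (Suc 0) X d \<and> chain_boundary (Suc 0) d = z"
  shows "singular_relboundary k (subtopology (powertop_real UNIV) S) {} z"
proof -
  let ?S = "subtopology (powertop_real UNIV) S" and ?c = "\<lambda>_::nat\<Rightarrow>real. v"
  let ?V = "subtopology ?S {v}"
  have V: "topspace ?V = {v}" using v by auto
  have cont: "continuous_map X ?V ?c" for X :: "(nat \<Rightarrow> real) topology"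
    using v by (auto simp: continuous_map_in_subtopology)
  have "singular_relboundary k ?V {} (chain_map k ?c z)"
  proof (cases "k = 0")
    case True
    then obtain X d where d: "singular_chain (Suc 0) X d" "chain_boundary (Suc 0) d = z"
      using k0 by blast
    have "chain_map 0 ?c z = chain_boundary (Suc 0) (chain_map (Suc 0) ?c d)"
      using chain_boundary_chain_map [OF d(1), of ?c] d(2) by simp
    then show ?thesis
      using True singular_chain_chain_map [OF d(1) cont] by (auto simp: singular_boundary)
  next
    case False
    then show ?thesis
      using singular_boundary_eq_cycle_singleton [OF V, of k] singular_relcycle_chain_map [OF z cont, of "{}"]
      by simp
  qed
  then have "singular_relboundary k ?S {} (chain_map k ?c z)"
    using singular_boundary_mono [of "{v}" UNIV k ?S] by (metis subset_UNIV subtopology_UNIV)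
  moreover have "singular_relboundary k ?S {} (z - chain_map k ?c z)"
    using homologous_rel_star [OF star z] by (simp add: homologous_rel_def)
  ultimately have "singular_relboundary k ?S {} (z - chain_map k ?c z + chain_map k ?c z)"
    by (intro singular_relboundary_add)
  then show ?thesis by simp
qed

text \<open>
  The frontier of a simplex is the union of the horn on vertex 0, which is star-shaped, and the
  opposite face, which is an attached simplex of dimension one less.
\<close>
definition simplex_horn :: "nat \<Rightarrow> (nat \<Rightarrow> real) set" where
  "simplex_horn m = {x \<in> standard_simplex m. \<exists>i. 1 \<le> i \<and> i \<le> m \<and> x i = 0}"

abbreviation vertex0 :: "nat \<Rightarrow> real" where
  "vertex0 \<equiv> (\<lambda>j. if j = 0 then 1 else 0)"

lemma standard_simplex_star:
  "\<lbrakk>x \<in> standard_simplex m; 0 \<le> u; u \<le> 1\<rbrakk> \<Longrightarrow> (\<lambda>i. (1 - u) * x i + u * vertex0 i) \<in> standard_simplex m"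
  using convex_standard_simplex [of x m vertex0 u] by simp

lemma simplex_horn_star:
  assumes "x \<in> simplex_horn m" "0 \<le> u" "u \<le> 1"
  shows "(\<lambda>i. (1 - u) * x i + u * vertex0 i) \<in> simplex_horn m"
proof -
  obtain i where i: "1 \<le> i" "i \<le> m" "x i = 0" and x: "x \<in> standard_simplex m"
    using assms(1) by (auto simp: simplex_horn_def)
  then have "(1 - u) * x i + u * vertex0 i = 0" by simp
  then show ?thesis
    using standard_simplex_star [OF x assms(2,3)] i(1,2) unfolding simplex_horn_def by blast
qed

lemma closedin_simplex_horn: "closedin (simplex_topology m) (simplex_horn m)"
proof -
  have "closedin (simplex_topology m) {x \<in> topspace (simplex_topology m). x i \<in> {0}}" for i
    by (rule closedin_continuous_map_preimage
        [OF continuous_map_from_subtopology [OF continuous_map_coord]]) simp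
  then have "closedin (simplex_topology m)
      (\<Union>i\<in>{1..m}. {x \<in> topspace (simplex_topology m). x i \<in> {0}})"
    by (intro closedin_Union) auto
  also have "(\<Union>i\<in>{1..m}. {x \<in> topspace (simplex_topology m). x i \<in> {0}}) = simplex_horn m"
    by (auto simp: simplex_horn_def topspace_standard_simplex)
  finally show ?thesis .
qed

lemma singular_face_id_simplex:
  "i \<le> Suc m \<Longrightarrow> singular_face (Suc m) i (id_simplex (Suc m)) = restrict (simplical_face i) (standard_simplex m)"
  using simplical_face_in_standard_simplex [of "Suc m" i] by (auto simp: singular_face_def restrict_def)

lemma attached_simplex_horn:
  "attached_simplex (subtopology (powertop_real UNIV) (simplex_frontier (Suc m))) (simplex_horn (Suc m)) m
     (singular_face (Suc m) 0 (id_simplex (Suc m)))"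
  (is "attached_simplex ?X ?A m ?f")
proof -
  let ?S = "simplex_topology (Suc m)"
  have f: "?f = restrict (simplical_face 0) (standard_simplex m)"
    by (rule singular_face_id_simplex) simp
  have FS: "simplex_frontier (Suc m) \<subseteq> standard_simplex (Suc m)" and HF: "?A \<subseteq> simplex_frontier (Suc m)"
    by (auto simp: simplex_frontier_def simplex_horn_def)
  have X: "?X = subtopology ?S (simplex_frontier (Suc m))"
    by (simp add: simplex_topology_subset FS)
  \<comment> \<open>Face 0 inserts a leading zero and shifts the indices by one, so the face meets
    the horn exactly in its own frontier.\<close>
  have sub: "(\<exists>i\<ge>1. i \<le> Suc m \<and> simplical_face 0 x i = 0) \<longleftrightarrow> (\<exists>i\<le>m. x i = 0)" for x :: "nat \<Rightarrow> real"
  proof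
    assume "\<exists>i\<ge>1. i \<le> Suc m \<and> simplical_face 0 x i = 0"
    then obtain i where "1 \<le> i" "i \<le> Suc m" "simplical_face 0 x i = 0" by blast
    then have "i - 1 \<le> m \<and> x (i - 1) = 0" by (auto simp: simplical_face_def)
    then show "\<exists>i\<le>m. x i = 0" by blast
  next
    assume "\<exists>i\<le>m. x i = 0"
    then obtain i where "i \<le> m" "x i = 0" by blast
    then have "1 \<le> Suc i \<and> Suc i \<le> Suc m \<and> simplical_face 0 x (Suc i) = 0"
      by (auto simp: simplical_face_def)
    then show "\<exists>i\<ge>1. i \<le> Suc m \<and> simplical_face 0 x i = 0" by blast
  qed
  have face: "simplical_face 0 x \<in> ?A \<longleftrightarrow> x \<in> simplex_frontier m" if "x \<in> standard_simplex m" for x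
    using that simplical_face_in_standard_simplex [of "Suc m" 0 x] sub [of x]
    by (simp add: simplex_horn_def simplex_frontier_def)
  show ?thesis
  proof
    show "Hausdorff_space ?X"
      unfolding X by (intro Hausdorff_space_subtopology Hausdorff_space_simplex_topology)
    show "closedin ?X ?A"
      unfolding X using closedin_simplex_horn HF by (simp add: closedin_subset_topspace)
    show "continuous_map (simplex_topology m) ?X ?f"
    proof -
      have "singular_simplex m ?S ?f"
        using singular_simplex_singular_face [OF singular_simplex_id_simplex, of "Suc m" 0] by simp
      then show ?thesis
        using simplical_face_frontier [of 0 m] unfolding X f
        by (auto simp: singular_simplex_def continuous_map_in_subtopology topspace_standard_simplex)
    qed
    show "topspace ?X = ?A \<union> ?f ` standard_simplex m"
    proof
      show "topspace ?X \<subseteq> ?A \<union> ?f ` standard_simplex m"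
      proof
        fix x assume "x \<in> topspace ?X"
        then obtain i where x: "x \<in> standard_simplex (Suc m)" "i \<le> Suc m" "x i = 0"
          by (auto simp: simplex_frontier_def)
        show "x \<in> ?A \<union> ?f ` standard_simplex m"
        proof (cases "i = 0")
          case True
          then obtain y where "y \<in> standard_simplex m" "x = simplical_face 0 y"
            using simplical_face_surj [OF x] by blast
          then show ?thesis by (auto simp: f)
        next
          case False
          then have "1 \<le> i" by simp
          then show ?thesis using x by (auto simp: simplex_horn_def)
        qed
      qed
      show "?A \<union> ?f ` standard_simplex m \<subseteq> topspace ?X"
        using HF simplical_face_frontier [of 0 m] by (auto simp: f)
    qed
    show "?f ` simplex_frontier m \<subseteq> ?A"
      using face by (auto simp: f simplex_frontier_def)
    show "x \<in> simplex_frontier m" if "x \<in> standard_simplex m" "?f x \<in> ?A" for x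
      using that face by (simp add: f)
    have "x i = y i" if "simplical_face 0 x = simplical_face 0 y" for x y :: "nat \<Rightarrow> real" and i
      using fun_cong [OF that, of "Suc i"] by (simp add: simplical_face_def)
    then show "inj_on ?f (standard_simplex m - simplex_frontier m)"
      by (auto simp: f inj_on_def)
  qed
qed


text \<open>The faces of positive index lie in the horn, and face 0 enters the boundary with sign
  +1.\<close>

lemma chain_boundary_id_simplex_horn:
  "\<exists>e. singular_chain m (subtopology (powertop_real UNIV) (simplex_horn (Suc m))) e \<and>
     chain_boundary (Suc m) (frag_of (id_simplex (Suc m))) =
       frag_of (singular_face (Suc m) 0 (id_simplex (Suc m))) + e"
proof -
  let ?f = "\<lambda>i. singular_face (Suc m) i (id_simplex (Suc m))"
  let ?H = "subtopology (powertop_real UNIV) (simplex_horn (Suc m))"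
  define e where "e = (\<Sum>i\<in>{1..Suc m}. frag_cmul ((-1) ^ i) (frag_of (?f i)))"
  have "singular_simplex m ?H (?f i)" if "i \<in> {1..Suc m}" for i
  proof -
    have "singular_simplex m (simplex_topology (Suc m)) (?f i)"
      using singular_simplex_singular_face [OF singular_simplex_id_simplex, of "Suc m" i] that by simp
    moreover have "simplical_face i y \<in> simplex_horn (Suc m)" if "y \<in> standard_simplex m" for y
    proof -
      have "simplical_face i y i = 0" by (simp add: simplical_face_def)
      then show ?thesis
        using that \<open>i \<in> {1..Suc m}\<close> simplical_face_in_standard_simplex [of "Suc m" i y]
        by (auto simp: simplex_horn_def)
    qed
    moreover have "?f i = restrict (simplical_face i) (standard_simplex m)"
      using that by (intro singular_face_id_simplex) simp
    ultimately show ?thesis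
      by (auto simp: singular_simplex_subtopology)
  qed
  then have "singular_chain m ?H e"
    unfolding e_def by (intro singular_chain_sum singular_chain_cmul) (simp add: singular_chain_of)
  moreover have "{..Suc m} = insert 0 {1..Suc m}" by auto
  then have "chain_boundary (Suc m) (frag_of (id_simplex (Suc m))) = frag_of (?f 0) + e"
    by (simp add: chain_boundary_of e_def del: sum.atMost_Suc)
  ultimately show ?thesis by blast
qed

lemma cycle_simplex_bounds:
  assumes "singular_relcycle (Suc k) (simplex_topology m) {} z"
  shows "singular_relboundary (Suc k) (simplex_topology m) {} z"
  using star_cycle_bounds [of "standard_simplex m" vertex0, OF standard_simplex_star _ assms] by simp

text \<open>The filling \<open>y\<close> in the whole simplex makes \<open>w\<close> a cycle and, in
  degree 0, shows that its coefficients sum to 0.\<close>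

lemma cycle_horn_bounds:
  assumes "singular_chain k (subtopology (powertop_real UNIV) (simplex_horn (Suc m))) w"
    and "singular_chain (Suc k) (simplex_topology (Suc m)) y" "chain_boundary (Suc k) y = w"
  shows "singular_relboundary k (subtopology (powertop_real UNIV) (simplex_horn (Suc m))) {} w"
proof (rule star_cycle_bounds [of _ vertex0])
  show "vertex0 \<in> simplex_horn (Suc m)"
    by (auto simp: simplex_horn_def intro: exI [of _ 1])
  show "singular_relcycle k (subtopology (powertop_real UNIV) (simplex_horn (Suc m))) {} w"
    using assms chain_boundary_boundary_alt by (auto simp: singular_cycle)
qed (use assms simplex_horn_star in blast)+

text \<open>Chain-level dimension shift. The boundary map relates the pair (simplex, frontier) to
  the pair (frontier, horn), since simplex and horn are star-shaped; the latter pair is an attached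
  simplex of one dimension less, covered by the induction hypothesis.\<close>

lemma generated_by_cell_simplex:
  "generated_by_cell (simplex_topology m) (simplex_frontier m) m (id_simplex m)"
proof (induction m)
  case 0
  let ?D = "simplex_topology 0"
  have D: "topspace ?D = {vertex0}" by (auto simp: standard_simplex_0)
  have id: "id_simplex 0 = restrict (\<lambda>x. vertex0) (standard_simplex 0)"
    by (auto simp: standard_simplex_0 restrict_def)
  show ?case
    unfolding generated_by_cell_def simplex_frontier_0
  proof (intro conjI allI impI)
    fix k z assume z: "singular_relcycle k ?D {} z"
    show "\<exists>a. (k \<noteq> 0 \<longrightarrow> a = 0) \<and> homologous_rel k ?D {} z (frag_cmul a (frag_of (id_simplex 0)))"
    proof (cases "k = 0")
      case True
      then obtain b where "z = frag_cmul b (frag_of (id_simplex 0))"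
        using z singular_chain_singleton [OF D, of 0 z] unfolding id by (auto simp: singular_cycle)
      then show ?thesis using True by (intro exI [of _ b]) simp
    next
      case False
      then show ?thesis
        using z singular_boundary_eq_cycle_singleton [OF D, of k z]
        by (auto simp: homologous_rel_def intro!: exI [of _ 0])
    qed
  next
    fix a assume "singular_relboundary 0 ?D {} (frag_cmul a (frag_of (id_simplex 0)))"
    then have "frag_cmul a (frag_of (id_simplex 0)) = 0"
      using singular_boundary_singleton [OF D] by blast
    then show "a = 0" by simp
  qed
next
  case (Suc m)
  let ?D = "simplex_topology (Suc m)" and ?F = "simplex_frontier (Suc m)" and ?H = "simplex_horn (Suc m)"
  let ?R = "powertop_real UNIV :: (nat \<Rightarrow> real) topology"
  let ?B = "subtopology ?R ?F"
  let ?i = "id_simplex (Suc m)" and ?f = "singular_face (Suc m) 0 (id_simplex (Suc m))"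
  have FS: "?F \<subseteq> standard_simplex (Suc m)" and HF: "?H \<subseteq> ?F"
    by (auto simp: simplex_frontier_def simplex_horn_def)
  have BF: "subtopology ?D ?F = ?B" and BH: "subtopology ?B ?H = subtopology ?R ?H"
    using FS HF by (simp_all add: subtopology_subtopology inf.absorb2)
  interpret attached_simplex ?B ?H m ?f by (rule attached_simplex_horn)
  have gen: "generated_by_cell ?B ?H m ?f"
  proof (rule generated_by_cell [OF Suc.IH])
    show "singular_simplex m ?B ?f"
      using continuous by (simp add: singular_simplex_def singular_face_def)
  qed
  obtain h where h: "singular_chain m (subtopology ?R ?H) h"
      "chain_boundary (Suc m) (frag_of ?i) = frag_of ?f + h"
    using chain_boundary_id_simplex_horn by blast
  show ?case
    unfolding generated_by_cell_def
  proof (intro conjI allI impI)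
    fix k z assume z: "singular_relcycle k ?D ?F z"
    show "\<exists>a. (k \<noteq> Suc m \<longrightarrow> a = 0) \<and> homologous_rel k ?D ?F z (frag_cmul a (frag_of ?i))"
    proof (cases k)
      case 0
      \<comment> \<open>A 0-chain can be contracted to \<open>vertex0\<close>, which lies in the
        frontier because the dimension is positive.\<close>
      let ?c = "\<lambda>_::nat\<Rightarrow>real. vertex0"
      have "homologous_rel 0 ?D {} z (chain_map 0 ?c z)"
        using homologous_rel_star [OF standard_simplex_star, where k = 0 and T = ?F and z = z] z 0 by simp
      then obtain d where d: "singular_chain (Suc 0) ?D d" "chain_boundary (Suc 0) d = z - chain_map 0 ?c z"
        by (auto simp: homologous_rel_def singular_boundary)
      have "vertex0 \<in> ?F"
        by (auto simp: simplex_frontier_def intro: exI [of _ "Suc 0"])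
      then have "singular_chain 0 (subtopology ?D ?F) (chain_map 0 ?c z)"
        using z 0 by (intro singular_chain_chain_map [of 0 ?D]) (auto simp: singular_relcycle BF continuous_map_in_subtopology)
      then have "singular_relboundary 0 ?D ?F z"
        using d by (auto simp: singular_relboundary)
      then show ?thesis using 0 by (auto simp: homologous_rel_def intro!: exI [of _ 0])
    next
      case (Suc j)
      have zc: "singular_chain (Suc j) ?D z" and zb: "singular_chain j ?B (chain_boundary (Suc j) z)"
        using z Suc BF by (auto simp: singular_relcycle)
      then have "singular_relcycle j ?B ?H (chain_boundary (Suc j) z)"
        using chain_boundary_boundary_alt [OF zc] by (simp add: singular_relcycle)
      then obtain a where a: "j \<noteq> m \<longrightarrow> a = 0"
          "singular_relboundary j ?B ?H (chain_boundary (Suc j) z - frag_cmul a (frag_of ?f))"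
        using gen unfolding generated_by_cell_def homologous_rel_def by blast
      then obtain e w where e: "singular_chain (Suc j) ?B e" and w: "singular_chain j (subtopology ?R ?H) w"
          and ew: "chain_boundary (Suc j) e + w = chain_boundary (Suc j) z - frag_cmul a (frag_of ?f)"
        by (auto simp: singular_relboundary BH)
      \<comment> \<open>Removing the expected multiple of the cell and a chain \<open>e\<close> in
        the frontier leaves a chain whose boundary lies in the horn. A filling \<open>w'\<close> of
        that boundary in the horn turns \<open>y - w'\<close> into an absolute cycle of the
        contractible simplex.\<close>
      define y where "y = z - frag_cmul a (frag_of ?i) - e"
      have aj: "singular_chain (Suc j) ?D (frag_cmul a (frag_of ?i))"
        "singular_chain j (subtopology ?R ?H) (frag_cmul a h)"
        using a(1) h(1) singular_simplex_id_simplex [of "Suc m"]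
        by (cases "j = m"; simp add: singular_chain_cmul singular_chain_of)+
      have yc: "singular_chain (Suc j) ?D y"
        unfolding y_def using zc aj e FS singular_chain_mono by (blast intro: singular_chain_diff)
      have "chain_boundary (Suc j) (frag_cmul a (frag_of ?i)) = frag_cmul a (frag_of ?f) + frag_cmul a h"
        using a(1) h(2) by (cases "j = m") (simp_all add: chain_boundary_cmul frag_cmul_distrib2)
      then have yb: "chain_boundary (Suc j) y = w - frag_cmul a h"
        using ew by (simp add: y_def chain_boundary_diff chain_boundary_add algebra_simps)
      have wc: "singular_chain j (subtopology ?R ?H) (w - frag_cmul a h)"
        using w aj by (intro singular_chain_diff)
      then obtain w' where w': "singular_chain (Suc j) (subtopology ?R ?H) w'"
          "chain_boundary (Suc j) w' = w - frag_cmul a h"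
        using cycle_horn_bounds [OF wc yc yb] by (auto simp: singular_boundary)
      have w'D: "singular_chain (Suc j) ?D w'" and w'B: "singular_chain (Suc j) ?B w'"
        using w' HF FS singular_chain_mono by blast+
      have "singular_relcycle (Suc j) ?D {} (y - w')"
        using yc w'D yb w' by (simp add: singular_cycle singular_chain_diff chain_boundary_diff)
      then obtain d where d: "singular_chain (Suc (Suc j)) ?D d" "chain_boundary (Suc (Suc j)) d = y - w'"
        using cycle_simplex_bounds [of j "Suc m" "y - w'"] unfolding singular_boundary by blast
      have "chain_boundary (Suc (Suc j)) d + (e + w') = z - frag_cmul a (frag_of ?i)"
        unfolding d by (simp add: y_def)
      moreover have "singular_chain (Suc j) (subtopology ?D ?F) (e + w')"
        using e w'B BF by (simp add: singular_chain_add)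
      ultimately have "homologous_rel (Suc j) ?D ?F z (frag_cmul a (frag_of ?i))"
        using d(1) unfolding homologous_rel_def singular_relboundary by blast
      then show ?thesis using Suc a(1) by auto
    qed
  next
    fix a assume "singular_relboundary (Suc m) ?D ?F (frag_cmul a (frag_of ?i))"
    then obtain d e where d: "singular_chain (Suc (Suc m)) ?D d" and e: "singular_chain (Suc m) ?B e"
        and de: "chain_boundary (Suc (Suc m)) d + e = frag_cmul a (frag_of ?i)"
      by (auto simp: singular_relboundary BF)
    \<comment> \<open>Applying the boundary to \<open>de\<close> exhibits \<open>a\<close> times
      face 0 as a boundary in the frontier relative to the horn, where the induction hypothesis
      forces \<open>a = 0\<close>.\<close>
    have "chain_boundary (Suc m) e = chain_boundary (Suc m) (frag_cmul a (frag_of ?i))"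
      using chain_boundary_boundary_alt [OF d] by (simp add: chain_boundary_add flip: de)
    also have "\<dots> = frag_cmul a (frag_of ?f) + frag_cmul a h"
      using h(2) by (simp add: chain_boundary_cmul frag_cmul_distrib2)
    finally have "chain_boundary (Suc m) e + frag_cmul (- a) h = frag_cmul a (frag_of ?f)"
      using frag_cmul_distrib [of a "- a" h] by simp
    moreover have "singular_chain m (subtopology ?B ?H) (frag_cmul (- a) h)"
      using h(1) BH singular_chain_cmul by metis
    ultimately have "singular_relboundary m ?B ?H (frag_cmul a (frag_of ?f))"
      using e unfolding singular_relboundary by blast
    then show "a = 0"
      using gen unfolding generated_by_cell_def by blast
  qed
qed

section \<open>Spaces glued from finitely many simplices\<close>

definition complex_points :: "(nat \<times> ((nat \<Rightarrow> real) \<Rightarrow> 'z)) set \<Rightarrow> 'z set" where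
  "complex_points L = (\<Union>(k, \<sigma>)\<in>L. \<sigma> ` standard_simplex k)"

text \<open>A finite Delta-complex structure recorded by its characteristic maps. Closure under
  faces makes the chains on \<open>L\<close> a subcomplex of the singular chains; the last clause
  says that the open cells are disjoint and injectively parametrised.\<close>

definition finite_simplex_complex ::
    "'z topology \<Rightarrow> (nat \<times> ((nat \<Rightarrow> real) \<Rightarrow> 'z)) set \<Rightarrow> bool" where
  "finite_simplex_complex Z L \<longleftrightarrow>
     Hausdorff_space Z \<and> finite L \<and>
     (\<forall>(k, \<sigma>)\<in>L. singular_simplex k Z \<sigma>) \<and>
     (\<forall>(k, \<sigma>)\<in>L. 0 < k \<longrightarrow> (\<forall>i\<le>k. (k - 1, singular_face k i \<sigma>) \<in> L)) \<and>
     (\<forall>(k, \<sigma>)\<in>L. \<forall>(l, \<tau>)\<in>L. \<forall>x y. x \<in> standard_simplex k - simplex_frontier k \<longrightarrow>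
        y \<in> standard_simplex l - simplex_frontier l \<longrightarrow> \<sigma> x = \<tau> y \<longrightarrow> k = l \<and> \<sigma> = \<tau> \<and> x = y)"

lemma finite_simplex_complexD:
  assumes "finite_simplex_complex Z L"
  shows "Hausdorff_space Z" "finite L"
    and "\<And>k \<sigma>. (k, \<sigma>) \<in> L \<Longrightarrow> singular_simplex k Z \<sigma>"
    and "\<And>k \<sigma> i. \<lbrakk>(Suc k, \<sigma>) \<in> L; i \<le> Suc k\<rbrakk> \<Longrightarrow> (k, singular_face (Suc k) i \<sigma>) \<in> L"
    and "\<And>k \<sigma> l \<tau> x y. \<lbrakk>(k, \<sigma>) \<in> L; (l, \<tau>) \<in> L; x \<in> standard_simplex k; x \<notin> simplex_frontier k;
          y \<in> standard_simplex l; y \<notin> simplex_frontier l; \<sigma> x = \<tau> y\<rbrakk> \<Longrightarrow> k = l \<and> \<sigma> = \<tau> \<and> x = y"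
proof -
  show "Hausdorff_space Z" "finite L"
    using assms by (simp_all add: finite_simplex_complex_def)
  show "singular_simplex k Z \<sigma>" if "(k, \<sigma>) \<in> L" for k \<sigma>
    using assms that by (auto simp: finite_simplex_complex_def)
  show "(k, singular_face (Suc k) i \<sigma>) \<in> L" if "(Suc k, \<sigma>) \<in> L" "i \<le> Suc k" for k \<sigma> i
  proof -
    have "\<forall>(k, \<sigma>)\<in>L. 0 < k \<longrightarrow> (\<forall>i\<le>k. (k - 1, singular_face k i \<sigma>) \<in> L)"
      using assms by (simp add: finite_simplex_complex_def)
    from bspec [OF this that(1)] that(2) show ?thesis by simp
  qed
  show "k = l \<and> \<sigma> = \<tau> \<and> x = y"
    if "(k, \<sigma>) \<in> L" "(l, \<tau>) \<in> L" "x \<in> standard_simplex k" "x \<notin> simplex_frontier k"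
      "y \<in> standard_simplex l" "y \<notin> simplex_frontier l" "\<sigma> x = \<tau> y" for k \<sigma> l \<tau> x y
  proof -
    have "\<forall>(k, \<sigma>)\<in>L. \<forall>(l, \<tau>)\<in>L. \<forall>x y. x \<in> standard_simplex k - simplex_frontier k \<longrightarrow>
        y \<in> standard_simplex l - simplex_frontier l \<longrightarrow> \<sigma> x = \<tau> y \<longrightarrow> k = l \<and> \<sigma> = \<tau> \<and> x = y"
      using assms by (simp add: finite_simplex_complex_def)
    from bspec [OF this that(1), simplified] that show ?thesis by blast
  qed
qed

lemma singular_face_frontier:
  assumes "x \<in> simplex_frontier k"
  obtains l i y where "k = Suc l" "i \<le> k" "y \<in> standard_simplex l"
    "\<And>\<sigma>. singular_face k i \<sigma> y = \<sigma> x"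
proof -
  obtain i where i: "i \<le> k" "x i = 0" and x: "x \<in> standard_simplex k"
    using assms by (auto simp: simplex_frontier_def)
  have "k \<noteq> 0" using assms simplex_frontier_0 by (cases k) auto
  then obtain l where l: "k = Suc l" using not0_implies_Suc by blast
  obtain y where "y \<in> standard_simplex l" "x = simplical_face i y"
    using simplical_face_surj [of x l i] i x l by blast
  with l i show ?thesis
    by (intro that [of l i y]) (auto simp: singular_face_def)
qed

text \<open>A point on the frontier of a simplex comes from one of its faces; descend in dimension
  until the point is interior, at the latest at a vertex.\<close>

lemma complex_points_interior:
  assumes L: "finite_simplex_complex Z L" and z: "z \<in> complex_points L"
  obtains k \<sigma> x where "(k, \<sigma>) \<in> L" "x \<in> standard_simplex k" "x \<notin> simplex_frontier k" "z = \<sigma> x"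
proof -
  have *: "(k, \<sigma>) \<in> L \<Longrightarrow> x \<in> standard_simplex k \<Longrightarrow>
      \<exists>l \<tau> y. (l, \<tau>) \<in> L \<and> y \<in> standard_simplex l \<and> y \<notin> simplex_frontier l \<and> \<sigma> x = \<tau> y" for k \<sigma> x
  proof (induction k arbitrary: \<sigma> x)
    case 0
    then show ?case using simplex_frontier_0 by blast
  next
    case (Suc k)
    show ?case
    proof (cases "x \<in> simplex_frontier (Suc k)")
      case True
      then obtain i y where i: "i \<le> Suc k" "y \<in> standard_simplex k" "singular_face (Suc k) i \<sigma> y = \<sigma> x"
        by (elim singular_face_frontier) auto
      then show ?thesis
        using Suc.IH [OF finite_simplex_complexD(4) [OF L Suc.prems(1) i(1)] i(2)] by simp
    qed (use Suc.prems in blast)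
  qed
  obtain k \<sigma> x where "(k, \<sigma>) \<in> L" "x \<in> standard_simplex k" "z = \<sigma> x"
    using z by (auto simp: complex_points_def)
  with * [of k \<sigma> x] that show thesis by metis
qed

text \<open>A simplex of maximal dimension is not a face of any other.\<close>

lemma finite_simplex_complex_remove:
  assumes L: "finite_simplex_complex Z L" and top: "\<And>k \<tau>. (k, \<tau>) \<in> L \<Longrightarrow> k \<le> m"
  shows "finite_simplex_complex Z (L - {(m, \<sigma>)})"
  unfolding finite_simplex_complex_def
proof (intro conjI)
  show "\<forall>(k, \<tau>)\<in>L - {(m, \<sigma>)}. 0 < k \<longrightarrow> (\<forall>i\<le>k. (k - 1, singular_face k i \<tau>) \<in> L - {(m, \<sigma>)})"
  proof clarify
    fix k \<tau> i assume "(k, \<tau>) \<in> L" "0 < k" "i \<le> k"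
    moreover then obtain l where "k = Suc l" using gr0_conv_Suc by blast
    ultimately show "(k - 1, singular_face k i \<tau>) \<in> L - {(m, \<sigma>)}"
      using finite_simplex_complexD(4) [OF L, of l \<tau> i] top [of k \<tau>] by auto
  qed
qed (use finite_simplex_complexD [OF L] in \<open>auto\<close>)

lemma closedin_complex_points:
  assumes L: "finite_simplex_complex Z L"
  shows "closedin Z (complex_points L)"
  unfolding complex_points_def
proof (intro closedin_Union)
  show "finite ((\<lambda>(k, \<sigma>). \<sigma> ` standard_simplex k) ` L)"
    using finite_simplex_complexD(2) [OF L] by simp
  have "closedin Z (\<sigma> ` standard_simplex k)" if "(k, \<sigma>) \<in> L" for k \<sigma>
  proof -
    have "continuous_map (simplex_topology k) Z \<sigma>"
      using finite_simplex_complexD(3) [OF L that] by (simp add: singular_simplex_def)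
    moreover have "compactin (simplex_topology k) (standard_simplex k)"
      using compact_space_simplex_topology [of k] by (simp add: compact_space_def topspace_standard_simplex)
    ultimately show ?thesis
      using image_compactin compactin_imp_closedin finite_simplex_complexD(1) [OF L] by blast
  qed
  then show "closedin Z T" if "T \<in> (\<lambda>(k, \<sigma>). \<sigma> ` standard_simplex k) ` L" for T
    using that by auto
qed

text \<open>The frontier goes to proper faces, which survive the removal. The interior misses the
  rest because every remaining point lies in a remaining open cell.\<close>

lemma attached_simplex_complex:
  assumes L: "finite_simplex_complex Z L" and top: "\<And>k \<tau>. (k, \<tau>) \<in> L \<Longrightarrow> k \<le> m"
    and \<sigma>: "(m, \<sigma>) \<in> L"
  shows "attached_simplex (subtopology Z (complex_points L)) (complex_points (L - {(m, \<sigma>)})) m \<sigma>"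
proof -
  let ?L' = "L - {(m, \<sigma>)}"
  have L': "finite_simplex_complex Z ?L'"
    by (rule finite_simplex_complex_remove [OF L top])
  have un: "complex_points L = complex_points ?L' \<union> \<sigma> ` standard_simplex m"
    using \<sigma> by (auto simp: complex_points_def)
  have cZ: "complex_points L \<subseteq> topspace Z"
    using closedin_complex_points [OF L] closedin_subset by blast
  show ?thesis
  proof
    show "Hausdorff_space (subtopology Z (complex_points L))"
      using finite_simplex_complexD(1) [OF L] Hausdorff_space_subtopology by blast
    show "closedin (subtopology Z (complex_points L)) (complex_points ?L')"
      using closedin_complex_points [OF L'] un by (simp add: closedin_subset_topspace)
    show "continuous_map (simplex_topology m) (subtopology Z (complex_points L)) \<sigma>"
      using finite_simplex_complexD(3) [OF L \<sigma>] un
      by (auto simp: singular_simplex_def continuous_map_in_subtopology)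
    show "topspace (subtopology Z (complex_points L)) = complex_points ?L' \<union> \<sigma> ` standard_simplex m"
      using un cZ by auto
    show "\<sigma> ` simplex_frontier m \<subseteq> complex_points ?L'"
    proof clarify
      fix x assume "x \<in> simplex_frontier m"
      then obtain l i y where y: "m = Suc l" "i \<le> m" "y \<in> standard_simplex l" "singular_face m i \<sigma> y = \<sigma> x"
        by (elim singular_face_frontier) auto
      then have "(l, singular_face m i \<sigma>) \<in> ?L'"
        using finite_simplex_complexD(4) [OF L, of l \<sigma> i] \<sigma> by auto
      then show "\<sigma> x \<in> complex_points ?L'"
        using y(3,4) unfolding complex_points_def by (metis (no_types, lifting) UN_I case_prod_conv imageI)
    qed
    show "x \<in> simplex_frontier m" if x: "x \<in> standard_simplex m" "\<sigma> x \<in> complex_points ?L'" for x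
    proof (rule ccontr)
      assume "x \<notin> simplex_frontier m"
      moreover obtain k \<tau> y where "(k, \<tau>) \<in> ?L'" "y \<in> standard_simplex k" "y \<notin> simplex_frontier k" "\<sigma> x = \<tau> y"
        using complex_points_interior [OF L' x(2)] by blast
      ultimately show False
        using finite_simplex_complexD(5) [OF L \<sigma>, of k \<tau> x y] x(1) by auto
    qed
    show "inj_on \<sigma> (standard_simplex m - simplex_frontier m)"
      using finite_simplex_complexD(5) [OF L \<sigma> \<sigma>] by (auto simp: inj_on_def)
  qed
qed

abbreviation complex_simplices where
  "complex_simplices L k \<equiv> {\<sigma>. (k, \<sigma>) \<in> L}"

lemma keys_chain_boundary_complex:
  assumes L: "finite_simplex_complex Z L" and w: "Poly_Mapping.keys w \<subseteq> complex_simplices L (Suc k)"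
  shows "Poly_Mapping.keys (chain_boundary (Suc k) w) \<subseteq> complex_simplices L k"
  using w
proof (induction w rule: frag_induction)
  case (one \<sigma>)
  have "Poly_Mapping.keys (frag_cmul ((-1) ^ i) (frag_of (singular_face (Suc k) i \<sigma>))) \<subseteq> complex_simplices L k"
    if "i \<le> Suc k" for i
    using finite_simplex_complexD(4) [OF L, of k \<sigma> i] one that keys_cmul [of "(-1) ^ i" "frag_of (singular_face (Suc k) i \<sigma>)"]
    by auto
  then have "(\<Union>i\<in>{..Suc k}. Poly_Mapping.keys (frag_cmul ((-1) ^ i) (frag_of (singular_face (Suc k) i \<sigma>))))
      \<subseteq> complex_simplices L k"
    by blast
  then show ?case
    using keys_sum [of "\<lambda>i. frag_cmul ((-1) ^ i) (frag_of (singular_face (Suc k) i \<sigma>))" "{..Suc k}"]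
    by (simp add: chain_boundary_of del: sum.atMost_Suc)
next
  case (diff a b)
  then show ?case
    using keys_diff [of "chain_boundary (Suc k) a" "chain_boundary (Suc k) b"] by (auto simp: chain_boundary_diff)
qed simp

lemma singular_chain_complex:
  assumes L: "finite_simplex_complex Z L" and w: "Poly_Mapping.keys w \<subseteq> complex_simplices L k"
  shows "singular_chain k (subtopology Z (complex_points L)) w"
proof -
  have "singular_simplex k (subtopology Z (complex_points L)) \<sigma>" if "(k, \<sigma>) \<in> L" for \<sigma>
    using finite_simplex_complexD(3) [OF L that] that
    by (auto simp: singular_simplex_subtopology complex_points_def)
  then show ?thesis
    using w by (auto simp: singular_chain_def)
qed

lemma generated_by_cellD:
  assumes "generated_by_cell X A m \<sigma>"
  shows "singular_relcycle k X A z \<Longrightarrow>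
      \<exists>a. (k \<noteq> m \<longrightarrow> a = 0) \<and> homologous_rel k X A z (frag_cmul a (frag_of \<sigma>))"
    and "singular_relboundary m X A (frag_cmul a (frag_of \<sigma>)) \<Longrightarrow> a = 0"
  using assms unfolding generated_by_cell_def by blast+

text \<open>The two clauses are surjectivity and injectivity of the map from simplicial to singular
  homology. Remove a top-dimensional simplex and chase the long exact sequence of the pair on
  chains, the relative term being given by \<open>generated_by_cell\<close>.\<close>

theorem simplicial_homology_complex:
  assumes "finite_simplex_complex Z L"
  shows "(\<forall>k z. singular_relcycle k (subtopology Z (complex_points L)) {} z \<longrightarrow>
            (\<exists>w. Poly_Mapping.keys w \<subseteq> complex_simplices L k \<and>
               homologous_rel k (subtopology Z (complex_points L)) {} z w)) \<and>
         (\<forall>k w. Poly_Mapping.keys w \<subseteq> complex_simplices L k \<longrightarrow>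
            singular_relboundary k (subtopology Z (complex_points L)) {} w \<longrightarrow>
            (\<exists>b. Poly_Mapping.keys b \<subseteq> complex_simplices L (Suc k) \<and> chain_boundary (Suc k) b = w))"
  using finite_simplex_complexD(2) [OF assms] assms
proof (induction "card L" arbitrary: L rule: less_induct)
  case (less L)
  note L = less.prems(2)
  let ?X = "subtopology Z (complex_points L)"
  show ?case
  proof (cases "L = {}")
    case True
    then have e: "topspace ?X = {}" by (simp add: complex_points_def)
    show ?thesis
    proof (intro conjI allI impI)
      fix k z assume "singular_relcycle k ?X {} z"
      then have "z = 0" using singular_chain_empty [OF e] by (simp add: singular_cycle)
      then show "\<exists>w. Poly_Mapping.keys w \<subseteq> complex_simplices L k \<and> homologous_rel k ?X {} z w"
        by (intro exI [of _ 0]) simp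
    next
      fix k and w :: "((nat \<Rightarrow> real) \<Rightarrow> 'a) \<Rightarrow>\<^sub>0 int"
      assume "Poly_Mapping.keys w \<subseteq> complex_simplices L k"
      then have "w = 0" using True by simp
      then show "\<exists>b. Poly_Mapping.keys b \<subseteq> complex_simplices L (Suc k) \<and> chain_boundary (Suc k) b = w"
        by (intro exI [of _ 0]) simp
    qed
  next
    case False
    define m where "m = Max (fst ` L)"
    have fin: "finite (fst ` L)" using less.prems by simp
    have top: "k \<le> m" if "(k, \<tau>) \<in> L" for k \<tau>
      using Max_ge [OF fin, of k] that unfolding m_def by force
    have "m \<in> fst ` L" unfolding m_def using False by (intro Max_in fin) simp
    then obtain \<sigma> where \<sigma>: "(m, \<sigma>) \<in> L" by auto
    let ?L' = "L - {(m, \<sigma>)}"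
    let ?A = "complex_points ?L'"
    have L': "finite_simplex_complex Z ?L'"
      by (rule finite_simplex_complex_remove [OF L top])
    interpret attached_simplex ?X ?A m \<sigma>
      by (rule attached_simplex_complex [OF L top \<sigma>])
    have AX: "?A \<subseteq> complex_points L" by (auto simp: complex_points_def)
    have XA: "subtopology ?X ?A = subtopology Z ?A"
      using AX by (simp add: subtopology_subtopology inf.absorb2)
    have chX: "singular_chain k ?X c" if "singular_chain k (subtopology Z ?A) c" for k c
      using that AX by (rule singular_chain_mono)
    have "card ?L' < card L" using \<sigma> less.prems(1) by (intro psubset_card_mono) auto
    moreover have "finite ?L'" using less.prems(1) by simp
    ultimately have IH1: "\<exists>w. Poly_Mapping.keys w \<subseteq> complex_simplices ?L' k \<and> homologous_rel k (subtopology Z ?A) {} z w"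
      if "singular_relcycle k (subtopology Z ?A) {} z" for k z
      using less.hyps [of ?L'] L' that by blast
    have IH2: "\<exists>b. Poly_Mapping.keys b \<subseteq> complex_simplices ?L' (Suc k) \<and> chain_boundary (Suc k) b = w"
      if "Poly_Mapping.keys w \<subseteq> complex_simplices ?L' k" "singular_relboundary k (subtopology Z ?A) {} w" for k w
      using less.hyps [of ?L'] L' that \<open>card ?L' < card L\<close> \<open>finite ?L'\<close> by blast
    have sub: "complex_simplices ?L' k \<subseteq> complex_simplices L k" for k by auto
    have \<sigma>X: "singular_simplex m ?X \<sigma>"
      using singular_chain_complex [OF L, of "frag_of \<sigma>" m] \<sigma> by (simp add: singular_chain_of)
    have gen: "generated_by_cell ?X ?A m \<sigma>"
      by (rule generated_by_cell [OF generated_by_cell_simplex \<sigma>X])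
    have cell: "Poly_Mapping.keys (frag_cmul a (frag_of \<sigma>)) \<subseteq> complex_simplices L k"
      if "k \<noteq> m \<longrightarrow> a = 0" for a k
      using that \<sigma> keys_cmul [of a "frag_of \<sigma>"] by (cases "k = m") auto
    have cell_boundary: "Poly_Mapping.keys (chain_boundary (Suc k) (frag_cmul a (frag_of \<sigma>))) \<subseteq> complex_simplices ?L' k"
      if "Suc k \<noteq> m \<longrightarrow> a = 0" for a k
    proof (cases "Suc k = m")
      case True
      then have "(m, \<sigma>) \<noteq> (k, \<tau>)" for \<tau> by simp
      then show ?thesis using keys_chain_boundary_complex [OF L cell [OF that]] by auto
    qed (use that in simp)
    show ?thesis
    proof (intro conjI allI impI)
      fix k z assume z: "singular_relcycle k ?X {} z"
      then have zX: "singular_chain k ?X z" "chain_boundary k z = 0"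
        by (simp_all add: singular_cycle)
      then have "singular_relcycle k ?X ?A z" by (simp add: singular_relcycle)
      then obtain a where a: "k \<noteq> m \<longrightarrow> a = 0" "homologous_rel k ?X ?A z (frag_cmul a (frag_of \<sigma>))"
        using gen unfolding generated_by_cell_def by blast
      let ?s = "frag_cmul a (frag_of \<sigma>)"
      obtain d e where d: "singular_chain (Suc k) ?X d" and e: "singular_chain k (subtopology Z ?A) e"
          and de: "chain_boundary (Suc k) d + e = z - ?s"
        using a(2) unfolding homologous_rel_def singular_relboundary XA by blast
      have be: "chain_boundary k e = - chain_boundary k ?s"
        using arg_cong [OF de, of "chain_boundary k"] zX(2) chain_boundary_boundary_alt [OF d]
        by (simp add: chain_boundary_add chain_boundary_diff)
      \<comment> \<open>The boundary of \<open>e\<close> is simplicial and bounds singularly in the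
        smaller complex, so it bounds a simplicial chain \<open>b\<close> there. Then
        \<open>e - b\<close> is a cycle to which the induction hypothesis applies.\<close>
      obtain b where b: "Poly_Mapping.keys b \<subseteq> complex_simplices ?L' k" "chain_boundary k b = chain_boundary k e"
      proof (cases k)
        case 0
        then show thesis using that [of 0] by (simp add: chain_boundary_def)
      next
        case (Suc j)
        have "Poly_Mapping.keys (chain_boundary k e) \<subseteq> complex_simplices ?L' j"
          using cell_boundary [of j a] a(1) Suc be by simp
        moreover have "singular_relboundary j (subtopology Z ?A) {} (chain_boundary k e)"
          using e Suc by (auto simp: singular_boundary)
        ultimately show thesis using IH2 that Suc by blast
      qed
      have "singular_relcycle k (subtopology Z ?A) {} (e - b)"
        using e b singular_chain_complex [OF L' b(1)]
        by (simp add: singular_cycle singular_chain_diff chain_boundary_diff)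
      then obtain w where w: "Poly_Mapping.keys w \<subseteq> complex_simplices ?L' k"
          "homologous_rel k (subtopology Z ?A) {} (e - b) w"
        using IH1 by blast
      then obtain f where f: "singular_chain (Suc k) (subtopology Z ?A) f" "chain_boundary (Suc k) f = e - b - w"
        by (auto simp: homologous_rel_def singular_boundary)
      have "chain_boundary (Suc k) (d + f) = z - (?s + b + w)"
      proof -
        have e_eq: "e = chain_boundary (Suc k) f + b + w" using f(2) by simp
        have z_eq: "z = chain_boundary (Suc k) d + e + ?s" using de by simp
        show ?thesis
          unfolding z_eq e_eq chain_boundary_add by simp
      qed
      then have "homologous_rel k ?X {} z (?s + b + w)"
        using singular_chain_add [OF d chX [OF f(1)]] unfolding homologous_rel_def singular_boundary by blast
      moreover have "Poly_Mapping.keys (?s + b + w) \<subseteq> complex_simplices L k"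
        using keys_add [of "?s + b" w] keys_add [of ?s b] cell [OF a(1)] b(1) w(1) sub by blast
      ultimately show "\<exists>w. Poly_Mapping.keys w \<subseteq> complex_simplices L k \<and> homologous_rel k ?X {} z w"
        by blast
    next
      fix k w assume w: "Poly_Mapping.keys w \<subseteq> complex_simplices L k" "singular_relboundary k ?X {} w"
      then obtain d where d: "singular_chain (Suc k) ?X d" "chain_boundary (Suc k) d = w"
        by (auto simp: singular_boundary)
      \<comment> \<open>If \<open>w\<close> involved \<open>\<sigma>\<close>, then modulo chains in
        the smaller complex a nonzero multiple of \<open>\<sigma>\<close> would be a relative
        boundary, against \<open>gen\<close>.\<close>
      have w': "Poly_Mapping.keys w \<subseteq> complex_simplices ?L' k"
      proof (cases "k = m")
        case True
        let ?a = "Poly_Mapping.lookup w \<sigma>"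
        let ?w' = "w - frag_cmul ?a (frag_of \<sigma>)"
        have "\<sigma> \<notin> Poly_Mapping.keys ?w'"
          by (simp add: in_keys_iff lookup_minus)
        moreover have "Poly_Mapping.keys ?w' \<subseteq> complex_simplices L k"
          using keys_diff [of w "frag_cmul ?a (frag_of \<sigma>)"] w(1) cell [of k ?a] True by auto
        ultimately have kw': "Poly_Mapping.keys ?w' \<subseteq> complex_simplices ?L' k" by auto
        then have "singular_chain k (subtopology ?X ?A) (- ?w')"
          using singular_chain_complex [OF L' kw'] XA by (simp only: singular_chain_minus)
        moreover have "chain_boundary (Suc k) d + - ?w' = frag_cmul ?a (frag_of \<sigma>)"
          using d(2) by simp
        ultimately have "singular_relboundary m ?X ?A (frag_cmul ?a (frag_of \<sigma>))"
          using d(1) True unfolding singular_relboundary by blast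
        then have "?a = 0" using gen unfolding generated_by_cell_def by blast
        then show ?thesis using kw' by simp
      qed (use w(1) in auto)
      \<comment> \<open>Since \<open>w\<close> avoids \<open>\<sigma>\<close>, the filling
        \<open>d\<close> is a cycle relative to the smaller complex and can be replaced by a
        multiple of \<open>\<sigma>\<close> up to a chain \<open>e\<close> living there.\<close>
      have dcyc: "singular_relcycle (Suc k) ?X ?A d"
        using d singular_chain_complex [OF L' w'] XA by (simp add: singular_relcycle)
      obtain a where a: "Suc k \<noteq> m \<longrightarrow> a = 0" "homologous_rel (Suc k) ?X ?A d (frag_cmul a (frag_of \<sigma>))"
        using generated_by_cellD(1) [OF gen dcyc] by (elim exE conjE)
      let ?s = "frag_cmul a (frag_of \<sigma>)"
      obtain f e where f: "singular_chain (Suc (Suc k)) ?X f" and e: "singular_chain (Suc k) (subtopology Z ?A) e"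
          and fe: "chain_boundary (Suc (Suc k)) f + e = d - ?s"
        using a(2) unfolding homologous_rel_def singular_relboundary XA by blast
      have "chain_boundary (Suc k) e = w - chain_boundary (Suc k) ?s"
        using arg_cong [OF fe, of "chain_boundary (Suc k)"] d(2) chain_boundary_boundary_alt [OF f]
        by (simp add: chain_boundary_add chain_boundary_diff)
      moreover have "Poly_Mapping.keys (w - chain_boundary (Suc k) ?s) \<subseteq> complex_simplices ?L' k"
        using keys_diff [of w "chain_boundary (Suc k) ?s"] w' cell_boundary [OF a(1)] by blast
      ultimately obtain b where b: "Poly_Mapping.keys b \<subseteq> complex_simplices ?L' (Suc k)"
          "chain_boundary (Suc k) b = w - chain_boundary (Suc k) ?s"
        using IH2 e unfolding singular_boundary by metis
      have "Poly_Mapping.keys (?s + b) \<subseteq> complex_simplices L (Suc k)"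
        using keys_add [of ?s b] cell [OF a(1)] b(1) sub by blast
      moreover have "chain_boundary (Suc k) (?s + b) = w"
        by (simp add: chain_boundary_add b(2))
      ultimately show "\<exists>b. Poly_Mapping.keys b \<subseteq> complex_simplices L (Suc k) \<and> chain_boundary (Suc k) b = w"
        by blast
    qed
  qed
qed

section \<open>Coinvariants of complexes of lists\<close>

lemma frag_cmul_uminus: "frag_cmul (- k) c = - frag_cmul k c"
  by (metis frag_cmul_cmul frag_cmul_minus_one mult_minus1)

lemma frag_cmul_diff: "frag_cmul k (a - b) = frag_cmul k a - frag_cmul k b"
  using frag_cmul_distrib2 [of k "a - b" b] by simp

section \<open>Integral chains of lists and their boundary\<close>

definition map_frag :: "('a \<Rightarrow> 'b) \<Rightarrow> ('a \<Rightarrow>\<^sub>0 int) \<Rightarrow> 'b \<Rightarrow>\<^sub>0 int" where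
  "map_frag f = frag_extend (frag_of \<circ> f)"

lemma map_frag_of [simp]: "map_frag f (frag_of x) = frag_of (f x)"
  and map_frag_0 [simp]: "map_frag f 0 = 0"
  and map_frag_add: "map_frag f (a + b) = map_frag f a + map_frag f b"
  and map_frag_diff: "map_frag f (a - b) = map_frag f a - map_frag f b"
  and map_frag_minus: "map_frag f (- a) = - map_frag f a"
  and map_frag_cmul: "map_frag f (frag_cmul k a) = frag_cmul k (map_frag f a)"
  by (simp_all add: map_frag_def frag_extend_add frag_extend_diff frag_extend_minus frag_extend_cmul)

lemma map_frag_map_frag: "map_frag f (map_frag g c) = map_frag (\<lambda>x. f (g x)) c"
  unfolding map_frag_def frag_extend_compose by (simp add: o_def)

lemma frag_induct [case_names zero of diff]:
  assumes "P 0" "\<And>x. P (frag_of x)" "\<And>a b. P a \<Longrightarrow> P b \<Longrightarrow> P (a - b)"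
  shows "P c"
  using frag_induction [of c UNIV P] assms by simp

lemma map_frag_ident [simp]: "map_frag (\<lambda>x. x) c = c"
  by (induction c rule: frag_induct) (simp_all add: map_frag_diff)

lemma frag_extend_map_frag: "frag_extend f (map_frag g c) = frag_extend (\<lambda>x. f (g x)) c"
  unfolding map_frag_def frag_extend_compose by (simp add: o_def)

lemma frag_extend_cmul_of: "frag_extend (\<lambda>x. frag_cmul k (frag_of (f x))) c = frag_cmul k (map_frag f c)"
  by (induction c rule: frag_induct) (simp_all add: frag_extend_diff map_frag_diff frag_cmul_diff)

lemma map_frag_sum: "map_frag f (\<Sum>i\<in>I. g i) = (\<Sum>i\<in>I. map_frag f (g i))"
  by (induction I rule: infinite_finite_induct) (simp_all add: map_frag_add)

lemma keys_map_frag: "Poly_Mapping.keys (map_frag f c) \<subseteq> f ` Poly_Mapping.keys c"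
  unfolding map_frag_def using keys_frag_extend [of "frag_of \<circ> f" c] by auto

text \<open>The augmented ordered boundary: the boundary of a singleton is the empty list, which
  spans degree -1. The recursion is the cone formula d(x * s) = s - x * d(s).\<close>

primrec list_boundary :: "'v list \<Rightarrow> 'v list \<Rightarrow>\<^sub>0 int" where
  "list_boundary [] = 0"
| "list_boundary (x # xs) = frag_of xs - map_frag ((#) x) (list_boundary xs)"

definition frag_boundary :: "('v list \<Rightarrow>\<^sub>0 int) \<Rightarrow> 'v list \<Rightarrow>\<^sub>0 int" where
  "frag_boundary = frag_extend list_boundary"

lemma frag_boundary_of [simp]: "frag_boundary (frag_of xs) = list_boundary xs"
  and frag_boundary_0 [simp]: "frag_boundary 0 = 0"
  and frag_boundary_add: "frag_boundary (a + b) = frag_boundary a + frag_boundary b"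
  and frag_boundary_diff: "frag_boundary (a - b) = frag_boundary a - frag_boundary b"
  and frag_boundary_minus: "frag_boundary (- a) = - frag_boundary a"
  and frag_boundary_cmul: "frag_boundary (frag_cmul k a) = frag_cmul k (frag_boundary a)"
  by (simp_all add: frag_boundary_def frag_extend_add frag_extend_diff frag_extend_minus frag_extend_cmul)

lemma frag_boundary_cons:
  "frag_boundary (map_frag ((#) x) c) = c - map_frag ((#) x) (frag_boundary c)"
  by (induction c rule: frag_induct) (simp_all add: map_frag_diff frag_boundary_diff)

lemma frag_boundary_boundary: "frag_boundary (frag_boundary c) = 0"
proof (induction c rule: frag_induct)
  case (of xs)
  show ?case
    by (induction xs) (simp_all add: frag_boundary_diff frag_boundary_cons)
qed (simp_all add: frag_boundary_diff)

text \<open>The Leibniz rule for the join of two simplices.\<close>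

lemma list_boundary_append:
  "list_boundary (xs @ ys) = map_frag (\<lambda>zs. zs @ ys) (list_boundary xs) +
     frag_cmul ((-1) ^ length xs) (map_frag ((@) xs) (list_boundary ys))"
proof (induction xs)
  case Nil
  have "(@) [] = (\<lambda>zs::'a list. zs)" by auto
  then show ?case by simp
next
  case (Cons x xs)
  then show ?case
    using frag_cmul_uminus [of "(-1) ^ length xs"]
    by (simp add: map_frag_diff map_frag_add map_frag_cmul map_frag_map_frag)
qed

lemma list_boundary_eq_sum:
  "list_boundary xs = (\<Sum>i<length xs. frag_cmul ((-1) ^ i) (frag_of (take i xs @ drop (Suc i) xs)))"
proof (induction xs)
  case (Cons x xs)
  show ?case
    by (simp add: Cons sum.lessThan_Suc_shift map_frag_sum map_frag_cmul del: sum.lessThan_Suc)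
      (simp only: frag_cmul_uminus sum_negf)
qed simp

lemma keys_list_boundary:
  "ys \<in> Poly_Mapping.keys (list_boundary xs) \<Longrightarrow> \<exists>as a bs. xs = as @ a # bs \<and> ys = as @ bs"
proof (induction xs arbitrary: ys)
  case (Cons x xs)
  then have "ys \<in> Poly_Mapping.keys (frag_of xs) \<or> ys \<in> Poly_Mapping.keys (map_frag ((#) x) (list_boundary xs))"
    using keys_diff [of "frag_of xs" "map_frag ((#) x) (list_boundary xs)"] by auto
  then show ?case
  proof
    assume "ys \<in> Poly_Mapping.keys (frag_of xs)"
    then have "x # xs = [] @ x # xs" "ys = [] @ xs" by auto
    then show ?case by blast
  next
    assume "ys \<in> Poly_Mapping.keys (map_frag ((#) x) (list_boundary xs))"
    then obtain zs where "ys = x # zs" "zs \<in> Poly_Mapping.keys (list_boundary xs)"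
      using keys_map_frag [of "(#) x" "list_boundary xs"] by auto
    with Cons.IH [of zs] obtain as a bs where "x # xs = (x # as) @ a # bs" "ys = (x # as) @ bs"
      by auto
    then show ?case by blast
  qed
qed simp

lemma frag_boundary_map:
  "frag_boundary (map_frag (map g) c) = map_frag (map g) (frag_boundary c)"
proof (induction c rule: frag_induct)
  case (of xs)
  show ?case
    by (induction xs) (simp_all add: map_frag_diff map_frag_map_frag)
qed (simp_all add: map_frag_diff frag_boundary_diff)

definition chains :: "'v list set \<Rightarrow> nat \<Rightarrow> ('v list \<Rightarrow>\<^sub>0 int) set" where
  "chains S k = {c. Poly_Mapping.keys c \<subseteq> {xs \<in> S. length xs = k}}"

lemma chains_0 [simp]: "0 \<in> chains S k"
  by (simp add: chains_def)

lemma chains_of: "frag_of xs \<in> chains S k \<longleftrightarrow> xs \<in> S \<and> length xs = k"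
  by (simp add: chains_def)

lemma chains_add: "a \<in> chains S k \<Longrightarrow> b \<in> chains S k \<Longrightarrow> a + b \<in> chains S k"
  unfolding chains_def using keys_add [of a b] by blast

lemma chains_diff: "a \<in> chains S k \<Longrightarrow> b \<in> chains S k \<Longrightarrow> a - b \<in> chains S k"
  unfolding chains_def using keys_diff [of a b] by blast

lemma chains_cmul: "a \<in> chains S k \<Longrightarrow> frag_cmul m a \<in> chains S k"
  unfolding chains_def using keys_cmul [of m a] by blast

lemma chains_sum: "(\<And>i. i \<in> I \<Longrightarrow> f i \<in> chains S k) \<Longrightarrow> sum f I \<in> chains S k"
  by (induction I rule: infinite_finite_induct) (auto intro: chains_add)

lemma chains_induct [consumes 1, case_names zero of diff]:
  assumes "c \<in> chains S k" "P 0" "\<And>xs. xs \<in> S \<Longrightarrow> length xs = k \<Longrightarrow> P (frag_of xs)"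
    "\<And>a b. P a \<Longrightarrow> P b \<Longrightarrow> P (a - b)"
  shows "P c"
  by (rule frag_induction [of c "{xs \<in> S. length xs = k}" P]) (use assms in \<open>auto simp: chains_def\<close>)

lemma frag_extend_chains:
  assumes "c \<in> chains S k" "\<And>xs. xs \<in> S \<Longrightarrow> length xs = k \<Longrightarrow> f xs \<in> chains T l"
  shows "frag_extend f c \<in> chains T l"
  using assms(1) by (induction rule: chains_induct) (auto simp: assms(2) frag_extend_diff chains_diff)

text \<open>The kernel of the projection to coinvariants in one degree. Congruence modulo this
  subgroup replaces the quotient groups throughout.\<close>

inductive_set coinv_null :: "('v \<Rightarrow> 'v) set \<Rightarrow> 'v list set \<Rightarrow> nat \<Rightarrow> ('v list \<Rightarrow>\<^sub>0 int) set"
  for G S k where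
  zero: "0 \<in> coinv_null G S k"
| gen: "\<lbrakk>g \<in> G; xs \<in> S; length xs = k\<rbrakk> \<Longrightarrow> frag_of (map g xs) - frag_of xs \<in> coinv_null G S k"
| diff: "\<lbrakk>a \<in> coinv_null G S k; b \<in> coinv_null G S k\<rbrakk> \<Longrightarrow> a - b \<in> coinv_null G S k"

lemma coinv_null_minus: "a \<in> coinv_null G S k \<Longrightarrow> - a \<in> coinv_null G S k"
  using coinv_null.diff [OF coinv_null.zero] by fastforce

lemma coinv_null_add: "\<lbrakk>a \<in> coinv_null G S k; b \<in> coinv_null G S k\<rbrakk> \<Longrightarrow> a + b \<in> coinv_null G S k"
  using coinv_null.diff [of a G S k "- b"] coinv_null_minus by fastforce

lemma coinv_null_sum: "(\<And>i. i \<in> I \<Longrightarrow> f i \<in> coinv_null G S k) \<Longrightarrow> sum f I \<in> coinv_null G S k"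
  by (induction I rule: infinite_finite_induct) (auto intro: coinv_null.zero coinv_null_add)

lemma coinv_null_mono: "G' \<subseteq> G \<Longrightarrow> coinv_null G' S k \<subseteq> coinv_null G S k"
proof
  show "c \<in> coinv_null G S k" if "G' \<subseteq> G" "c \<in> coinv_null G' S k" for c
    using that(2) by induction (use that(1) in \<open>auto intro: coinv_null.intros\<close>)
qed

lemma frag_cmul_closed:
  fixes A :: "('a \<Rightarrow>\<^sub>0 int) set"
  assumes "0 \<in> A" and diff: "\<And>a b. a \<in> A \<Longrightarrow> b \<in> A \<Longrightarrow> a - b \<in> A" and a: "a \<in> A"
  shows "frag_cmul m a \<in> A"
proof -
  have minus: "- b \<in> A" if "b \<in> A" for b
    using diff [OF assms(1) that] by simp
  have nat: "frag_cmul (int k) a \<in> A" for k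
  proof (induction k)
    case (Suc k)
    have "frag_cmul (int (Suc k)) a = frag_cmul (int k) a - - a"
      by (simp add: frag_cmul_distrib)
    then show ?case using diff [OF Suc minus [OF a]] by simp
  qed (use assms(1) in simp)
  show ?thesis
  proof (cases "0 \<le> m")
    case True
    then show ?thesis using nat [of "nat m"] by simp
  next
    case False
    then show ?thesis using minus [OF nat [of "nat (- m)"]] frag_cmul_uminus [of "- m" a] by simp
  qed
qed

lemma coinv_null_cmul: "a \<in> coinv_null G S k \<Longrightarrow> frag_cmul m a \<in> coinv_null G S k"
  by (rule frag_cmul_closed) (auto intro: coinv_null.intros)

locale list_complex =
  fixes S :: "'v list set"
  assumes closed_delete: "as @ a # bs \<in> S \<Longrightarrow> as @ bs \<in> S"
begin

lemma frag_boundary_chains: "c \<in> chains S (Suc k) \<Longrightarrow> frag_boundary c \<in> chains S k"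
  unfolding frag_boundary_def
proof (rule frag_extend_chains)
  show "list_boundary xs \<in> chains S k" if "xs \<in> S" "length xs = Suc k" for xs
    unfolding chains_def using keys_list_boundary closed_delete that by fastforce
qed

lemma frag_boundary_chains_0: "c \<in> chains S 0 \<Longrightarrow> frag_boundary c = 0"
  by (induction rule: chains_induct) (auto simp: frag_boundary_diff)

text \<open>Truncated subtraction at \<open>k = 0\<close> does no harm, since the empty list has
  boundary 0.\<close>

lemma frag_boundary_chains': "c \<in> chains S k \<Longrightarrow> frag_boundary c \<in> chains S (k - 1)"
  using frag_boundary_chains frag_boundary_chains_0 by (cases k) auto

end

locale list_complex_action = list_complex S for S :: "'v list set" +
  fixes G :: "('v \<Rightarrow> 'v) set"
  assumes map_closed: "g \<in> G \<Longrightarrow> xs \<in> S \<Longrightarrow> map g xs \<in> S"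
begin

lemma map_frag_diff_coinv_null:
  assumes "g \<in> G" "c \<in> chains S k"
  shows "map_frag (map g) c - c \<in> coinv_null G S k"
  using assms(2)
proof (induction rule: chains_induct)
  case (diff a b)
  have eq: "map_frag (map g) (a - b) - (a - b) = (map_frag (map g) a - a) - (map_frag (map g) b - b)"
    by (simp add: map_frag_diff)
  show ?case unfolding eq by (rule coinv_null.diff [OF diff])
qed (use assms(1) in \<open>auto intro: coinv_null.intros\<close>)

lemma frag_boundary_coinv_null:
  "c \<in> coinv_null G S k \<Longrightarrow> frag_boundary c \<in> coinv_null G S (k - 1)"
proof (induction rule: coinv_null.induct)
  case (gen g xs)
  have "list_boundary xs \<in> chains S (k - 1)"
    using frag_boundary_chains' [of "frag_of xs" k] gen by (simp add: chains_of)
  then have "map_frag (map g) (list_boundary xs) - list_boundary xs \<in> coinv_null G S (k - 1)"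
    by (rule map_frag_diff_coinv_null [OF gen(1)])
  moreover have "list_boundary (map g xs) = map_frag (map g) (list_boundary xs)"
    using frag_boundary_map [of g "frag_of xs"] by simp
  ultimately show ?case by (simp add: frag_boundary_diff)
qed (auto simp: frag_boundary_diff intro: coinv_null.intros)

text \<open>
  Any map that separates orbits exhibits the coinvariants as a free abelian group.
\<close>
lemma coinv_null_if_map_frag_eq_0:
  assumes sep: "\<And>xs ys. \<lbrakk>xs \<in> S; length xs = k; ys \<in> S; length ys = k; f xs = f ys\<rbrakk> \<Longrightarrow> \<exists>g\<in>G. ys = map g xs"
    and c: "c \<in> chains S k" "map_frag f c = 0"
  shows "c \<in> coinv_null G S k"
proof -
  \<comment> \<open>Replacing each list by the representative of its \<open>f\<close>-fibre changes
    \<open>c\<close> only by null elements, and the result depends on \<open>map_frag f c\<close>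
    alone.\<close>
  let ?s = "inv_into {xs \<in> S. length xs = k} f"
  have "c - map_frag ?s (map_frag f c) \<in> coinv_null G S k"
    using c(1)
  proof (induction rule: chains_induct)
    case (of xs)
    then have "f xs \<in> f ` {xs \<in> S. length xs = k}" by blast
    then have s: "?s (f xs) \<in> S" "length (?s (f xs)) = k" "f (?s (f xs)) = f xs"
      using inv_into_into [of "f xs" f "{xs \<in> S. length xs = k}"] f_inv_into_f [of "f xs" f] by auto
    then obtain g where "g \<in> G" "xs = map g (?s (f xs))"
      using sep [of "?s (f xs)" xs] of by auto
    then show ?case
      using coinv_null.gen [of g G "?s (f xs)" S k] s by simp
  next
    case (diff a b)
    then show ?case
      using coinv_null.diff [OF diff] by (simp add: map_frag_diff algebra_simps)
  qed (simp add: coinv_null.zero)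
  then show ?thesis using c(2) by simp
qed

lemma map_frag_coinv_null:
  assumes "\<And>g xs. \<lbrakk>g \<in> G; xs \<in> S; length xs = k\<rbrakk> \<Longrightarrow> f (map g xs) = f xs" "c \<in> coinv_null G S k"
  shows "map_frag f c = 0"
  using assms(2) by induction (auto simp: map_frag_diff assms(1))

end

locale list_complex_group_action = list_complex_action +
  assumes id_in: "id \<in> G"
    and comp_in: "\<lbrakk>g \<in> G; h \<in> G\<rbrakk> \<Longrightarrow> g \<circ> h \<in> G"
    and inverse_in: "g \<in> G \<Longrightarrow> \<exists>h\<in>G. h \<circ> g = id"
begin

definition list_orbit :: "'a list \<Rightarrow> 'a list set" where
  "list_orbit xs = (\<lambda>g. map g xs) ` G"

lemma list_orbit_eq_iff: "list_orbit xs = list_orbit ys \<longleftrightarrow> (\<exists>g\<in>G. ys = map g xs)"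
proof
  assume "list_orbit xs = list_orbit ys"
  moreover have "ys \<in> list_orbit ys"
    using id_in by (force simp: list_orbit_def)
  ultimately show "\<exists>g\<in>G. ys = map g xs"
    by (auto simp: list_orbit_def)
next
  assume "\<exists>g\<in>G. ys = map g xs"
  then obtain g where g: "g \<in> G" "ys = map g xs" by blast
  obtain h where h: "h \<in> G" "h \<circ> g = id" using inverse_in [OF g(1)] by blast
  then have xs: "xs = map h ys" by (simp add: g(2))
  have "list_orbit (map f zs) \<subseteq> list_orbit zs" if "f \<in> G" for f zs
    using comp_in that by (fastforce simp: list_orbit_def)
  then show "list_orbit xs = list_orbit ys"
    using g h(1) xs by (metis subset_antisym)
qed

text \<open>Coinvariants of a permutation module are free on the orbits, and sending a list to its
  orbit separates orbits.\<close>

lemma coinv_null_torsion_free: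
  assumes "c \<in> chains S k" "m \<noteq> 0" "frag_cmul m c \<in> coinv_null G S k"
  shows "c \<in> coinv_null G S k"
proof (rule coinv_null_if_map_frag_eq_0 [where f = list_orbit])
  have "map_frag list_orbit (frag_cmul m c) = 0"
    by (rule map_frag_coinv_null [OF _ assms(3)]) (use list_orbit_eq_iff in metis)
  then show "map_frag list_orbit c = 0"
    using assms(2) by (simp add: map_frag_cmul)
qed (use assms list_orbit_eq_iff in auto)

end

text \<open>\<open>t\<close> supplies representatives of the cosets G' t(y), indexed by
  \<open>Y\<close>; \<open>coset\<close> says that right multiplication by an element of
  \<open>G\<close> permutes these cosets.\<close>

locale list_complex_transfer =
  big: list_complex_group_action S G + small: list_complex_group_action S G'
  for S :: "'v list set" and G G' +
  fixes Y :: "'y set" and t :: "'y \<Rightarrow> 'v \<Rightarrow> 'v"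
  assumes finite_Y: "finite Y"
    and sub: "G' \<subseteq> G"
    and t_in: "y \<in> Y \<Longrightarrow> t y \<in> G"
    and coset: "h \<in> G \<Longrightarrow> \<exists>\<pi>. bij_betw \<pi> Y Y \<and> (\<forall>y\<in>Y. \<exists>g\<in>G'. t y \<circ> h = g \<circ> t (\<pi> y))"
begin

definition transfer :: "('v list \<Rightarrow>\<^sub>0 int) \<Rightarrow> 'v list \<Rightarrow>\<^sub>0 int" where
  "transfer c = (\<Sum>y\<in>Y. map_frag (map (t y)) c)"

lemma transfer_diff: "transfer (a - b) = transfer a - transfer b"
  by (simp add: transfer_def map_frag_diff sum_subtractf)

lemma frag_boundary_transfer: "frag_boundary (transfer c) = transfer (frag_boundary c)"
proof -
  have "frag_boundary (sum f I) = (\<Sum>i\<in>I. frag_boundary (f i))" for f :: "'y \<Rightarrow> 'v list \<Rightarrow>\<^sub>0 int" and I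
    by (induction I rule: infinite_finite_induct) (simp_all add: frag_boundary_add)
  then show ?thesis by (simp add: transfer_def frag_boundary_map)
qed

lemma transfer_chains: "c \<in> chains S k \<Longrightarrow> transfer c \<in> chains S k"
  unfolding transfer_def map_frag_def
  by (intro chains_sum frag_extend_chains) (auto simp: chains_of big.map_closed t_in)

text \<open>Translating by \<open>h\<close> only permutes the summands, up to elements of the small
  group; so the transfer descends from coinvariants of \<open>G\<close> to those of
  \<open>G'\<close>.\<close>

lemma transfer_coinv_null: "c \<in> coinv_null G S k \<Longrightarrow> transfer c \<in> coinv_null G' S k"
proof (induction rule: coinv_null.induct)
  case (gen h xs)
  obtain \<pi> where \<pi>: "bij_betw \<pi> Y Y" "\<forall>y\<in>Y. \<exists>g\<in>G'. t y \<circ> h = g \<circ> t (\<pi> y)"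
    using coset [OF gen(1)] by blast
  then have "\<pi> y \<in> Y" if "y \<in> Y" for y
    using that by (auto simp: bij_betw_def)
  have "transfer (frag_of xs) = (\<Sum>y\<in>Y. frag_of (map (t (\<pi> y)) xs))"
    using sum.reindex_bij_betw [OF \<pi>(1), of "\<lambda>y. frag_of (map (t y) xs)"] by (simp add: transfer_def)
  then have "transfer (frag_of (map h xs) - frag_of xs) =
      (\<Sum>y\<in>Y. frag_of (map (t y \<circ> h) xs) - frag_of (map (t (\<pi> y)) xs))"
    by (simp add: transfer_diff sum_subtractf) (simp add: transfer_def)
  also have "\<dots> \<in> coinv_null G' S k"
  proof (rule coinv_null_sum)
    fix y assume y: "y \<in> Y"
    then obtain g where g: "g \<in> G'" "t y \<circ> h = g \<circ> t (\<pi> y)" using \<pi>(2) by blast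
    have "frag_of (map g (map (t (\<pi> y)) xs)) - frag_of (map (t (\<pi> y)) xs) \<in> coinv_null G' S k"
      using gen g(1) y \<open>\<And>y. y \<in> Y \<Longrightarrow> \<pi> y \<in> Y\<close>
      by (intro coinv_null.gen) (auto simp: big.map_closed t_in)
    then show "frag_of (map (t y \<circ> h) xs) - frag_of (map (t (\<pi> y)) xs) \<in> coinv_null G' S k"
      by (simp only: g(2) map_map)
  qed
  finally show ?case .
qed (simp_all add: transfer_diff coinv_null.zero coinv_null.diff, simp add: transfer_def coinv_null.zero)

text \<open>Each summand is congruent to \<open>c\<close> for the big group: transfer followed by
  projection multiplies by the index.\<close>

lemma transfer_cong_cmul:
  assumes "c \<in> chains S k"
  shows "transfer c - frag_cmul (int (card Y)) c \<in> coinv_null G S k"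
proof -
  have "frag_cmul (int (card Y)) c = (\<Sum>y\<in>Y. c)"
    using finite_Y by (induction Y rule: finite_induct) (simp_all add: frag_cmul_distrib)
  then have "transfer c - frag_cmul (int (card Y)) c = (\<Sum>y\<in>Y. map_frag (map (t y)) c - c)"
    by (simp add: transfer_def sum_subtractf)
  then show ?thesis
    by (simp add: coinv_null_sum big.map_frag_diff_coinv_null [OF t_in assms])
qed

text \<open>Below degree \<open>d\<close> the transferred class vanishes for the small group, so the
  index annihilates the class of \<open>z\<close>; it is also annihilated by \<open>q\<close>, and
  Bezout combines the two. From degree \<open>d\<close> on there are no longer lists, hence no
  boundaries, and freeness of the coinvariants suffices.\<close>

lemma no_torsion:
  assumes acyclic: "\<And>k z. \<lbrakk>k < d; z \<in> chains S k; frag_boundary z \<in> coinv_null G' S (k - 1)\<rbrakk> \<Longrightarrow>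
      \<exists>b\<in>chains S (Suc k). z - frag_boundary b \<in> coinv_null G' S k"
    and top: "\<And>xs. xs \<in> S \<Longrightarrow> length xs \<le> d"
    and cop: "coprime q (int (card Y))" and q: "q \<noteq> 0"
    and z: "z \<in> chains S k" and b: "b \<in> chains S (Suc k)"
    and zb: "frag_cmul q z - frag_boundary b \<in> coinv_null G S k"
  shows "\<exists>b\<in>chains S (Suc k). z - frag_boundary b \<in> coinv_null G S k"
proof (cases "k < d")
  case True
  have "frag_boundary (frag_cmul q z - frag_boundary b) \<in> coinv_null G S (k - 1)"
    by (rule big.frag_boundary_coinv_null [OF zb])
  then have "frag_cmul q (frag_boundary z) \<in> coinv_null G S (k - 1)"
    by (simp add: frag_boundary_diff frag_boundary_cmul frag_boundary_boundary)
  \<comment> \<open>\<open>z\<close> is assumed to be a cycle only after multiplication by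
    \<open>q\<close>; torsion-freeness one degree below makes it a cycle itself.\<close>
  then have "frag_boundary z \<in> coinv_null G S (k - 1)"
    by (rule big.coinv_null_torsion_free [OF big.frag_boundary_chains' [OF z] q])
  then have "frag_boundary (transfer z) \<in> coinv_null G' S (k - 1)"
    by (simp add: frag_boundary_transfer transfer_coinv_null)
  then obtain b' where b': "b' \<in> chains S (Suc k)" "transfer z - frag_boundary b' \<in> coinv_null G' S k"
    using acyclic [OF True transfer_chains [OF z]] by blast
  let ?N = "int (card Y)"
  have "transfer z - frag_boundary b' - (transfer z - frag_cmul ?N z) \<in> coinv_null G S k"
    using b'(2) coinv_null_mono [OF sub] transfer_cong_cmul [OF z] by (blast intro: coinv_null.diff)
  moreover have "a - b - (a - c) = c - b" for a b c :: "'v list \<Rightarrow>\<^sub>0 int" by simp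
  ultimately have N: "frag_cmul ?N z - frag_boundary b' \<in> coinv_null G S k"
    by (simp only:)
  obtain u v where uv: "u * q + v * ?N = 1"
    using cop bezout_int [of q ?N] by (metis coprime_iff_gcd_eq_1)
  let ?b = "frag_cmul u b + frag_cmul v b'"
  have "frag_cmul u (frag_cmul q z - frag_boundary b) + frag_cmul v (frag_cmul ?N z - frag_boundary b')
      \<in> coinv_null G S k"
    by (intro coinv_null_add coinv_null_cmul zb N)
  also have "frag_cmul u (frag_cmul q z - frag_boundary b) + frag_cmul v (frag_cmul ?N z - frag_boundary b')
      = frag_cmul (u * q + v * ?N) z - frag_boundary ?b"
    by (simp add: frag_cmul_diff frag_boundary_add frag_boundary_cmul frag_cmul_distrib)
  finally show ?thesis
    using b b'(1) uv by (intro bexI [of _ ?b]) (auto intro: chains_add chains_cmul)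
next
  case False
  then have "{xs \<in> S. length xs = Suc k} = {}" using top by force
  then have "Poly_Mapping.keys b = {}" using b unfolding chains_def by blast
  then have "b = 0" by simp
  then have "z \<in> coinv_null G S k"
    using zb big.coinv_null_torsion_free [OF z q] by simp
  then show ?thesis by (intro bexI [of _ 0]) auto
qed

end

text \<open>
  A weighted form of algebraic discrete Morse theory: if the homotopy operator is the identity up
  to strictly smaller weight in degrees below the critical one, then the coinvariants are acyclic
  there.
\<close>
locale list_complex_matching = list_complex_action S G for S :: "'v list set" and G +
  fixes d :: nat and h :: "'v list \<Rightarrow> 'v list \<Rightarrow>\<^sub>0 int" and wt :: "'v list \<Rightarrow> nat"
  assumes h_chains: "xs \<in> S \<Longrightarrow> length xs < d \<Longrightarrow> h xs \<in> chains S (Suc (length xs))"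
    and h_map: "g \<in> G \<Longrightarrow> xs \<in> S \<Longrightarrow> length xs < d \<Longrightarrow> h (map g xs) = map_frag (map g) (h xs)"
    and h_wt: "\<lbrakk>xs \<in> S; length xs < d;
        ys \<in> Poly_Mapping.keys (frag_of xs - frag_boundary (h xs) - frag_extend h (list_boundary xs))\<rbrakk>
      \<Longrightarrow> wt ys < wt xs"
begin

lemma frag_extend_h_chains:
  "c \<in> chains S k \<Longrightarrow> k < d \<Longrightarrow> frag_extend h c \<in> chains S (Suc k)"
  by (rule frag_extend_chains [of c S k]) (use h_chains in auto)

lemma frag_extend_h_coinv_null:
  assumes "c \<in> coinv_null G S k" "k < d"
  shows "frag_extend h c \<in> coinv_null G S (Suc k)"
  using assms(1)
proof induction
  case (gen g xs)
  then show ?case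
    using map_frag_diff_coinv_null [OF gen(1) h_chains, of xs] h_map [of g xs] assms(2)
    by (simp add: frag_extend_diff)
qed (auto simp: frag_extend_diff intro: coinv_null.intros)

text \<open>With \<open>e\<close> = 1 - dh - hd, a cycle \<open>z\<close> of the coinvariants is
  homologous to \<open>e z\<close>, because \<open>h\<close> preserves null chains. Each application
  of \<open>e\<close> lowers the weight bound by one, until no term is left.\<close>

lemma acyclic:
  assumes k: "k < d" and z: "z \<in> chains S k" "frag_boundary z \<in> coinv_null G S (k - 1)"
  shows "\<exists>b\<in>chains S (Suc k). z - frag_boundary b \<in> coinv_null G S k"
proof -
  define e where "e c = c - frag_boundary (frag_extend h c) - frag_extend h (frag_boundary c)" for c
  have e_diff: "e (a - b) = e a - e b" for a b
    by (simp add: e_def frag_extend_diff frag_boundary_diff)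
  have h0: "frag_extend h (frag_boundary c) \<in> chains S k" if "c \<in> chains S k" for c
  proof (cases k)
    case 0
    then show ?thesis using frag_boundary_chains_0 that by auto
  next
    case (Suc l)
    then show ?thesis using frag_extend_h_chains [OF frag_boundary_chains, of c l] that k by simp
  qed
  have h0': "frag_extend h c \<in> coinv_null G S k" if "c \<in> coinv_null G S (k - 1)" "0 < k" for c
    using frag_extend_h_coinv_null [OF that(1)] k that(2) by auto
  have e_chains: "e c \<in> chains S k" if "c \<in> chains S k" for c
    unfolding e_def by (intro chains_diff that h0 frag_boundary_chains frag_extend_h_chains k)
  have wt: "\<forall>ys\<in>Poly_Mapping.keys (e c). wt ys < N"
    if "c \<in> chains S k" "\<forall>xs\<in>Poly_Mapping.keys c. wt xs < Suc N" for c N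
  proof -
    have "Poly_Mapping.keys c \<subseteq> {xs \<in> S. length xs = k \<and> wt xs < Suc N}"
      using that by (auto simp: chains_def)
    then have "Poly_Mapping.keys (e c) \<subseteq> {ys. wt ys < N}"
    proof (induction c rule: frag_induction)
      case (one xs)
      then show ?case using h_wt [of xs] k by (fastforce simp: e_def)
    next
      case (diff a b)
      then show ?case using keys_diff [of "e a" "e b"] by (auto simp: e_diff)
    qed (simp add: e_def)
    then show ?thesis by blast
  qed
  have "\<exists>b\<in>chains S (Suc k). z - frag_boundary b \<in> coinv_null G S k"
    if "z \<in> chains S k" "frag_boundary z \<in> coinv_null G S (k - 1)"
      "\<forall>xs\<in>Poly_Mapping.keys z. wt xs < N" for N z
    using that
  proof (induction N arbitrary: z)
    case 0
    then have "z = 0" by auto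
    then show ?case by (intro bexI [of _ 0]) (auto intro: coinv_null.zero)
  next
    case (Suc N)
    have hb: "frag_extend h (frag_boundary z) \<in> coinv_null G S k"
    proof (cases "k = 0")
      case True
      then show ?thesis using Suc.prems(1) frag_boundary_chains_0 by (auto intro: coinv_null.zero)
    qed (use h0' Suc.prems in auto)
    have "frag_boundary (e z) = frag_boundary z - frag_boundary (frag_extend h (frag_boundary z))"
      by (simp add: e_def frag_boundary_diff frag_boundary_boundary)
    then have "frag_boundary (e z) \<in> coinv_null G S (k - 1)"
      using frag_boundary_coinv_null [OF hb] Suc.prems(2) by (simp add: coinv_null.diff)
    then obtain b where b: "b \<in> chains S (Suc k)" "e z - frag_boundary b \<in> coinv_null G S k"
      using Suc.IH [OF e_chains [OF Suc.prems(1)]] wt [OF Suc.prems(1,3)] by blast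
    let ?b = "b + frag_extend h z"
    have "z - frag_boundary ?b = (e z - frag_boundary b) + frag_extend h (frag_boundary z)"
      by (simp add: e_def frag_boundary_add)
    then have "z - frag_boundary ?b \<in> coinv_null G S k"
      using coinv_null_add [OF b(2) hb] by simp
    then show ?case
      using b(1) frag_extend_h_chains [OF Suc.prems(1) k] by (blast intro: chains_add)
  qed
  \<comment> \<open>The bound is one more than the largest weight; the inserted 0 covers
    \<open>z = 0\<close>.\<close>
  from this [OF z, of "Suc (Max (insert 0 (wt ` Poly_Mapping.keys z)))"] show ?thesis
    by (simp add: less_Suc_eq_le)
qed

end

section \<open>The equivariant matching on chains of partitions\<close>

definition finer :: "nat \<Rightarrow> nat set set \<Rightarrow> nat set set \<Rightarrow> bool" where
  "finer n P Q \<longleftrightarrow> refines {1..n} P Q \<and> P \<noteq> Q"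

definition one_block :: "nat \<Rightarrow> nat set \<Rightarrow> nat set set" where
  "one_block n B = insert B ((\<lambda>i. {i}) ` ({1..n} - B))"

text \<open>For a partition and nonempty \<open>B\<close> this expresses that
  \<open>one_block n B\<close> refines it; see \<open>refines_one_block\<close>.\<close>

definition covers :: "nat set \<Rightarrow> nat set set \<Rightarrow> bool" where
  "covers B P \<longleftrightarrow> (\<exists>C\<in>P. B \<subseteq> C)"

text \<open>For a proper nonempty \<open>B\<close> these are the complements of {B, -B} in the
  interval above \<open>one_block n B\<close>.\<close>

definition extends_block :: "nat \<Rightarrow> nat set \<Rightarrow> nat set set \<Rightarrow> bool" where
  "extends_block n B P \<longleftrightarrow> (\<exists>j\<in>{1..n} - B. P = one_block n (insert j B))"

text \<open>The meet of \<open>P\<close> with \<open>{B, - B}\<close>, provided that \<open>B\<close> lies inside a block of \<open>P\<close>.\<close>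
definition split_off :: "nat set \<Rightarrow> nat set set \<Rightarrow> nat set set" where
  "split_off B P = insert B ((\<lambda>C. C - B) ` P - {{}})"

lemma finer_trans: "finer n P Q \<Longrightarrow> finer n Q R \<Longrightarrow> finer n P R"
  unfolding finer_def using refines_trans refines_asym by metis

lemma finer_irrefl: "\<not> finer n P P"
  by (simp add: finer_def)

lemma partition_block_unique:
  "\<lbrakk>partition_on A P; C \<in> P; D \<in> P; i \<in> C; i \<in> D\<rbrakk> \<Longrightarrow> C = D"
  by (auto simp: partition_on_def disjoint_def)

lemma partition_on_one_block: "\<lbrakk>B \<subseteq> {1..n}; B \<noteq> {}\<rbrakk> \<Longrightarrow> partition_on {1..n} (one_block n B)"
  by (auto simp: one_block_def partition_on_def disjoint_def)

lemma partition_on_split_off: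
  assumes P: "partition_on {1..n} P" and B: "B \<subseteq> {1..n}" "B \<noteq> {}"
  shows "partition_on {1..n} (split_off B P)"
proof (rule partition_onI)
  show "\<Union>(split_off B P) = {1..n}"
    using partition_onD1 [OF P] B by (auto simp: split_off_def)
  show "{} \<notin> split_off B P"
    using B by (auto simp: split_off_def)
  fix p q assume pq: "p \<in> split_off B P" "q \<in> split_off B P" "p \<noteq> q"
  have "disjnt (C - B) (D - B)" if "C \<in> P" "D \<in> P" "C - B \<noteq> D - B" for C D
  proof -
    have "C \<noteq> D" using that by auto
    then show ?thesis
      using partition_onD2 [OF P] that by (auto simp: disjoint_def disjnt_def)
  qed
  then show "disjnt p q"
    using pq by (auto simp: split_off_def disjnt_def)
qed

lemma refines_split_off:
  assumes P: "partition_on {1..n} P" and B: "B \<subseteq> {1..n}" "B \<noteq> {}" "covers B P"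
  shows "refines {1..n} (split_off B P) P"
  unfolding refines_def
  using partition_on_split_off [OF P B(1,2)] P B(3) by (auto simp: split_off_def covers_def)

text \<open>The universal property of the meet: a partition containing the block \<open>B\<close>
  lies below {B, -B}, so it lies below the meet once it refines \<open>P\<close>.\<close>

lemma refines_split_off_iff:
  assumes P: "partition_on {1..n} P" and B: "B \<subseteq> {1..n}" "B \<noteq> {}"
    and Q: "B \<in> Q" "refines {1..n} Q P"
  shows "refines {1..n} Q (split_off B P)"
  unfolding refines_def
proof (intro conjI ballI)
  show pQ: "partition_on {1..n} Q" using Q(2) by (simp add: refines_def)
  show "partition_on {1..n} (split_off B P)" by (rule partition_on_split_off [OF P B])
  fix D assume D: "D \<in> Q"
  show "\<exists>C\<in>split_off B P. D \<subseteq> C"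
  proof (cases "D = B")
    case False
    then have "D \<inter> B = {}"
      using partition_onD2 [OF pQ] D Q(1) by (auto simp: disjoint_def)
    moreover obtain C where "C \<in> P" "D \<subseteq> C" using Q(2) D by (auto simp: refines_def)
    moreover have "D \<noteq> {}" using D partition_onD3 [OF pQ] by blast
    ultimately have "C - B \<in> split_off B P" "D \<subseteq> C - B" by (auto simp: split_off_def)
    then show ?thesis by blast
  qed (auto simp: split_off_def)
qed

lemma covers_mono: "covers B P \<Longrightarrow> refines {1..n} P Q \<Longrightarrow> covers B Q"
  by (meson covers_def refines_def subset_trans)

lemma refines_one_block:
  assumes "partition_on {1..n} P" "B \<subseteq> {1..n}" "B \<noteq> {}" "covers B P"
  shows "refines {1..n} (one_block n B) P"
  unfolding refines_def
  using partition_on_one_block [OF assms(2,3)] partition_onD1 [OF assms(1)] assms(1,4)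
  by (auto simp: one_block_def covers_def)

text \<open>The block of \<open>Q\<close> around \<open>B\<close> is squeezed between
  \<open>B\<close> and \<open>B\<close>. Consequently the members of a chain that have
  \<open>B\<close> as a block form an initial segment.\<close>

lemma block_of_refinement:
  assumes "covers B Q" "refines {1..n} Q P" "B \<in> P" "B \<noteq> {}"
  shows "B \<in> Q"
proof -
  obtain C where C: "C \<in> Q" "B \<subseteq> C" using assms(1) by (auto simp: covers_def)
  then obtain D where D: "D \<in> P" "C \<subseteq> D" using assms(2) by (auto simp: refines_def)
  have P: "partition_on {1..n} P" using assms(2) by (simp add: refines_def)
  obtain i where i: "i \<in> B" using assms(4) by blast
  then have "i \<in> D" using C D by blast
  then have "D = B" using partition_block_unique [OF P D(1) assms(3) _ i] by simp
  then have "C = B" using C(2) D(2) by simp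
  then show ?thesis using C(1) by simp
qed

lemma extends_block_not_in:
  assumes "extends_block n B P" "B \<noteq> {}"
  shows "B \<notin> P"
  using assms by (auto simp: extends_block_def one_block_def)

text \<open>The meet collapses to the bottom of the interval only at the bottom and at complements,
  which is exactly where \<open>matching\<close> recurses. Every block other than the one around
  \<open>B\<close> survives the splitting and is thus a singleton; the block around \<open>B\<close>
  can exceed it by one point only.\<close>

lemma split_off_eq_one_block:
  assumes P: "partition_on {1..n} P" and B: "B \<subseteq> {1..n}" "B \<noteq> {}" "covers B P"
    and eq: "split_off B P = one_block n B"
  shows "P = one_block n B \<or> extends_block n B P"
proof -
  obtain C where C: "C \<in> P" "B \<subseteq> C" using B by (auto simp: covers_def)
  have sing: "\<exists>i\<in>{1..n} - B. D - B = {i}" if "D \<in> P" "\<not> D \<subseteq> B" for D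
  proof -
    have "D - B \<in> one_block n B" using that eq by (auto simp: split_off_def)
    moreover have "D - B \<noteq> B" using B(2) by auto
    ultimately show ?thesis by (auto simp: one_block_def)
  qed
  have disj: "D \<inter> C = {}" if "D \<in> P" "D \<noteq> C" for D
    using partition_onD2 [OF P] C that by (auto simp: disjoint_def)
  have ne: "D \<noteq> {}" if "D \<in> P" for D using partition_onD3 [OF P] that by blast
  have other: "\<exists>i\<in>{1..n} - C. D = {i}" if D: "D \<in> P" "D \<noteq> C" for D
  proof -
    have d: "D \<inter> C = {}" "D \<noteq> {}" using disj ne D by auto
    then have "\<not> D \<subseteq> B" using C by auto
    from sing [OF D(1) this] obtain i where "i \<in> {1..n} - B" "D - B = {i}" by (rule bexE)
    moreover have "D - B = D" using d C by auto
    ultimately show ?thesis using d by auto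
  qed
  have "P = one_block n C"
  proof
    show "P \<subseteq> one_block n C" using other by (auto simp: one_block_def)
    show "one_block n C \<subseteq> P"
    proof
      fix D assume "D \<in> one_block n C"
      then consider "D = C" | i where "i \<in> {1..n} - C" "D = {i}" by (auto simp: one_block_def)
      then show "D \<in> P"
      proof cases
        case 2
        then have "i \<in> \<Union>P" using partition_onD1 [OF P] by (metis DiffD1)
        then obtain E where "E \<in> P" "i \<in> E" by blast
        then show ?thesis using other [of E] 2 by auto
      qed (simp add: C)
    qed
  qed
  moreover have "C = B \<or> (\<exists>j\<in>{1..n} - B. C = insert j B)"
  proof (cases "C \<subseteq> B")
    case False
    from sing [OF C(1) this] obtain i where "i \<in> {1..n} - B" "C - B = {i}" by (rule bexE)
    then show ?thesis using C by blast
  qed (use C in auto)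
  ultimately show ?thesis by (auto simp: extends_block_def)
qed

text \<open>Complements are atoms of the interval above \<open>one_block n B\<close>; a chain
  avoiding the bottom can contain one only as its first member.\<close>

lemma extends_block_cover:
  assumes Q: "refines {1..n} Q P" "covers B Q" and P: "extends_block n B P"
    and B: "B \<subseteq> {1..n}" "B \<noteq> {}"
  shows "Q = one_block n B \<or> Q = P"
proof -
  obtain j where j: "j \<in> {1..n} - B" "P = one_block n (insert j B)"
    using P by (auto simp: extends_block_def)
  have pQ: "partition_on {1..n} Q" using Q(1) by (simp add: refines_def)
  obtain C where C: "C \<in> Q" "B \<subseteq> C" using Q by (auto simp: covers_def)
  obtain D where "D \<in> P" "C \<subseteq> D" using Q(1) C by (auto simp: refines_def)
  with C B j have "C \<subseteq> insert j B" by (auto simp: one_block_def)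
  have "refines {1..n} (one_block n B) Q"
    by (rule refines_one_block [OF pQ B Q(2)])
  show ?thesis
  proof (cases "j \<in> C")
    case True
    then have "refines {1..n} P Q"
      unfolding j(2) using C j B by (intro refines_one_block [OF pQ]) (auto simp: covers_def)
    then show ?thesis using Q(1) refines_asym by blast
  next
    case False
    then have "C = B" using C \<open>C \<subseteq> insert j B\<close> by auto
    have "refines {1..n} Q (one_block n B)"
      unfolding refines_def
    proof (intro conjI ballI pQ partition_on_one_block B)
      fix E assume E: "E \<in> Q"
      show "\<exists>F\<in>one_block n B. E \<subseteq> F"
      proof (cases "E = C")
        case True
        then show ?thesis using \<open>C = B\<close> by (auto simp: one_block_def)
      next
        case False
        then have d: "E \<inter> B = {}"
          using partition_onD2 [OF pQ] E C \<open>C = B\<close> by (auto simp: disjoint_def)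
        obtain F where F: "F \<in> P" "E \<subseteq> F" using Q(1) E by (auto simp: refines_def)
        from F(1) j have "F = insert j B \<or> (\<exists>i\<in>{1..n} - insert j B. F = {i})"
          by (auto simp: one_block_def)
        then consider "E \<subseteq> insert j B" | i where "i \<in> {1..n}" "i \<notin> B" "E \<subseteq> {i}"
          using F(2) by blast
        then show ?thesis
        proof cases
          case 1
          then have "E \<subseteq> {j}" using d by auto
          then show ?thesis using j by (auto simp: one_block_def)
        qed (auto simp: one_block_def)
      qed
    qed
    then show ?thesis using \<open>refines {1..n} (one_block n B) Q\<close> refines_asym by blast
  qed
qed

lemma proper_partition_refines_top:
  "P \<in> proper_partitions n \<Longrightarrow> 0 < n \<Longrightarrow> finer n P {{1..n}}"
proof -
  assume P: "P \<in> proper_partitions n" and "0 < n"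
  then have "partition_on {1..n} {{1..n}}" by (intro partition_on_space) auto
  then show ?thesis
    using P partition_onD1 [of "{1..n}" P]
    unfolding finer_def refines_def proper_partitions_def by blast
qed

text \<open>Chains in the open interval between \<open>one_block n B\<close> and the top
  partition.\<close>

definition chain_above :: "nat \<Rightarrow> nat set \<Rightarrow> nat set set list \<Rightarrow> bool" where
  "chain_above n B R \<longleftrightarrow> sorted_wrt (finer n) R \<and>
     (\<forall>P\<in>set R. P \<in> proper_partitions n \<and> covers B P \<and> P \<noteq> one_block n B)"

text \<open>The matching for chains without a complement. \<open>S\<close> collects the members with
  block \<open>B\<close>, and \<open>m\<close> is the meet for the first later member, or for the
  top if there is none. A chain already containing \<open>m\<close> is the larger partner of its
  pair and goes to 0; otherwise \<open>m\<close> is inserted, with the sign of its position.\<close>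

definition toggle :: "nat \<Rightarrow> nat set \<Rightarrow> nat set set list \<Rightarrow> nat set set list \<Rightarrow>\<^sub>0 int" where
  "toggle n B R =
     (let S = takeWhile (\<lambda>P. B \<in> P) R; U = dropWhile (\<lambda>P. B \<in> P) R;
          m = split_off B (hd (U @ [{{1..n}}]))
      in if S \<noteq> [] \<and> last S = m then 0 else frag_cmul ((-1) ^ length S) (frag_of (S @ m # U)))"

definition block_at :: "nat \<Rightarrow> nat set set \<Rightarrow> nat set" where
  "block_at x P = \<Union>{C \<in> P. x \<in> C}"

text \<open>
  The flag part of a chain is its longest initial segment in which the block of \<open>x\<close> grows by one
  point at a time and all other blocks are singletons. Behind a flag ending in the block \<open>B\<close>, the
  matching inserts or removes the meet with \<open>{B, - B}\<close> of the first member not containing \<open>B\<close>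
  as a block; the one-block partition serves as a sentinel.
\<close>
fun matching :: "nat \<Rightarrow> nat \<Rightarrow> nat set \<Rightarrow> nat set set list \<Rightarrow> nat set set list \<Rightarrow>\<^sub>0 int" where
  "matching n x B [] = toggle n B []"
| "matching n x B (P # R) =
     (if extends_block n B P then - map_frag ((#) P) (matching n x (block_at x P) R)
      else toggle n B (P # R))"

text \<open>The toggle inserts only into the segment with block \<open>B\<close>, so the count
  ignores that segment. The summand \<open>n\<close> per flag step exceeds the length of every chain
  to which the homotopy is applied, so losing a flag step always lowers the weight.\<close>

fun matching_weight :: "nat \<Rightarrow> nat \<Rightarrow> nat set \<Rightarrow> nat set set list \<Rightarrow> nat" where
  "matching_weight n x B [] = 0"
| "matching_weight n x B (P # R) =
     (if extends_block n B P then n + matching_weight n x (block_at x P) R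
      else length (dropWhile (\<lambda>P. B \<in> P) (P # R)))"

text \<open>Chains on which \<open>matching\<close> reduces to the toggle, with the cut made
  explicit. The sentinel in the last clause matters for the empty chain: if only one point lies
  outside \<open>B\<close>, the meet with the top would be the bottom of the interval.\<close>

definition toggle_split :: "nat \<Rightarrow> nat set \<Rightarrow> nat set set list \<Rightarrow> nat set set list \<Rightarrow> bool" where
  "toggle_split n B S U \<longleftrightarrow> chain_above n B (S @ U) \<and> (\<forall>P\<in>set S. B \<in> P) \<and> (\<forall>P\<in>set U. B \<notin> P) \<and>
     \<not> extends_block n B (hd (S @ U @ [{{1..n}}]))"

lemma chain_aboveD:
  assumes "chain_above n B R" "P \<in> set R"
  shows "partition_on {1..n} P" "P \<in> proper_partitions n" "covers B P" "P \<noteq> one_block n B"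
    "P \<noteq> {{1..n}}"
  using assms by (auto simp: chain_above_def proper_partitions_def)

lemma chain_above_Cons_iff:
  "chain_above n B (P # R) \<longleftrightarrow> P \<in> proper_partitions n \<and> covers B P \<and> P \<noteq> one_block n B \<and>
     (\<forall>Q\<in>set R. finer n P Q) \<and> chain_above n B R"
  by (auto simp: chain_above_def)

lemma chain_above_append_iff:
  "chain_above n B (R @ R') \<longleftrightarrow> chain_above n B R \<and> chain_above n B R' \<and>
     (\<forall>P\<in>set R. \<forall>Q\<in>set R'. finer n P Q)"
  by (auto simp: chain_above_def sorted_wrt_append)

context
  fixes n x :: nat and B :: "nat set"
  assumes xB: "x \<in> B" and B_proper: "B \<subset> {1..n}"
begin

lemma BA: "B \<subseteq> {1..n}" and B_not_top: "B \<noteq> {1..n}"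
  using B_proper by auto

lemma B_nonempty: "B \<noteq> {}"
  using xB by auto

lemma n_pos: "0 < n"
  using xB BA by auto

lemma toggle_split_eval:
  assumes "toggle_split n B S U"
  shows "matching n x B (S @ U) =
      (let m = split_off B (hd (U @ [{{1..n}}]))
       in if S \<noteq> [] \<and> last S = m then 0 else frag_cmul ((-1) ^ length S) (frag_of (S @ m # U)))"
    and "matching_weight n x B (S @ U) = length U"
proof -
  have S: "\<forall>P\<in>set S. B \<in> P" and U: "\<forall>P\<in>set U. B \<notin> P"
    and hd: "\<not> extends_block n B (hd (S @ U @ [{{1..n}}]))"
    using assms by (auto simp: toggle_split_def)
  have tw: "takeWhile (\<lambda>P. B \<in> P) (S @ U) = S" "dropWhile (\<lambda>P. B \<in> P) (S @ U) = U"
    using S U by (simp_all add: takeWhile_append2 dropWhile_append2 takeWhile_eq_Nil_iff dropWhile_eq_self_iff)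
      (cases U; simp)+
  have "matching n x B (S @ U) = toggle n B (S @ U)"
    using hd by (cases "S @ U") (auto simp flip: append_assoc)
  then show "matching n x B (S @ U) =
      (let m = split_off B (hd (U @ [{{1..n}}]))
       in if S \<noteq> [] \<and> last S = m then 0 else frag_cmul ((-1) ^ length S) (frag_of (S @ m # U)))"
    by (simp only: toggle_def tw Let_def)
  have "matching_weight n x B (S @ U) = length (dropWhile (\<lambda>P. B \<in> P) (S @ U))"
    using hd by (cases "S @ U") (auto simp flip: append_assoc)
  then show "matching_weight n x B (S @ U) = length U"
    by (simp only: tw)
qed

lemma toggle_split_exists:
  assumes R: "chain_above n B R" and hd: "\<not> extends_block n B (hd (R @ [{{1..n}}]))"
  shows "toggle_split n B (takeWhile (\<lambda>P. B \<in> P) R) (dropWhile (\<lambda>P. B \<in> P) R)"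
proof -
  have drop: "B \<notin> P" if "P \<in> set (dropWhile (\<lambda>P. B \<in> P) R)" for P
    using R that
  proof (induction R)
    case (Cons Q R)
    show ?case
    proof (cases "B \<in> Q")
      case True
      then show ?thesis using Cons by (auto simp: chain_above_Cons_iff)
    next
      case False
      then have "P = Q \<or> finer n Q P" using Cons.prems by (auto simp: chain_above_Cons_iff)
      then show ?thesis
        using False block_of_refinement [of B Q n P] B_nonempty Cons.prems(1)
        by (auto simp: chain_above_Cons_iff finer_def)
    qed
  qed simp
  have take: "B \<in> P" if "P \<in> set (takeWhile (\<lambda>P. B \<in> P) R)" for P
    using set_takeWhileD [OF that] by simp
  have hd_eq: "hd (takeWhile (\<lambda>P. B \<in> P) R @ dropWhile (\<lambda>P. B \<in> P) R @ [{{1..n}}]) = hd (R @ [{{1..n}}])"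
    by (metis append_assoc takeWhile_dropWhile_id)
  show ?thesis
    unfolding toggle_split_def
  proof (intro conjI ballI)
    show "chain_above n B (takeWhile (\<lambda>P. B \<in> P) R @ dropWhile (\<lambda>P. B \<in> P) R)"
      using R by simp
    show "\<not> extends_block n B (hd (takeWhile (\<lambda>P. B \<in> P) R @ dropWhile (\<lambda>P. B \<in> P) R @ [{{1..n}}]))"
      unfolding hd_eq by (rule hd)
  qed (fact take, fact drop)
qed

lemma covers_top: "covers B {{1..n}}"
  using BA by (simp add: covers_def)

lemma hd_top_properties:
  assumes "chain_above n B R"
  defines "T \<equiv> hd (R @ [{{1..n}}])"
  shows "partition_on {1..n} T" "covers B T"
proof -
  show "partition_on {1..n} T"
    using chain_aboveD(1) [OF assms(1), of T] n_pos
    by (cases R) (auto simp: T_def partition_on_space)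
  show "covers B T"
    using chain_aboveD(3) [OF assms(1), of T] covers_top by (cases R) (auto simp: T_def)
qed

lemma not_extends_block_above:
  assumes "P \<in> proper_partitions n" "covers B P" "P \<noteq> one_block n B" "finer n P Q"
  shows "\<not> extends_block n B Q"
  using extends_block_cover [of n P Q B] assms BA B_nonempty by (auto simp: finer_def)

lemma not_extends_block_tail:
  assumes "chain_above n B (a # R)"
  shows "\<not> extends_block n B (hd (R @ [{{1..n}}]))"
proof -
  have a: "a \<in> proper_partitions n" "covers B a" "a \<noteq> one_block n B" "\<forall>Q\<in>set R. finer n a Q"
    using assms by (auto simp: chain_above_Cons_iff)
  then have "finer n a (hd (R @ [{{1..n}}]))"
    using proper_partition_refines_top [OF a(1) n_pos] by (cases R) auto
  then show ?thesis by (rule not_extends_block_above [OF a(1-3)])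
qed

text \<open>Passing to a face creates no flag step: the head either stays or lies strictly above a
  deleted member of the interval, whereas complements are atoms.\<close>

lemma not_extends_block_delete:
  assumes "chain_above n B (R @ a # R')" "\<not> extends_block n B (hd (R @ a # R' @ [{{1..n}}]))"
  shows "\<not> extends_block n B (hd (R @ R' @ [{{1..n}}]))"
  using assms not_extends_block_tail [of a R'] by (cases R) auto

lemma toggle_split_delete_first:
  assumes c: "toggle_split n B (S1 @ a # S2) U"
  shows "toggle_split n B (S1 @ S2) U"
  using c not_extends_block_delete [of S1 a "S2 @ U"]
  by (auto simp: toggle_split_def chain_above_append_iff chain_above_Cons_iff)

lemma toggle_split_delete_second:
  assumes c: "toggle_split n B S (U1 @ a # U2)"
  shows "toggle_split n B S (U1 @ U2)"
  using c not_extends_block_delete [of "S @ U1" a U2]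
  by (auto simp: toggle_split_def chain_above_append_iff chain_above_Cons_iff)

text \<open>All members of \<open>S\<close> refine the meet by its universal property, so
  \<open>m\<close> can occur in \<open>S\<close> only at the end; having \<open>B\<close> as a
  block, it lies strictly below \<open>U\<close>. Hence \<open>m\<close> fits between
  \<open>S\<close> and \<open>U\<close> without changing the cut.\<close>

lemma toggle_split_insert:
  assumes c: "toggle_split n B S U"
  defines "m \<equiv> split_off B (hd (U @ [{{1..n}}]))"
  shows "m \<in> set S \<Longrightarrow> last S = m"
    and "\<not> (S \<noteq> [] \<and> last S = m) \<Longrightarrow> toggle_split n B (S @ [m]) U"
proof -
  let ?T = "hd (U @ [{{1..n}}])"
  have ch: "chain_above n B S" "chain_above n B U" and SU: "\<forall>P\<in>set S. \<forall>Q\<in>set U. finer n P Q"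
    and S: "\<forall>P\<in>set S. B \<in> P" and U: "\<forall>P\<in>set U. B \<notin> P"
    using c by (auto simp: toggle_split_def chain_above_append_iff)
  have T: "partition_on {1..n} ?T" "covers B ?T" using hd_top_properties [OF ch(2)] by auto
  have Tcases: "?T \<in> set U \<or> ?T = {{1..n}}" using hd_in_set [of "U @ [{{1..n}}]"] by auto
  have ST: "finer n P ?T" if "P \<in> set S" for P
    using that SU Tcases proper_partition_refines_top [OF chain_aboveD(2) [OF ch(1)] n_pos] by auto
  have pm: "partition_on {1..n} m"
    unfolding m_def by (rule partition_on_split_off [OF T(1) BA B_nonempty])
  have Bm: "B \<in> m" by (simp add: m_def split_off_def)
  have mT: "refines {1..n} m ?T"
    unfolding m_def by (rule refines_split_off [OF T(1) BA B_nonempty T(2)])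
  have Sm: "refines {1..n} P m" if "P \<in> set S" for P
    unfolding m_def using ST [OF that] S that
    by (intro refines_split_off_iff [OF T(1) BA B_nonempty]) (auto simp: finer_def)
  show *: "last S = m" if "m \<in> set S"
  proof (rule ccontr)
    assume "last S \<noteq> m"
    moreover have ne: "S \<noteq> []" using that by auto
    then have "S = butlast S @ [last S]" by simp
    ultimately have "m \<in> set (butlast S)" using that by (metis Un_iff empty_iff empty_set insert_iff list.simps(15) set_append)
    then have "finer n m (last S)"
      using ch(1) \<open>S = butlast S @ [last S]\<close> chain_above_append_iff [of n B "butlast S" "[last S]"] by auto
    then show False
      using Sm [of "last S"] ne refines_asym [of "{1..n}" m "last S"] by (auto simp: finer_def)
  qed
  assume nl: "\<not> (S \<noteq> [] \<and> last S = m)"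
  then have mS: "m \<notin> set S" using * by force
  have BT: "B \<notin> ?T"
    using Tcases U B_not_top by auto
  have covm: "covers B m" using Bm by (auto simp: covers_def)
  \<comment> \<open>For empty \<open>S\<close> the meet could degenerate only at a complement,
    excluded by \<open>toggle_split\<close>; otherwise \<open>m\<close> lies above a member of
    \<open>S\<close>, which is above the bottom.\<close>
  have m_ne: "m \<noteq> one_block n B"
  proof (cases S)
    case Nil
    have "\<not> extends_block n B ?T"
      using c Nil by (simp add: toggle_split_def)
    moreover have "?T \<noteq> one_block n B"
      using BT by (auto simp: one_block_def)
    ultimately show ?thesis
      using split_off_eq_one_block [OF T(1) BA B_nonempty T(2)] unfolding m_def by blast
  next
    case (Cons P S')
    then have P: "refines {1..n} P m" "covers B P" "P \<noteq> one_block n B" "partition_on {1..n} P"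
      using Sm chain_aboveD [OF ch(1), of P] by auto
    then have "refines {1..n} (one_block n B) P"
      by (intro refines_one_block BA B_nonempty) auto
    then show ?thesis using P refines_asym by metis
  qed
  have "m \<noteq> (\<lambda>i. {i}) ` {1..n}"
  proof
    assume m: "m = (\<lambda>i. {i}) ` {1..n}"
    then obtain i where "i \<in> {1..n}" "B = {i}" using Bm by auto
    then have "one_block n B = m" unfolding m by (auto simp: one_block_def)
    then show False using m_ne by simp
  qed
  moreover have "m \<noteq> {{1..n}}" using Bm B_not_top by auto
  ultimately have proper: "m \<in> proper_partitions n" using pm by (simp add: proper_partitions_def)
  have Sm': "finer n P m" if "P \<in> set S" for P
    using Sm [OF that] mS that by (auto simp: finer_def)
  have mU: "finer n m Q" if Q: "Q \<in> set U" for Q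
  proof -
    obtain T' U' where U': "U = T' # U'" using Q by (cases U) auto
    then have "finer n m T'" using mT Bm BT by (auto simp: finer_def)
    moreover have "Q = T' \<or> finer n T' Q" using Q ch(2) U' by (auto simp: chain_above_Cons_iff)
    ultimately show ?thesis using finer_trans by blast
  qed
  have "\<not> extends_block n B (hd ((S @ [m]) @ U @ [{{1..n}}]))"
  proof (cases S)
    case Nil
    then show ?thesis using extends_block_not_in [OF _ B_nonempty, of n m] Bm by auto
  next
    case (Cons P S')
    then show ?thesis using c by (simp add: toggle_split_def)
  qed
  then show "toggle_split n B (S @ [m]) U"
    using ch proper covm m_ne Sm' mU SU S U Bm
    by (auto simp: toggle_split_def chain_above_append_iff chain_above_Cons_iff chain_above_def [of n B "[]"])
qed

lemma matching_keys_toggle: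
  assumes c: "toggle_split n B S U" and Y: "Y \<in> Poly_Mapping.keys (matching n x B (S @ U))"
  shows "chain_above n B Y \<and> length Y = Suc (length (S @ U)) \<and> matching_weight n x B Y = length U"
proof -
  let ?m = "split_off B (hd (U @ [{{1..n}}]))"
  have nl: "\<not> (S \<noteq> [] \<and> last S = ?m)"
    using Y unfolding toggle_split_eval(1) [OF c] by (auto simp: Let_def)
  then have "Y \<in> Poly_Mapping.keys (frag_cmul ((-1) ^ length S) (frag_of (S @ ?m # U)))"
    using Y unfolding toggle_split_eval(1) [OF c] by (simp only: Let_def if_False)
  then have "Y = (S @ [?m]) @ U" by simp
  moreover have "toggle_split n B (S @ [?m]) U" by (rule toggle_split_insert(2) [OF c nl])
  ultimately show ?thesis
    using toggle_split_eval(2) [of "S @ [?m]" U] by (auto simp: toggle_split_def)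
qed

definition lower :: "nat \<Rightarrow> nat \<Rightarrow> (nat set set list \<Rightarrow>\<^sub>0 int) \<Rightarrow> bool" where
  "lower l w c \<longleftrightarrow> (\<forall>Y\<in>Poly_Mapping.keys c. chain_above n B Y \<and> length Y = l \<and> matching_weight n x B Y < w)"

lemma lower_add: "lower l w a \<Longrightarrow> lower l w b \<Longrightarrow> lower l w (a + b)"
  unfolding lower_def using keys_add [of a b] by blast

lemma lower_diff: "lower l w a \<Longrightarrow> lower l w b \<Longrightarrow> lower l w (a - b)"
  unfolding lower_def using keys_diff [of a b] by blast

lemma lower_cmul: "lower l w a \<Longrightarrow> lower l w (frag_cmul k a)"
  unfolding lower_def using keys_cmul [of k a] by blast

text \<open>Deleting a member of \<open>U\<close> lowers the weight by one, and the toggle does not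
  raise it again.\<close>

lemma frag_extend_matching_lower:
  assumes c: "toggle_split n B S U"
  shows "lower (length (S @ U)) (length U)
     (frag_extend (matching n x B) (map_frag ((@) S) (list_boundary U)))"
  unfolding lower_def
proof
  fix Y assume "Y \<in> Poly_Mapping.keys (frag_extend (matching n x B) (map_frag ((@) S) (list_boundary U)))"
  then obtain Z where Z: "Z \<in> Poly_Mapping.keys (map_frag ((@) S) (list_boundary U))"
      "Y \<in> Poly_Mapping.keys (matching n x B Z)"
    using subsetD [OF keys_frag_extend [of "matching n x B"]] by auto
  from subsetD [OF keys_map_frag Z(1)]
  obtain V where V: "V \<in> Poly_Mapping.keys (list_boundary U)" "Z = S @ V"
    by auto
  from keys_list_boundary [OF V(1)] obtain U1 a U2 where U: "U = U1 @ a # U2" "V = U1 @ U2"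
    by (elim exE conjE)
  have "toggle_split n B S V"
    using toggle_split_delete_second c U by simp
  from matching_keys_toggle [OF this] Z(2) V(2) U
  show "chain_above n B Y \<and> length Y = length (S @ U) \<and> matching_weight n x B Y < length U"
    by simp
qed

lemma keys_boundary_after_meet_lower:
  assumes c: "toggle_split n B (S @ [m]) U"
  shows "lower (length (S @ U)) (length U) (map_frag (\<lambda>zs. S @ m # zs) (list_boundary U))"
  unfolding lower_def
proof
  fix Y assume "Y \<in> Poly_Mapping.keys (map_frag (\<lambda>zs. S @ m # zs) (list_boundary U))"
  from subsetD [OF keys_map_frag this]
  obtain V where V: "V \<in> Poly_Mapping.keys (list_boundary U)" "Y = (S @ [m]) @ V"
    by auto
  from keys_list_boundary [OF V(1)] obtain U1 a U2 where U: "U = U1 @ a # U2" "V = U1 @ U2"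
    by (elim exE conjE)
  have "toggle_split n B (S @ [m]) V"
    using toggle_split_delete_second c U by simp
  with toggle_split_eval(2) [OF this] V U
  show "chain_above n B Y \<and> length Y = length (S @ U) \<and> matching_weight n x B Y < length U"
    by (simp add: toggle_split_def)
qed

text \<open>Deleting a member of \<open>S\<close> leaves \<open>U\<close>, and therefore
  \<open>m\<close>, unchanged, but moves the insertion one place forward; the resulting sign change
  produces the cancellation against the boundary of the inserted chain.\<close>

lemma frag_extend_matching_front:
  assumes c: "toggle_split n B S U" and m: "m = split_off B (hd (U @ [{{1..n}}]))" and mS: "m \<notin> set S"
  shows "frag_extend (matching n x B) (map_frag (\<lambda>zs. zs @ U) (list_boundary S)) =
    frag_cmul (- ((-1) ^ length S)) (map_frag (\<lambda>zs. zs @ m # U) (list_boundary S))"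
proof -
  have "matching n x B (V @ U) = frag_cmul (- ((-1) ^ length S)) (frag_of (V @ m # U))"
    if V: "V \<in> Poly_Mapping.keys (list_boundary S)" for V
  proof -
    obtain S1 a S2 where S: "S = S1 @ a # S2" "V = S1 @ S2"
      using keys_list_boundary [OF V] by blast
    have V': "toggle_split n B V U" using toggle_split_delete_first c S by simp
    have nl: "\<not> (V \<noteq> [] \<and> last V = m)"
      using mS S last_in_set [of V] by auto
    have "matching n x B (V @ U) = frag_cmul ((-1) ^ length V) (frag_of (V @ m # U))"
      unfolding toggle_split_eval(1) [OF V'] m [symmetric] Let_def using nl by (rule if_not_P)
    moreover have "(-1::int) ^ length V = - ((-1) ^ length S)" using S by simp
    ultimately show ?thesis by (simp only:)
  qed
  then have "frag_extend (\<lambda>V. matching n x B (V @ U)) (list_boundary S) =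
      frag_extend (\<lambda>V. frag_cmul (- ((-1) ^ length S)) (frag_of (V @ m # U))) (list_boundary S)"
    by (rule frag_extend_eq)
  then show ?thesis
    unfolding frag_extend_cmul_of frag_extend_map_frag .
qed

text \<open>If \<open>m\<close> is absent, deleting it after insertion returns the chain, faces in
  \<open>S\<close> cancel, and faces in \<open>U\<close> have lower weight. If \<open>m\<close> ends
  \<open>S\<close>, the operator kills the chain, and among the faces in \<open>S\<close> only the
  one without \<open>m\<close> contributes, returning the chain itself.\<close>

lemma matching_homotopy_toggle:
  assumes c: "toggle_split n B S U"
  shows "lower (length (S @ U)) (length U)
     (frag_of (S @ U) - frag_boundary (matching n x B (S @ U)) -
      frag_extend (matching n x B) (list_boundary (S @ U)))"
proof -
  let ?H = "frag_extend (matching n x B)" and ?e = "(-1::int) ^ length S"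
  define m where "m = split_off B (hd (U @ [{{1..n}}]))"
  have ee: "?e * ?e = 1" by (simp flip: power_add)
  define L where "L = frag_cmul ?e (?H (map_frag ((@) S) (list_boundary U)))"
  have L: "lower (length (S @ U)) (length U) L"
    unfolding L_def by (intro lower_cmul frag_extend_matching_lower c)
  have Hb: "?H (list_boundary (S @ U)) = ?H (map_frag (\<lambda>zs. zs @ U) (list_boundary S)) + L"
    by (simp add: list_boundary_append frag_extend_add frag_extend_cmul L_def)
  show ?thesis
  proof (cases "S \<noteq> [] \<and> last S = m")
    case False
    have mS: "m \<notin> set S" using toggle_split_insert(1) [OF c] False by (force simp: m_def)
    have c': "toggle_split n B (S @ [m]) U"
      using toggle_split_insert(2) [OF c] False by (simp add: m_def)
    have "matching n x B (S @ U) = frag_cmul ?e (frag_of (S @ m # U))"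
      using toggle_split_eval(1) [OF c] False by (simp only: m_def Let_def if_False)
    then have "frag_boundary (matching n x B (S @ U)) =
        frag_cmul ?e (map_frag (\<lambda>zs. zs @ m # U) (list_boundary S)) +
        (frag_of (S @ U) - map_frag (\<lambda>zs. S @ m # zs) (list_boundary U))"
      by (simp add: frag_boundary_cmul list_boundary_append frag_cmul_distrib2 ee map_frag_diff map_frag_map_frag)
    moreover have "?H (map_frag (\<lambda>zs. zs @ U) (list_boundary S)) =
        frag_cmul (- ?e) (map_frag (\<lambda>zs. zs @ m # U) (list_boundary S))"
      by (rule frag_extend_matching_front [OF c m_def mS])
    moreover have "frag_cmul ?e X + frag_cmul (- ?e) X = 0" for X :: "nat set set list \<Rightarrow>\<^sub>0 int"
      using frag_cmul_distrib [of ?e "- ?e" X] by simp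
    moreover have "a - (p + (a - q)) - (p' + l) = q - l" if "p + p' = 0"
      for a p p' q l :: "nat set set list \<Rightarrow>\<^sub>0 int"
      using that by (simp add: algebra_simps eq_neg_iff_add_eq_0)
    ultimately have "frag_of (S @ U) - frag_boundary (matching n x B (S @ U)) - ?H (list_boundary (S @ U))
        = map_frag (\<lambda>zs. S @ m # zs) (list_boundary U) - L"
      unfolding Hb by (simp only:)
    then show ?thesis
      using lower_diff [OF keys_boundary_after_meet_lower [OF c'] L] by simp
  next
    case True
    define S' where "S' = butlast S"
    have S: "S = S' @ [m]" using True append_butlast_last_id [of S] by (simp add: S'_def)
    have c': "toggle_split n B S' U"
      using toggle_split_delete_first [of S' m "[]"] c S by simp
    have mS': "m \<notin> set S'"
      using c S by (auto simp: toggle_split_def chain_above_append_iff chain_above_Cons_iff finer_irrefl)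
    have m0: "matching n x B (S @ U) = 0"
      using toggle_split_eval(1) [OF c] True by (simp add: m_def Let_def)
    \<comment> \<open>Deleting a member before \<open>m\<close> leaves \<open>m\<close> in its
      place, so the face is again the larger partner of a pair.\<close>
    have z: "matching n x B ((V @ [m]) @ U) = 0" if V: "V \<in> Poly_Mapping.keys (list_boundary S')" for V
    proof -
      obtain S1 a S2 where "S' = S1 @ a # S2" "V = S1 @ S2"
        using keys_list_boundary [OF V] by blast
      then have "toggle_split n B (V @ [m]) U"
        using toggle_split_delete_first [of S1 a "S2 @ [m]"] c S by simp
      then show ?thesis
        using toggle_split_eval(1) [of "V @ [m]" U] by (simp only: m_def Let_def) simp
    qed
    have "?H (map_frag (\<lambda>zs. (zs @ [m]) @ U) (list_boundary S')) = 0"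
      using frag_extend_eq_0 [of "list_boundary S'" "\<lambda>V. matching n x B ((V @ [m]) @ U)"] z
      unfolding frag_extend_map_frag by blast
    moreover have "matching n x B (S' @ U) = frag_cmul ((-1) ^ length S') (frag_of (S @ U))"
    proof -
      have "\<not> (S' \<noteq> [] \<and> last S' = m)" using mS' last_in_set [of S'] by auto
      then show ?thesis
        using toggle_split_eval(1) [OF c'] by (simp only: m_def [symmetric] Let_def if_False) (simp add: S)
    qed
    moreover have "(-1::int) ^ length S' * (-1) ^ length S' = 1" by (simp flip: power_add)
    ultimately have "?H (map_frag (\<lambda>zs. zs @ U) (list_boundary S)) = frag_of (S @ U)"
      by (simp add: S list_boundary_append map_frag_add map_frag_cmul map_frag_map_frag
          frag_extend_add frag_extend_cmul)
    then have "frag_of (S @ U) - frag_boundary (matching n x B (S @ U)) - ?H (list_boundary (S @ U)) = frag_cmul (-1) L"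
      unfolding Hb m0 by simp
    then show ?thesis
      using lower_cmul [OF L, of "-1"] by simp
  qed
qed

end

section \<open>Recursion of the matching along the flag\<close>

lemma block_at_one_block: "x \<in> B \<Longrightarrow> block_at x (one_block n B) = B"
  by (auto simp: block_at_def one_block_def)

lemma extends_block_top_card:
  assumes "extends_block n B {{1..n}}" "B \<subseteq> {1..n}"
  shows "n \<le> Suc (card B)"
proof -
  obtain j where j: "{{1..n}} = one_block n (insert j B)"
    using assms(1) by (auto simp: extends_block_def)
  have "insert j B \<in> one_block n (insert j B)" by (simp add: one_block_def)
  then have "insert j B = {1..n}" unfolding j [symmetric] by (rule singletonD)
  then have "card (insert j B) = n" by simp
  then show ?thesis using card_insert_le_m1 [of "n" B j] card_insert_if [of B j] finite_subset [OF assms(2)]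
    by (auto split: if_splits)
qed

text \<open>The length bound rules out the one remaining obstruction: the empty chain when all but
  one point lie in \<open>B\<close>. A flag that long is already a maximal chain.\<close>

lemma not_extends_block_head:
  assumes "B \<subseteq> {1..n}" "length R + card B + 1 < n"
    and "\<And>P R'. R = P # R' \<Longrightarrow> \<not> extends_block n B P"
  shows "\<not> extends_block n B (hd (R @ [{{1..n}}]))"
proof (cases R)
  case Nil
  then show ?thesis using extends_block_top_card [OF _ assms(1)] assms(2) by auto
qed (use assms(3) in auto)

context
  fixes n x :: nat and B B' :: "nat set" and j :: nat
  assumes xB: "x \<in> B" and B'A: "B' \<subset> {1..n}" and j: "j \<in> {1..n} - B" and B': "B' = insert j B"
begin

lemma flag_step_B: "B \<subset> {1..n}" "x \<in> B'" "B' \<subseteq> {1..n}" "B \<noteq> {}" "B' \<noteq> {}" "B \<subseteq> B'"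
  using xB B'A j B' by auto

lemma covers_step: "covers B' P \<Longrightarrow> covers B P"
  unfolding covers_def using flag_step_B by blast

lemma not_covers_step: "\<not> covers B' (one_block n B)"
proof
  assume "covers B' (one_block n B)"
  then consider "B' \<subseteq> B" | i where "i \<in> {1..n} - B" "B' \<subseteq> {i}"
    unfolding covers_def one_block_def by blast
  then show False
    using xB j B' by cases auto
qed

text \<open>Behind an atom of the interval, a chain is a chain in the interval above that atom; this
  is what permits the recursion.\<close>

lemma chain_above_step:
  "chain_above n B (one_block n B' # Y) \<longleftrightarrow> one_block n B' \<in> proper_partitions n \<and> chain_above n B' Y"
proof (intro iffI conjI)
  have cB': "covers B' (one_block n B')" by (auto simp: covers_def one_block_def)
  {
    assume c: "chain_above n B (one_block n B' # Y)"
    then show "one_block n B' \<in> proper_partitions n" by (simp add: chain_above_Cons_iff)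
    have "covers B' Q \<and> Q \<noteq> one_block n B'" if "Q \<in> set Y" for Q
      using c that covers_mono [OF cB', of n Q] by (auto simp: chain_above_Cons_iff finer_def)
    then show "chain_above n B' Y"
      using c by (auto simp: chain_above_def)
  }
  assume c: "one_block n B' \<in> proper_partitions n \<and> chain_above n B' Y"
  have Q: "finer n (one_block n B') Q \<and> covers B Q \<and> Q \<noteq> one_block n B" if Q: "Q \<in> set Y" for Q
  proof -
    have Q': "partition_on {1..n} Q" "covers B' Q" "Q \<noteq> one_block n B'"
      using chain_aboveD [OF conjunct2 [OF c] Q] by auto
    then have "refines {1..n} (one_block n B') Q"
      by (intro refines_one_block flag_step_B)
    then show ?thesis
      using Q' covers_step not_covers_step by (auto simp: finer_def)
  qed
  have "covers B (one_block n B')" "one_block n B' \<noteq> one_block n B"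
    using covers_step [OF cB'] not_covers_step cB' by auto
  then show "chain_above n B (one_block n B' # Y)"
    using c Q by (auto simp: chain_above_def)
qed

lemma not_extends_block_after_step:
  assumes c: "chain_above n B (one_block n B' # Y)"
  shows "chain_above n B Y" "\<not> extends_block n B (hd (Y @ [{{1..n}}]))"
  using c not_extends_block_tail [OF xB flag_step_B(1) c] by (simp_all add: chain_above_Cons_iff)

text \<open>Once the flag member is dropped, no flag step can start, so no summand \<open>n\<close>
  remains and the weight is the length of a tail.\<close>

lemma matching_weight_after_step:
  assumes c: "chain_above n B (one_block n B' # Y)"
  shows "matching_weight n x B Y \<le> length Y"
proof -
  note s = toggle_split_exists [OF xB flag_step_B(1) not_extends_block_after_step [OF c]]
  show ?thesis
    using toggle_split_eval(2) [OF xB flag_step_B(1) s] length_dropWhile_le [of "\<lambda>P. B \<in> P" Y] by simp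
qed

end

text \<open>A flag step shortens the list by one and enlarges the block by one, so the bound on
  length plus block size is preserved. The 2 arises because \<open>R\<close> is only the tail behind
  \<open>P\<close>.\<close>

lemma extends_blockE:
  assumes "extends_block n B P" "x \<in> B" "B \<subseteq> {1..n}" "length R + card B + 2 < n"
  obtains j where "j \<in> {1..n} - B" "P = one_block n (insert j B)" "insert j B \<subset> {1..n}"
    "length R + card (insert j B) + 1 < n" "block_at x P = insert j B"
proof -
  obtain j where j: "j \<in> {1..n} - B" "P = one_block n (insert j B)"
    using assms(1) by (auto simp: extends_block_def)
  have fin: "finite B" using assms(3) finite_subset by blast
  then have card: "card (insert j B) = Suc (card B)" using j by simp
  then have "insert j B \<noteq> {1..n}" using assms(4) by auto
  then have "insert j B \<subset> {1..n}" using j assms(3) by auto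
  moreover have "block_at x P = insert j B"
    unfolding j(2) using assms(2) by (intro block_at_one_block) simp
  ultimately show thesis
    using that j card assms(4) by simp
qed

text \<open>Flag steps are left in place and the inserted meet has \<open>B\<close> as a block, so
  neither contribution to the weight changes.\<close>

lemma matching_keys:
  assumes "x \<in> B" "B \<subset> {1..n}" "chain_above n B R" "length R + card B + 1 < n"
    and "Y \<in> Poly_Mapping.keys (matching n x B R)"
  shows "chain_above n B Y \<and> length Y = Suc (length R) \<and> matching_weight n x B Y = matching_weight n x B R"
  using assms
proof (induction R arbitrary: B Y)
  case Nil
  have "\<not> extends_block n B (hd ([] @ [{{1..n}}]))"
    by (rule not_extends_block_head) (use Nil in auto)
  then have s: "toggle_split n B [] []"
    using Nil.prems(3) by (simp add: toggle_split_def)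
  show ?case
    using matching_keys_toggle [OF Nil.prems(1,2) s] Nil.prems(5) by simp
next
  case (Cons P R)
  show ?case
  proof (cases "extends_block n B P")
    case True
    obtain j where j: "j \<in> {1..n} - B" "P = one_block n (insert j B)" "insert j B \<subset> {1..n}"
        "length R + card (insert j B) + 1 < n" "block_at x P = insert j B"
      using extends_blockE [OF True Cons.prems(1)] Cons.prems(2,4) by auto
    note step = Cons.prems(1) j(3,1) refl
    have "Y \<in> Poly_Mapping.keys (map_frag ((#) P) (matching n x (insert j B) R))"
      using Cons.prems(5) True j(5) by simp
    from subsetD [OF keys_map_frag this] obtain Z where
      Z: "Z \<in> Poly_Mapping.keys (matching n x (insert j B) R)" "Y = P # Z" by auto
    have R: "P \<in> proper_partitions n" "chain_above n (insert j B) R"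
      using chain_above_step [OF step, of R] Cons.prems(3) j(2) by auto
    have "chain_above n (insert j B) Z \<and> length Z = Suc (length R) \<and>
        matching_weight n x (insert j B) Z = matching_weight n x (insert j B) R"
      by (rule Cons.IH [OF _ j(3) R(2) j(4) Z(1)]) (use Cons.prems(1) in simp)
    then show ?thesis
      using chain_above_step [OF step, of Z] R(1) j(2,5) Z(2) True by simp
  next
    case False
    then have "\<not> extends_block n B (hd ((P # R) @ [{{1..n}}]))" by simp
    note s = toggle_split_exists [OF Cons.prems(1,2,3) this]
    show ?thesis
      using matching_keys_toggle [OF Cons.prems(1,2) s, of Y] toggle_split_eval(2) [OF Cons.prems(1,2) s]
        Cons.prems(5) unfolding takeWhile_dropWhile_id by simp
  qed
qed

text \<open>By the cone formula, the error for a flag member \<open>P\<close> is the error for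
  \<open>R\<close> above \<open>P\<close>, prefixed by \<open>P\<close>, plus two terms from
  deleting \<open>P\<close>: the operators for the new and the old block applied to
  \<open>R\<close>. The prefixed term decreases by induction, the other two have lost the summand
  \<open>n\<close>.\<close>

lemma matching_homotopy:
  assumes "x \<in> B" "B \<subset> {1..n}" "chain_above n B R" "length R + card B + 1 < n"
  shows "lower n x B (length R) (matching_weight n x B R)
     (frag_of R - frag_boundary (matching n x B R) - frag_extend (matching n x B) (list_boundary R))"
  using assms
proof (induction R arbitrary: B)
  case Nil
  have "\<not> extends_block n B (hd ([] @ [{{1..n}}]))"
    by (rule not_extends_block_head) (use Nil in auto)
  then have s: "toggle_split n B [] []"
    using Nil.prems(3) by (simp add: toggle_split_def)
  show ?case
    using matching_homotopy_toggle [OF Nil.prems(1,2) s] by simp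
next
  case (Cons P R)
  show ?case
  proof (cases "extends_block n B P")
    case True
    obtain j where j: "j \<in> {1..n} - B" "P = one_block n (insert j B)" "insert j B \<subset> {1..n}"
        "length R + card (insert j B) + 1 < n" "block_at x P = insert j B"
      using extends_blockE [OF True Cons.prems(1)] Cons.prems(2,4) by auto
    let ?B' = "insert j B"
    note step = Cons.prems(1) j(3,1) refl
    have xB': "x \<in> ?B'" using Cons.prems(1) by simp
    have R: "P \<in> proper_partitions n" "chain_above n ?B' R"
      using chain_above_step [OF step, of R] Cons.prems(3) j(2) by auto
    have mP: "matching n x B (P # Z) = - map_frag ((#) P) (matching n x ?B' Z)" for Z
      using True j(5) by simp
    have wP: "matching_weight n x B (P # Z) = n + matching_weight n x ?B' Z" for Z
      using True j(5) by simp
    have HP: "frag_extend (matching n x B) (map_frag ((#) P) c) =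
        - map_frag ((#) P) (frag_extend (matching n x ?B') c)" for c
      by (induction c rule: frag_induct) (simp_all add: map_frag_diff frag_extend_diff mP del: matching.simps)
    let ?E = "frag_of R - frag_boundary (matching n x ?B' R) - frag_extend (matching n x ?B') (list_boundary R)"
    have eq: "frag_of (P # R) - frag_boundary (matching n x B (P # R)) - frag_extend (matching n x B) (list_boundary (P # R))
        = map_frag ((#) P) ?E + matching n x ?B' R - matching n x B R"
      by (simp add: mP HP frag_boundary_minus frag_boundary_cons frag_extend_diff map_frag_diff del: matching.simps)
    let ?w = "matching_weight n x B (P # R)" and ?l = "length (P # R)"
    have "lower n x ?B' (length R) (matching_weight n x ?B' R) ?E"
      by (rule Cons.IH [OF xB' j(3) R(2) j(4)])
    then have 1: "lower n x B ?l ?w (map_frag ((#) P) ?E)"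
      unfolding lower_def [OF xB' j(3)] lower_def [OF Cons.prems(1,2)]
    proof (intro ballI)
      fix Y assume E: "\<forall>Y\<in>Poly_Mapping.keys ?E. chain_above n ?B' Y \<and> length Y = length R \<and>
          matching_weight n x ?B' Y < matching_weight n x ?B' R"
        and Y: "Y \<in> Poly_Mapping.keys (map_frag ((#) P) ?E)"
      from subsetD [OF keys_map_frag Y] obtain Z where Z: "Z \<in> Poly_Mapping.keys ?E" "Y = P # Z" by auto
      have "chain_above n B (P # Z)"
        using chain_above_step [OF step, of Z] bspec [OF E Z(1)] R(1) j(2) by simp
      with bspec [OF E Z(1)] show "chain_above n B Y \<and> length Y = ?l \<and> matching_weight n x B Y < ?w"
        unfolding Z(2) wP by simp
    qed
    \<comment> \<open>These chains have lost \<open>P\<close>, so relative to \<open>B\<close> their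
      weight is at most their length, which is below \<open>n\<close>.\<close>
    have 2: "lower n x B ?l ?w (matching n x ?B' R)"
      unfolding lower_def [OF Cons.prems(1,2)]
    proof (intro ballI)
      fix Y assume "Y \<in> Poly_Mapping.keys (matching n x ?B' R)"
      from matching_keys [OF xB' j(3) R(2) j(4) this]
      have Y: "chain_above n ?B' Y" "length Y = Suc (length R)" by auto
      then have c: "chain_above n B (one_block n ?B' # Y)"
        using chain_above_step [OF step, of Y] R(1) j(2) by simp
      show "chain_above n B Y \<and> length Y = ?l \<and> matching_weight n x B Y < ?w"
        using not_extends_block_after_step(1) [OF step c] matching_weight_after_step [OF step c] Y(2)
          Cons.prems(4) by (simp add: wP del: matching_weight.simps)
    qed
    \<comment> \<open>Here the toggle for the old block \<open>B\<close> applies, since no flag step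
      follows the deleted \<open>P\<close>.\<close>
    have 3: "lower n x B ?l ?w (matching n x B R)"
      unfolding lower_def [OF Cons.prems(1,2)]
    proof (intro ballI)
      fix Y assume Y: "Y \<in> Poly_Mapping.keys (matching n x B R)"
      have c: "chain_above n B (one_block n ?B' # R)"
        using Cons.prems(3) j(2) by simp
      note s = toggle_split_exists [OF Cons.prems(1,2) not_extends_block_after_step [OF step c]]
      show "chain_above n B Y \<and> length Y = ?l \<and> matching_weight n x B Y < ?w"
        using matching_keys_toggle [OF Cons.prems(1,2) s, of Y] Y length_dropWhile_le [of "\<lambda>P. B \<in> P" R]
          Cons.prems(4) unfolding takeWhile_dropWhile_id by (simp add: wP del: matching_weight.simps)
    qed
    show ?thesis
      unfolding eq by (intro lower_add lower_diff Cons.prems 1 2 3)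
  next
    case False
    then have "\<not> extends_block n B (hd ((P # R) @ [{{1..n}}]))" by simp
    note s = toggle_split_exists [OF Cons.prems(1,2,3) this]
    show ?thesis
      using matching_homotopy_toggle [OF Cons.prems(1,2) s] toggle_split_eval(2) [OF Cons.prems(1,2) s]
      unfolding takeWhile_dropWhile_id by simp
  qed
qed

section \<open>Equivariance of the matching\<close>

context
  fixes \<sigma> :: "nat \<Rightarrow> nat" and n :: nat
  assumes \<sigma>: "\<sigma> permutes {1..n}"
begin

lemma permute_partition_eq_iff: "permute_partition \<sigma> P = permute_partition \<sigma> Q \<longleftrightarrow> P = Q"
  using inj_permute_partition [OF \<sigma>] by (simp add: inj_eq)

lemma mem_permute_partition_iff: "\<sigma> ` B \<in> permute_partition \<sigma> P \<longleftrightarrow> B \<in> P"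
  using inj_image_mem_iff [of "(`) \<sigma>" B P] permutes_inj [OF \<sigma>] by (simp add: permute_partition_def inj_on_image)

lemma permute_partition_top: "permute_partition \<sigma> {{1..n}} = {{1..n}}"
  by (simp only: permute_partition_def image_insert image_empty permutes_image [OF \<sigma>])

lemma permute_partition_one_block:
  assumes "B \<subseteq> {1..n}"
  shows "permute_partition \<sigma> (one_block n B) = one_block n (\<sigma> ` B)"
proof -
  have "\<sigma> ` ({1..n} - B) = {1..n} - \<sigma> ` B"
    by (simp only: image_set_diff [OF permutes_inj [OF \<sigma>]] permutes_image [OF \<sigma>])
  moreover have "permute_partition \<sigma> (one_block n B) = insert (\<sigma> ` B) ((\<lambda>i. {i}) ` \<sigma> ` ({1..n} - B))"
    by (simp only: permute_partition_def one_block_def image_insert image_image image_empty)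
  ultimately show ?thesis by (simp only: one_block_def)
qed

lemma extends_block_permute_iff:
  assumes B: "B \<subseteq> {1..n}"
  shows "extends_block n (\<sigma> ` B) (permute_partition \<sigma> P) \<longleftrightarrow> extends_block n B P"
proof -
  have "{1..n} - \<sigma> ` B = \<sigma> ` ({1..n} - B)"
    by (simp only: image_set_diff [OF permutes_inj [OF \<sigma>]] permutes_image [OF \<sigma>])
  then have "extends_block n (\<sigma> ` B) (permute_partition \<sigma> P) \<longleftrightarrow>
      (\<exists>j\<in>{1..n} - B. permute_partition \<sigma> P = one_block n (\<sigma> ` insert j B))"
    by (simp add: extends_block_def)
  also have "\<dots> \<longleftrightarrow> (\<exists>j\<in>{1..n} - B. permute_partition \<sigma> P = permute_partition \<sigma> (one_block n (insert j B)))"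
    by (intro bex_cong refl) (use B in \<open>simp add: permute_partition_one_block\<close>)
  finally show ?thesis by (simp add: permute_partition_eq_iff extends_block_def)
qed

lemma split_off_permute: "split_off (\<sigma> ` B) (permute_partition \<sigma> P) = permute_partition \<sigma> (split_off B P)"
proof -
  have "(\<lambda>C. C - \<sigma> ` B) ` permute_partition \<sigma> P = (`) \<sigma> ` (\<lambda>C. C - B) ` P"
    by (simp add: permute_partition_def image_image image_set_diff [OF permutes_inj [OF \<sigma>]])
  moreover have "(`) \<sigma> ` X - {{}} = (`) \<sigma> ` (X - {{}})" for X by auto
  ultimately show ?thesis
    by (simp add: split_off_def permute_partition_def)
qed

lemma block_at_permute: "\<sigma> x = x \<Longrightarrow> block_at x (permute_partition \<sigma> P) = \<sigma> ` block_at x P"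
proof -
  assume x: "\<sigma> x = x"
  have "x \<in> \<sigma> ` C \<longleftrightarrow> x \<in> C" for C
    using inj_image_mem_iff [OF permutes_inj [OF \<sigma>], of x C] x by simp
  then have "{C \<in> permute_partition \<sigma> P. x \<in> C} = (`) \<sigma> ` {C \<in> P. x \<in> C}"
    by (auto simp: permute_partition_def)
  then show ?thesis by (simp add: block_at_def image_Union)
qed

lemma toggle_permute:
  "toggle n (\<sigma> ` B) (map (permute_partition \<sigma>) R) = map_frag (map (permute_partition \<sigma>)) (toggle n B R)"
proof -
  let ?g = "permute_partition \<sigma>" and ?S = "takeWhile (\<lambda>P. B \<in> P) R" and ?U = "dropWhile (\<lambda>P. B \<in> P) R"
  have S: "takeWhile (\<lambda>P. \<sigma> ` B \<in> P) (map ?g R) = map ?g ?S"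
    and U: "dropWhile (\<lambda>P. \<sigma> ` B \<in> P) (map ?g R) = map ?g ?U"
    by (simp_all add: takeWhile_map dropWhile_map o_def mem_permute_partition_iff)
  have "hd (map ?g ?U @ [{{1..n}}]) = ?g (hd (?U @ [{{1..n}}]))"
    by (cases ?U) (simp_all only: permute_partition_top list.map append.simps list.sel)
  then have m: "split_off (\<sigma> ` B) (hd (map ?g ?U @ [{{1..n}}])) = ?g (split_off B (hd (?U @ [{{1..n}}])))"
    by (simp only: split_off_permute)
  have "map ?g ?S \<noteq> [] \<and> last (map ?g ?S) = ?g m \<longleftrightarrow> ?S \<noteq> [] \<and> last ?S = m" for m
    by (auto simp: last_map permute_partition_eq_iff)
  then show ?thesis
    unfolding toggle_def S U m Let_def by (simp add: map_frag_cmul)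
qed

text \<open>All ingredients are intrinsic to the refinement order, to \<open>B\<close> and to
  \<open>x\<close>. The block must be allowed to move, because a permutation fixing \<open>x\<close>
  need not fix the later blocks of the flag.\<close>

lemma matching_permute:
  assumes "x \<in> B" "B \<subseteq> {1..n}" "\<sigma> x = x"
  shows "matching n x (\<sigma> ` B) (map (permute_partition \<sigma>) R) =
    map_frag (map (permute_partition \<sigma>)) (matching n x B R)"
  using assms(1,2)
proof (induction R arbitrary: B)
  case Nil
  then show ?case using toggle_permute [of B "[]"] by simp
next
  case (Cons P R)
  show ?case
  proof (cases "extends_block n B P")
    case True
    then obtain j where "j \<in> {1..n} - B" "P = one_block n (insert j B)"
      by (auto simp: extends_block_def)
    then have "block_at x P = insert j B" "insert j B \<subseteq> {1..n}"
      using Cons.prems block_at_one_block [of x "insert j B"] by auto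
    then show ?thesis
      using True Cons.IH [of "insert j B"] Cons.prems
      by (simp add: extends_block_permute_iff block_at_permute assms(3) map_frag_minus map_frag_map_frag)
  next
    case False
    then show ?thesis
      using toggle_permute [of B "P # R"] Cons.prems by (simp add: extends_block_permute_iff)
  qed
qed

lemma finer_permute: "finer n P Q \<Longrightarrow> finer n (permute_partition \<sigma> P) (permute_partition \<sigma> Q)"
  using refines_permute_partition [OF \<sigma>] by (auto simp: finer_def permute_partition_eq_iff)

end

section \<open>Chains of proper partitions and their acyclicity\<close>

definition partition_chains :: "nat \<Rightarrow> nat set set list set" where
  "partition_chains n = {R. set R \<subseteq> proper_partitions n \<and> sorted_wrt (finer n) R}"

text \<open>For \<open>B = {x}\<close> the bottom of the interval is the partition into singletons,
  so the matching starts on all chains.\<close>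

lemma partition_chains_iff_chain_above:
  assumes "x \<in> {1..n}"
  shows "R \<in> partition_chains n \<longleftrightarrow> chain_above n {x} R"
proof -
  have "one_block n {x} = (\<lambda>i. {i}) ` {1..n}"
    using assms by (auto simp: one_block_def)
  moreover have "covers {x} P" if "P \<in> proper_partitions n" for P
    using that partition_onD1 [of "{1..n}" P] assms by (auto simp: covers_def proper_partitions_def)
  ultimately show ?thesis
    by (auto simp: partition_chains_def chain_above_def proper_partitions_def)
qed

text \<open>Sending a block of \<open>P\<close> to the block of \<open>Q\<close> around it is onto;
  were it also injective, each block would equal its image and the partitions would
  coincide.\<close>

lemma card_finer:
  assumes "finer n P Q"
  shows "card Q < card P"
proof -
  have P: "partition_on {1..n} P" and Q: "partition_on {1..n} Q" and r: "\<forall>C\<in>P. \<exists>D\<in>Q. C \<subseteq> D"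
    and ne: "P \<noteq> Q"
    using assms by (auto simp: finer_def refines_def)
  have fin: "finite P" using P finite_elements by blast
  obtain f where f: "\<And>C. C \<in> P \<Longrightarrow> f C \<in> Q \<and> C \<subseteq> f C" using r by metis
  have sub: "f C = D" if "C \<in> P" "D \<in> Q" "i \<in> C" "i \<in> D" for C D i
    using f [OF that(1)] partition_block_unique [OF Q _ that(2) _ that(4)] that(3) by blast
  have ex: "\<exists>C\<in>P. f C = D \<and> i \<in> C" if "D \<in> Q" "i \<in> D" for D i
  proof -
    have "i \<in> \<Union>P" using that partition_onD1 [OF P] partition_onD1 [OF Q] by auto
    then show ?thesis using sub that by blast
  qed
  have surj: "f ` P = Q"
  proof
    show "Q \<subseteq> f ` P"
    proof
      fix D assume "D \<in> Q"
      moreover from this obtain i where "i \<in> D" using partition_onD3 [OF Q] by (metis ex_in_conv)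
      ultimately show "D \<in> f ` P" using ex by blast
    qed
  qed (use f in auto)
  have "card Q \<le> card P" using card_image_le [OF fin, of f] surj by simp
  moreover have "card Q \<noteq> card P"
  proof
    assume eq: "card Q = card P"
    then have inj: "inj_on f P" using surj fin by (intro eq_card_imp_inj_on) auto
    have "f C = C" if C: "C \<in> P" for C
    proof
      show "f C \<subseteq> C"
      proof
        fix i assume "i \<in> f C"
        then obtain C' where "C' \<in> P" "f C' = f C" "i \<in> C'" using ex [of "f C" i] f [OF C] by blast
        then show "i \<in> C" using inj C by (auto dest: inj_onD)
      qed
    qed (use f C in auto)
    then have "P = Q" using surj by auto
    then show False using ne by simp
  qed
  ultimately show ?thesis by simp
qed

text \<open>Block numbers decrease strictly along a chain and lie between 2 and
  \<open>n - 1\<close>.\<close>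

lemma length_partition_chains:
  assumes R: "R \<in> partition_chains n" and n: "2 \<le> n"
  shows "length R \<le> n - 2"
proof -
  have "card P \<in> {2..n-1}" if "P \<in> set R" for P
  proof -
    have P: "P \<in> proper_partitions n" using that R by (auto simp: partition_chains_def)
    have "card {{1..n}} < card P"
      using card_finer [OF proper_partition_refines_top [OF P]] n by simp
    moreover have "finer n ((\<lambda>i. {i}) ` {1..n}) P"
      using P partition_on_singletons [of "{1..n}"] partition_onD1 [of "{1..n}" P]
      by (auto simp: finer_def refines_def proper_partitions_def)
    then have "card P < n"
      using card_finer by (fastforce simp: card_image)
    ultimately show ?thesis using n by auto
  qed
  then have "card ` set R \<subseteq> {2..n-1}" by auto
  then have "card (card ` set R) \<le> n - 2"
    using card_mono [of "{2..n-1}" "card ` set R"] n by auto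
  moreover have "sorted_wrt (finer n) xs \<Longrightarrow> distinct (map card xs)" for xs
  proof (induction xs)
    case (Cons P xs)
    then show ?case using card_finer by fastforce
  qed simp
  then have "distinct (map card R)" using R by (simp add: partition_chains_def)
  then have "card (card ` set R) = length R"
    using distinct_card by fastforce
  ultimately show ?thesis by simp
qed

lemma list_complex_group_action_partition_chains:
  assumes H: "subgroup H (sym_group n)"
  shows "list_complex_group_action (partition_chains n) (permute_partition ` H)"
proof
  have perm: "\<sigma> permutes {1..n}" if "\<sigma> \<in> H" for \<sigma>
    using subgroup.subset [OF H] that by (auto simp: sym_group_carrier)
  show "as @ bs \<in> partition_chains n" if "as @ a # bs \<in> partition_chains n"
    for as bs :: "nat set set list" and a
    using that by (auto simp: partition_chains_def sorted_wrt_append)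
  show "map g xs \<in> partition_chains n" if "g \<in> permute_partition ` H" "xs \<in> partition_chains n" for g xs
    using that permute_partition_proper perm finer_permute
    by (auto simp: partition_chains_def sorted_wrt_map intro: sorted_wrt_mono_rel [of xs "finer n"])
  have "id \<in> H" using subgroup.one_closed [OF H] by (simp add: sym_group_one)
  moreover have "permute_partition id = id" using permute_partition_id by auto
  ultimately show "id \<in> permute_partition ` H" by force
  show "g \<circ> h \<in> permute_partition ` H" if gh: "g \<in> permute_partition ` H" "h \<in> permute_partition ` H" for g h
  proof -
    obtain \<sigma> \<tau> where st: "g = permute_partition \<sigma>" "h = permute_partition \<tau>" "\<sigma> \<in> H" "\<tau> \<in> H"
      using gh by auto
    then have "\<sigma> \<circ> \<tau> \<in> H" using subgroup.m_closed [OF H] by (simp add: sym_group_mult)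
    moreover have "g \<circ> h = permute_partition (\<sigma> \<circ> \<tau>)" using st by (simp add: fun_eq_iff permute_partition_comp)
    ultimately show ?thesis by blast
  qed
  show "\<exists>h\<in>permute_partition ` H. h \<circ> g = id" if g: "g \<in> permute_partition ` H" for g
  proof -
    obtain \<sigma> where \<sigma>: "g = permute_partition \<sigma>" "\<sigma> \<in> H" using g by auto
    have "inv\<^bsub>sym_group n\<^esub> \<sigma> \<in> H" by (rule subgroup.m_inv_closed [OF H \<sigma>(2)])
    moreover have "inv\<^bsub>sym_group n\<^esub> \<sigma> = inv' \<sigma>"
      using perm [OF \<sigma>(2)] by (intro group.inv_equality [OF sym_group_is_group])
        (simp_all add: sym_group_carrier sym_group_mult sym_group_one permutes_inv permutes_inv_o)
    moreover have "permute_partition (inv' \<sigma>) \<circ> g = id"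
      using permute_partition_inv(2) [OF perm [OF \<sigma>(2)]] \<sigma>(1) by auto
    ultimately show ?thesis by (intro bexI [of _ "permute_partition (inv' \<sigma>)"]) auto
  qed
qed

lemma partition_chains_acyclic:
  assumes H: "subgroup H (sym_group n)" and x: "x \<in> {1..n}" "\<And>\<sigma>. \<sigma> \<in> H \<Longrightarrow> \<sigma> x = x"
    and k: "k < n - 2" and z: "z \<in> chains (partition_chains n) k"
      "frag_boundary z \<in> coinv_null (permute_partition ` H) (partition_chains n) (k - 1)"
  shows "\<exists>b\<in>chains (partition_chains n) (Suc k).
    z - frag_boundary b \<in> coinv_null (permute_partition ` H) (partition_chains n) k"
proof -
  interpret list_complex_group_action "partition_chains n" "permute_partition ` H"
    by (rule list_complex_group_action_partition_chains [OF H])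
  have perm: "\<sigma> permutes {1..n}" if "\<sigma> \<in> H" for \<sigma>
    using subgroup.subset [OF H] that by (auto simp: sym_group_carrier)
  have "{x} \<noteq> {1..n}"
  proof
    assume "{x} = {1..n}"
    then have "card {x} = n" by simp
    then show False using k by simp
  qed
  then have proper: "{x} \<subset> {1..n}" using x(1) by blast
  interpret list_complex_matching "partition_chains n" "permute_partition ` H" "n - 2"
    "matching n x {x}" "matching_weight n x {x}"
  proof
    fix xs assume xs: "xs \<in> partition_chains n" "length xs < n - 2"
    \<comment> \<open>As \<open>{x}\<close> has one element, length below \<open>n - 2\<close> is
      exactly the bound required by the matching.\<close>
    then have c: "chain_above n {x} xs" and l: "length xs + card {x} + 1 < n"
      using partition_chains_iff_chain_above [OF x(1)] by auto
    show "matching n x {x} xs \<in> chains (partition_chains n) (Suc (length xs))"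
      using matching_keys [OF _ proper c l] partition_chains_iff_chain_above [OF x(1)]
      by (auto simp: chains_def)
    show "matching n x {x} (map g xs) = map_frag (map g) (matching n x {x} xs)"
      if g: "g \<in> permute_partition ` H" for g
    proof -
      obtain \<sigma> where \<sigma>: "\<sigma> \<in> H" "g = permute_partition \<sigma>" using g by blast
      show ?thesis
        using matching_permute [OF perm [OF \<sigma>(1)], of x "{x}" xs] x(1) x(2) [OF \<sigma>(1)] \<sigma>(2) by simp
    qed
    show "matching_weight n x {x} ys < matching_weight n x {x} xs"
      if "ys \<in> Poly_Mapping.keys (frag_of xs - frag_boundary (matching n x {x} xs) -
          frag_extend (matching n x {x}) (list_boundary xs))" for ys
      using matching_homotopy [OF _ proper c l] that lower_def [OF _ proper, of x] by simp
  qed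
  show ?thesis by (rule acyclic [OF k z])
qed

section \<open>Transfer from the stabiliser of a point\<close>

lemma sum_list_take_Suc: "i < length ns \<Longrightarrow> sum_list (take (Suc i) ns) = sum_list (take i ns) + ns ! i"
  for ns :: "nat list"
  by (simp add: take_Suc_conv_app_nth)

lemma sum_list_take_mono: "i \<le> j \<Longrightarrow> sum_list (take i ns) \<le> sum_list (take j ns)" for ns :: "nat list"
  by (metis le_add1 le_add_diff_inverse sum_list_append take_add)

lemma card_young_block: "i < length ns \<Longrightarrow> card (young_block ns i) = ns ! i"
  by (simp add: young_block_def sum_list_take_Suc)

lemma young_block_subset: "young_block ns i \<subseteq> {1..sum_list ns}"
  using sum_list_take_mono [of "Suc i" "max (Suc i) (length ns)" ns] by (auto simp: young_block_def)

lemma young_block_disjoint: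
  assumes "x \<in> young_block ns i" "x \<in> young_block ns j"
  shows "i = j"
proof (rule linorder_cases [of i j])
  assume "i < j"
  then show ?thesis using assms sum_list_take_mono [of "Suc i" j ns] by (auto simp: young_block_def)
next
  assume "j < i"
  then show ?thesis using assms sum_list_take_mono [of "Suc j" i ns] by (auto simp: young_block_def)
qed

text \<open>With \<open>x\<close> fixed and \<open>y\<close> running through its block, these
  transpositions represent the cosets of the stabiliser of \<open>x\<close>.\<close>

lemma transpose_in_young_subgroup:
  assumes "x \<in> young_block ns i" "y \<in> young_block ns i"
  shows "Transposition.transpose x y \<in> young_subgroup ns"
proof -
  have "x \<in> {1..sum_list ns}" "y \<in> {1..sum_list ns}"
    using assms young_block_subset by blast+
  then have "Transposition.transpose x y permutes {1..sum_list ns}"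
    by (rule permutes_swap_id)
  moreover have "x \<in> young_block ns j \<longleftrightarrow> y \<in> young_block ns j" for j
    using assms young_block_disjoint by metis
  ultimately show ?thesis
    by (simp add: young_subgroup_def sym_group_carrier)
qed

lemma subgroup_stabilizer:
  assumes H: "subgroup H (sym_group n)"
  shows "subgroup {\<sigma> \<in> H. \<sigma> x = x} (sym_group n)"
proof (rule group.subgroupI [OF sym_group_is_group])
  show "{\<sigma> \<in> H. \<sigma> x = x} \<subseteq> carrier (sym_group n)"
    using subgroup.subset [OF H] by blast
  have "id \<in> H" using subgroup.one_closed [OF H] by (simp add: sym_group_one)
  then show "{\<sigma> \<in> H. \<sigma> x = x} \<noteq> {}" by auto
  fix \<sigma> assume \<sigma>: "\<sigma> \<in> {\<sigma> \<in> H. \<sigma> x = x}"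
  then have c: "\<sigma> \<in> carrier (sym_group n)" using subgroup.subset [OF H] by auto
  then have "inv' \<sigma> x = x" using \<sigma> permutes_inv_eq [of \<sigma> "{1..n}" x x] by (simp add: sym_group_carrier)
  then show "inv\<^bsub>sym_group n\<^esub> \<sigma> \<in> {\<sigma> \<in> H. \<sigma> x = x}"
    using \<sigma> subgroup.m_inv_closed [OF H, of \<sigma>] unfolding sym_group_inv_equality [OF c] by simp
  fix \<tau> assume "\<tau> \<in> {\<sigma> \<in> H. \<sigma> x = x}"
  then show "\<sigma> \<otimes>\<^bsub>sym_group n\<^esub> \<tau> \<in> {\<sigma> \<in> H. \<sigma> x = x}"
    using \<sigma> subgroup.m_closed [OF H, of \<sigma> \<tau>] by (simp add: sym_group_mult)
qed

lemma young_no_torsion: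
  assumes i: "i < length ns" and n: "2 \<le> sum_list ns"
    and q: "coprime q (int (ns ! i))" "q \<noteq> 0" and pos: "0 < ns ! i"
    and z: "z \<in> chains (partition_chains (sum_list ns)) k"
    and b: "b \<in> chains (partition_chains (sum_list ns)) (Suc k)"
    and zb: "frag_cmul q z - frag_boundary b
      \<in> coinv_null (permute_partition ` young_subgroup ns) (partition_chains (sum_list ns)) k"
  shows "\<exists>b\<in>chains (partition_chains (sum_list ns)) (Suc k). z - frag_boundary b
      \<in> coinv_null (permute_partition ` young_subgroup ns) (partition_chains (sum_list ns)) k"
proof -
  let ?n = "sum_list ns" and ?Y = "young_subgroup ns"
  define x where "x = Suc (sum_list (take i ns))"
  have x: "x \<in> young_block ns i"
    using pos i by (simp add: x_def young_block_def sum_list_take_Suc)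
  then have xn: "x \<in> {1..?n}" using young_block_subset by blast
  define H' where "H' = {\<sigma> \<in> ?Y. \<sigma> x = x}"
  have sY: "subgroup ?Y (sym_group ?n)" by (rule subgroup_young_subgroup)
  have sH': "subgroup H' (sym_group ?n)" unfolding H'_def by (rule subgroup_stabilizer [OF sY])
  have perm: "\<sigma> permutes {1..?n}" if "\<sigma> \<in> ?Y" for \<sigma>
    using that by (simp add: young_subgroup_def sym_group_carrier)
  have comp: "\<sigma> \<circ> \<tau> \<in> ?Y" if "\<sigma> \<in> ?Y" "\<tau> \<in> ?Y" for \<sigma> \<tau>
    using subgroup.m_closed [OF sY that] by (simp add: sym_group_mult)
  interpret big: list_complex_group_action "partition_chains ?n" "permute_partition ` ?Y"
    by (rule list_complex_group_action_partition_chains [OF sY])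
  interpret small: list_complex_group_action "partition_chains ?n" "permute_partition ` H'"
    by (rule list_complex_group_action_partition_chains [OF sH'])
  interpret list_complex_transfer "partition_chains ?n" "permute_partition ` ?Y" "permute_partition ` H'"
    "young_block ns i" "\<lambda>y. permute_partition (Transposition.transpose x y)"
  proof
    show "finite (young_block ns i)" by (simp add: young_block_def)
    show "permute_partition ` H' \<subseteq> permute_partition ` ?Y" by (auto simp: H'_def)
    show "permute_partition (Transposition.transpose x y) \<in> permute_partition ` ?Y"
      if "y \<in> young_block ns i" for y
      using transpose_in_young_subgroup [OF x that] by blast
    fix h assume "h \<in> permute_partition ` ?Y"
    then obtain \<tau> where \<tau>: "\<tau> \<in> ?Y" "h = permute_partition \<tau>" by blast
    have inj: "inj (inv' \<tau>)"
      using permutes_inj [OF permutes_inv [OF perm [OF \<tau>(1)]]] .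
    have "inv' \<tau> \<in> ?Y"
      using subgroup.m_inv_closed [OF sY \<tau>(1)] sym_group_inv_equality [of \<tau> ?n] perm [OF \<tau>(1)]
      by (simp add: sym_group_carrier)
    then have im: "inv' \<tau> ` young_block ns i = young_block ns i"
      using i by (simp add: young_subgroup_def)
    have "\<exists>g\<in>permute_partition ` H'. permute_partition (Transposition.transpose x y) \<circ> h =
        g \<circ> permute_partition (Transposition.transpose x (inv' \<tau> y))" if y: "y \<in> young_block ns i" for y
    proof -
      let ?y = "inv' \<tau> y"
      have y': "?y \<in> young_block ns i" using y im by blast
      have ty: "\<tau> ?y = y" using permutes_inverses(1) [OF perm [OF \<tau>(1)]] by simp
      \<comment> \<open>This maps x to the preimage of \<open>y\<close> under \<open>\<tau>\<close>,
        then to \<open>y\<close>, then back to \<open>x\<close>; so \<open>h\<close> permutes the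
        cosets by the inverse of \<open>\<tau>\<close> on the block.\<close>
      let ?g = "Transposition.transpose x y \<circ> \<tau> \<circ> Transposition.transpose x ?y"
      have "?g \<in> ?Y"
        by (intro comp \<tau>(1) transpose_in_young_subgroup [OF x y] transpose_in_young_subgroup [OF x y'])
      moreover have "?g x = x" using ty by simp
      ultimately have "?g \<in> H'" by (simp add: H'_def)
      moreover have g: "?g \<circ> Transposition.transpose x ?y = Transposition.transpose x y \<circ> \<tau>"
        by (simp add: comp_assoc)
      have "permute_partition (Transposition.transpose x y) \<circ> h =
          permute_partition ?g \<circ> permute_partition (Transposition.transpose x ?y)"
        by (simp only: fun_eq_iff \<tau>(2) o_apply permute_partition_comp [symmetric] g) simp
      ultimately show ?thesis by blast
    qed
    then show "\<exists>\<pi>. bij_betw \<pi> (young_block ns i) (young_block ns i) \<and>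
        (\<forall>y\<in>young_block ns i. \<exists>g\<in>permute_partition ` H'.
          permute_partition (Transposition.transpose x y) \<circ> h =
          g \<circ> permute_partition (Transposition.transpose x (\<pi> y)))"
      using im inj_on_subset [OF inj] by (intro exI [of _ "inv' \<tau>"]) (auto simp: bij_betw_def)
  qed
  show ?thesis
  proof (rule no_torsion [where d = "?n - 2", OF _ _ _ q(2) z b zb])
    show "coprime q (int (card (young_block ns i)))" using q(1) i by (simp add: card_young_block)
    show "length xs \<le> ?n - 2" if "xs \<in> partition_chains ?n" for xs
      by (rule length_partition_chains [OF that n])
    show "\<exists>b\<in>chains (partition_chains ?n) (Suc k). z - frag_boundary b
        \<in> coinv_null (permute_partition ` H') (partition_chains ?n) k"
      if "k < ?n - 2" "z \<in> chains (partition_chains ?n) k"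
        "frag_boundary z \<in> coinv_null (permute_partition ` H') (partition_chains ?n) (k - 1)" for k z
      by (rule partition_chains_acyclic [OF sH' xn _ that]) (simp add: H'_def)
  qed
qed

section \<open>The orbit space of the partition complex\<close>

text \<open>The affine simplex spanned by the vertices in \<open>R\<close>. Written as a sum over
  positions, it is visibly continuous, and its total mass follows by exchanging two sums.\<close>

definition chain_point :: "nat set set list \<Rightarrow> (nat \<Rightarrow> real) \<Rightarrow> nat set set \<Rightarrow> real" where
  "chain_point R t = (\<lambda>P. \<Sum>j<length R. if R ! j = P then t j else 0)"

lemma distinct_partition_chain: "R \<in> partition_chains n \<Longrightarrow> distinct R"
proof -
  have "sorted_wrt (finer n) R \<Longrightarrow> distinct R"
    by (induction R) (auto simp: finer_irrefl)
  then show "R \<in> partition_chains n \<Longrightarrow> distinct R"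
    by (simp add: partition_chains_def)
qed

lemma chain_point_nth:
  assumes "distinct R" "j < length R"
  shows "chain_point R t (R ! j) = t j"
proof -
  have "chain_point R t (R ! j) = (\<Sum>i<length R. if i = j then t j else 0)"
    unfolding chain_point_def using assms by (intro sum.cong) (auto simp: nth_eq_iff_index_eq)
  then show ?thesis using assms(2) by simp
qed

lemma chain_point_outside: "P \<notin> set R \<Longrightarrow> chain_point R t P = 0"
  unfolding chain_point_def by (intro sum.neutral) auto

lemma chain_point_eqI:
  assumes "distinct R" "\<And>j. j < length R \<Longrightarrow> u (R ! j) = t j" "\<And>P. P \<notin> set R \<Longrightarrow> u P = 0"
  shows "chain_point R t = u"
proof
  fix P show "chain_point R t P = u P"
    using assms chain_point_nth [OF assms(1)] chain_point_outside by (metis in_set_conv_nth)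
qed

lemma set_partition_chain_in_order_complex:
  assumes "R \<in> partition_chains n" "S \<subseteq> set R" "S \<noteq> {}"
  shows "S \<in> order_complex (proper_partitions n) (refines {1..n})"
proof -
  have "refines {1..n} P Q \<or> refines {1..n} Q P" if PQ: "P \<in> set R" "Q \<in> set R" for P Q
  proof -
    obtain i j where ij: "i < length R" "j < length R" "P = R ! i" "Q = R ! j"
      using PQ by (metis in_set_conv_nth)
    have s: "sorted_wrt (finer n) R" "P \<in> proper_partitions n"
      using assms(1) that by (auto simp: partition_chains_def)
    show ?thesis
    proof (rule linorder_cases [of i j])
      assume "i = j"
      then show ?thesis using s(2) ij refines_refl by (auto simp: proper_partitions_def)
    qed (use s(1) ij in \<open>auto simp: sorted_wrt_iff_nth_less finer_def\<close>)
  qed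
  then show ?thesis
    using assms finite_subset [OF assms(2)]
    by (auto simp: order_complex_def Complete_Partial_Order.chain_def partition_chains_def)
qed

lemma chain_point_in_complex:
  assumes R: "R \<in> partition_chains n" "length R = Suc k" and t: "t \<in> standard_simplex k"
  shows "chain_point R t \<in> topspace (partition_complex n)"
proof -
  have t0: "0 \<le> t j" for j using t by (simp add: standard_simplex_def)
  have nonneg: "0 \<le> chain_point R t P" for P
    unfolding chain_point_def by (intro sum_nonneg) (simp add: t0)
  let ?S = "{P. chain_point R t P \<noteq> 0}"
  have sub: "?S \<subseteq> set R" using chain_point_outside by blast
  have "(\<Sum>P\<in>?S. chain_point R t P) = (\<Sum>P\<in>set R. chain_point R t P)"
    using sub by (intro sum.mono_neutral_left) auto
  also have "\<dots> = (\<Sum>j<length R. \<Sum>P\<in>set R. if R ! j = P then t j else 0)"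
    unfolding chain_point_def by (rule sum.swap)
  also have "\<dots> = (\<Sum>j<length R. t j)"
    by (intro sum.cong refl) simp
  also have "\<dots> = 1"
    using t R(2) by (simp add: standard_simplex_def lessThan_Suc_atMost)
  finally have sum: "(\<Sum>P\<in>?S. chain_point R t P) = 1" .
  then have "?S \<noteq> {}" by (metis sum.empty zero_neq_one)
  then show ?thesis
    using nonneg sum set_partition_chain_in_order_complex [OF R(1) sub]
    by (simp add: topspace_partition_complex)
qed

lemma continuous_map_chain_point:
  assumes R: "R \<in> partition_chains n" "length R = Suc k"
  shows "continuous_map (simplex_topology k) (partition_complex n) (chain_point R)"
proof -
  have "continuous_map (simplex_topology k) euclideanreal (\<lambda>t. chain_point R t P)" for P
    unfolding chain_point_def
  proof (intro continuous_map_sum finite_lessThan)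
    show "continuous_map (simplex_topology k) euclideanreal (\<lambda>t. if R ! j = P then t j else 0)" for j
      using continuous_map_from_subtopology [OF continuous_map_coord] by (cases "R ! j = P") auto
  qed
  then have "continuous_map (simplex_topology k) (powertop_real UNIV) (chain_point R)"
    by (simp add: continuous_map_componentwise_UNIV)
  then show ?thesis
    using chain_point_in_complex [OF R]
    unfolding partition_complex_def geometric_realization_def continuous_map_in_subtopology
    by (auto simp: topspace_standard_simplex topspace_partition_complex)
qed

text \<open>Among comparable partitions, more blocks means finer; sorting by decreasing block number
  orders the chain.\<close>

lemma sorted_partition_chain_exists:
  assumes C: "C \<in> order_complex (proper_partitions n) (refines {1..n})"
  obtains R where "R \<in> partition_chains n" "set R = C"
proof -
  have "finite C" using C by (simp add: order_complex_def)
  then obtain xs where xs: "set xs = C" "distinct xs" using finite_distinct_list by blast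
  let ?f = "\<lambda>P::nat set set. - int (card P)"
  define R where "R = sort_key ?f xs"
  have R: "set R = C" "distinct R" "sorted (map ?f R)" using xs by (simp_all add: R_def)
  have "finer n (R ! i) (R ! j)" if ij: "i < j" "j < length R" for i j
  proof -
    have mem: "R ! i \<in> C" "R ! j \<in> C" using ij R(1) by auto
    have ne: "R ! i \<noteq> R ! j" using ij R(2) by (simp add: nth_eq_iff_index_eq)
    have le: "card (R ! j) \<le> card (R ! i)"
      using R(3) ij by (auto simp: sorted_iff_nth_mono_less)
    have "refines {1..n} (R ! i) (R ! j) \<or> refines {1..n} (R ! j) (R ! i)"
      using C mem by (auto simp: order_complex_def Complete_Partial_Order.chain_def)
    moreover have "\<not> refines {1..n} (R ! j) (R ! i)"
      using card_finer [of n "R ! j" "R ! i"] ne le by (auto simp: finer_def)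
    ultimately show ?thesis using ne by (simp add: finer_def)
  qed
  then have "R \<in> partition_chains n"
    using C R(1) by (auto simp: partition_chains_def sorted_wrt_iff_nth_less order_complex_def)
  then show thesis using that R(1) by blast
qed

lemma chain_point_exists:
  assumes u: "u \<in> topspace (partition_complex n)"
  obtains R k t where "R \<in> partition_chains n" "length R = Suc k" "t \<in> standard_simplex k"
    "u = chain_point R t"
proof -
  let ?C = "{P. u P \<noteq> 0}"
  have C: "?C \<in> order_complex (proper_partitions n) (refines {1..n})" and pos: "\<And>P. 0 \<le> u P"
    and sum: "(\<Sum>P\<in>?C. u P) = 1"
    using u by (auto simp: topspace_partition_complex)
  obtain R where R: "R \<in> partition_chains n" "set R = ?C"
    using sorted_partition_chain_exists [OF C] by blast
  have d: "distinct R" by (rule distinct_partition_chain [OF R(1)])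
  have "?C \<noteq> {}" using C by (simp add: order_complex_def)
  then have "R \<noteq> []" using R(2) by auto
  then obtain k where k: "length R = Suc k" by (cases R) auto
  define t where "t j = (if j < length R then u (R ! j) else 0)" for j
  have eq: "chain_point R t = u"
    using R(2) by (intro chain_point_eqI d) (auto simp: t_def)
  have "(\<Sum>j<length R. t j) = (\<Sum>P\<in>set R. u P)"
    using sum.reindex_bij_betw [OF bij_betw_nth [OF d refl refl], of u] by (simp add: t_def)
  then have s1: "(\<Sum>j\<le>k. t j) = 1"
    using sum R(2) k by (simp add: lessThan_Suc_atMost)
  have t0: "0 \<le> t j" for j using pos by (simp add: t_def)
  have "t j \<le> 1" for j
  proof (cases "j \<le> k")
    case True
    then show ?thesis using member_le_sum [of j "{..k}" t] t0 s1 by auto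
  qed (simp add: t_def k)
  then have "t \<in> standard_simplex k"
    using t0 s1 k by (auto simp: standard_simplex_def t_def)
  then show thesis using that R(1) k eq by blast
qed

lemma sorted_wrt_unique:
  assumes "sorted_wrt (finer n) R" "sorted_wrt (finer n) R'" "set R = set R'"
  shows "R = R'"
  using assms
proof (induction R arbitrary: R')
  case (Cons P R)
  then obtain Q R'' where R': "R' = Q # R''" by (cases R') auto
  have "P = Q"
  proof (rule ccontr)
    assume "P \<noteq> Q"
    then have "finer n P Q" "finer n Q P" using Cons.prems R' by auto
    then show False using finer_trans finer_irrefl by blast
  qed
  have "P \<notin> set R" "P \<notin> set R''"
    using Cons.prems R' \<open>P = Q\<close> by (auto simp: finer_irrefl)
  then have "set R = set R''" using Cons.prems(3) R' \<open>P = Q\<close> by auto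
  then show ?case using Cons R' \<open>P = Q\<close> by simp
qed simp

text \<open>The support of an interior point is the whole vertex set, which determines its ordering
  and then the coordinates.\<close>

lemma chain_point_interior_eq:
  assumes R: "R \<in> partition_chains n" "length R = Suc k" and R': "R' \<in> partition_chains n" "length R' = Suc l"
    and t: "t \<in> standard_simplex k" "t \<notin> simplex_frontier k"
    and s: "s \<in> standard_simplex l" "s \<notin> simplex_frontier l"
    and eq: "chain_point R t = chain_point R' s"
  shows "k = l \<and> R = R' \<and> t = s"
proof -
  have supp: "set R = {P. chain_point R t P \<noteq> 0}"
    if R: "R \<in> partition_chains n" "length R = Suc k" and t: "t \<in> standard_simplex k" "t \<notin> simplex_frontier k"
    for R k t
  proof -
    have "t j \<noteq> 0" if "j < length R" for j
      using t R(2) that by (auto simp: simplex_frontier_def)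
    then have "chain_point R t P \<noteq> 0" if "P \<in> set R" for P
      using chain_point_nth [OF distinct_partition_chain [OF R(1)]] that by (metis in_set_conv_nth)
    then show ?thesis using chain_point_outside by blast
  qed
  have "set R = set R'" using supp [OF R t] supp [OF R' s] eq by simp
  then have RR: "R = R'"
    using R(1) R'(1) sorted_wrt_unique by (auto simp: partition_chains_def)
  moreover have "t j = s j" for j
  proof (cases "j < length R")
    case True
    then show ?thesis
      using chain_point_nth [OF distinct_partition_chain [OF R(1)] True] eq RR by metis
  next
    case False
    then show ?thesis using t(1) s(1) R(2) R'(2) RR by (simp add: standard_simplex_def)
  qed
  ultimately show ?thesis using R(2) R'(2) by auto
qed

lemma finite_partition_chains: "finite (partition_chains n)"
proof -
  have fin: "finite (proper_partitions n)"
    using finitely_many_partition_on [of "{1..n}"] by (rule rev_finite_subset) (auto simp: proper_partitions_def)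
  have "partition_chains n \<subseteq> {R. set R \<subseteq> proper_partitions n \<and> length R \<le> card (proper_partitions n)}"
  proof
    fix R assume R: "R \<in> partition_chains n"
    then have "set R \<subseteq> proper_partitions n" by (simp add: partition_chains_def)
    moreover have "length R = card (set R)"
      using distinct_card [OF distinct_partition_chain [OF R]] by simp
    ultimately show "R \<in> {R. set R \<subseteq> proper_partitions n \<and> length R \<le> card (proper_partitions n)}"
      using card_mono [OF fin] by auto
  qed
  then show ?thesis using finite_lists_length_le [OF fin] finite_subset by blast
qed

lemma compact_space_partition_complex: "compact_space (partition_complex n)"
proof -
  let ?I = "(\<lambda>R. chain_point R ` standard_simplex (length R - 1)) ` (partition_chains n - {[]})"
  have "compactin (partition_complex n) (\<Union>?I)"
  proof (rule compactin_Union)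
    show "finite ?I" using finite_partition_chains by simp
    show "compactin (partition_complex n) T" if T: "T \<in> ?I" for T
    proof -
      obtain R where R: "R \<in> partition_chains n" "R \<noteq> []" "T = chain_point R ` standard_simplex (length R - 1)"
        using T by blast
      have len: "length R = Suc (length R - 1)" using R(2) by (cases R) auto
      have comp: "compactin (simplex_topology (length R - 1)) (standard_simplex (length R - 1))"
        using compact_space_simplex_topology [of "length R - 1"] by (simp add: compact_space_def topspace_standard_simplex)
      show ?thesis
        unfolding R(3) by (rule image_compactin [OF comp continuous_map_chain_point [OF R(1) len]])
    qed
  qed
  moreover have "\<Union>?I = topspace (partition_complex n)"
  proof
    show "\<Union>?I \<subseteq> topspace (partition_complex n)"
    proof
      fix u assume "u \<in> \<Union>?I"
      then obtain R t where R: "R \<in> partition_chains n" "R \<noteq> []" "t \<in> standard_simplex (length R - 1)"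
          "u = chain_point R t"
        by auto
      then have "length R = Suc (length R - 1)" by (cases R) auto
      from chain_point_in_complex [OF R(1) this R(3)] show "u \<in> topspace (partition_complex n)"
        using R(4) by simp
    qed
    show "topspace (partition_complex n) \<subseteq> \<Union>?I"
    proof
      fix u assume "u \<in> topspace (partition_complex n)"
      then obtain R k t where "R \<in> partition_chains n" "length R = Suc k" "t \<in> standard_simplex k" "u = chain_point R t"
        by (rule chain_point_exists)
      then show "u \<in> \<Union>?I" by (auto intro!: bexI [of _ R])
    qed
  qed
  ultimately show ?thesis by (simp add: compact_space_def)
qed

lemma Hausdorff_space_partition_complex: "Hausdorff_space (partition_complex n)"
  unfolding partition_complex_def geometric_realization_def
  by (intro Hausdorff_space_subtopology) (simp add: Hausdorff_space_product_topology)

lemma continuous_map_partition_complex_action: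
  assumes \<sigma>: "\<sigma> permutes {1..n}"
  shows "continuous_map (partition_complex n) (partition_complex n) (partition_complex_action n \<sigma>)"
proof -
  have "continuous_map (partition_complex n) (powertop_real UNIV) (\<lambda>t P. t (permute_partition (inv' \<sigma>) P))"
    unfolding continuous_map_componentwise_UNIV partition_complex_def geometric_realization_def
    by (intro allI continuous_map_from_subtopology continuous_map_product_projection) simp
  then have "continuous_map (partition_complex n) (powertop_real UNIV) (partition_complex_action n \<sigma>)"
    by (rule continuous_map_eq) (simp add: partition_complex_action_def)
  then show ?thesis
    using partition_complex_action_closed [OF \<sigma>]
    by (subst (2) partition_complex_def)
      (auto simp: geometric_realization_def continuous_map_in_subtopology topspace_partition_complex)
qed

lemma partition_complex_action_chain_point:
  assumes \<sigma>: "\<sigma> permutes {1..n}" and R: "R \<in> partition_chains n" "length R = Suc k" and t: "t \<in> standard_simplex k"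
  shows "partition_complex_action n \<sigma> (chain_point R t) = chain_point (map (permute_partition \<sigma>) R) t"
proof -
  have "R ! j = permute_partition (inv' \<sigma>) P \<longleftrightarrow> permute_partition \<sigma> (R ! j) = P" for j P
    using permute_partition_inv [OF \<sigma>] by metis
  then show ?thesis
    using chain_point_in_complex [OF R t]
    by (auto simp: partition_complex_action_def chain_point_def intro!: sum.cong)
qed

section \<open>The simplices of the orbit space\<close>

abbreviation permutation_group :: "nat \<Rightarrow> (nat \<Rightarrow> nat) set \<Rightarrow> (nat \<Rightarrow> nat) monoid" where
  "permutation_group n H \<equiv> (sym_group n)\<lparr>carrier := H\<rparr>"

abbreviation orbit_complex :: "nat \<Rightarrow> (nat \<Rightarrow> nat) set \<Rightarrow> (nat set set \<Rightarrow> real) set topology" where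
  "orbit_complex n H \<equiv> orbit_space (permutation_group n H) (partition_complex_action n) (partition_complex n)"

abbreviation orbit_map :: "nat \<Rightarrow> (nat \<Rightarrow> nat) set \<Rightarrow> (nat set set \<Rightarrow> real) \<Rightarrow> (nat set set \<Rightarrow> real) set" where
  "orbit_map n H \<equiv> orbit (permutation_group n H) (partition_complex_action n)"

definition orbit_simplex :: "nat \<Rightarrow> (nat \<Rightarrow> nat) set \<Rightarrow> nat set set list \<Rightarrow> (nat \<Rightarrow> real) \<Rightarrow> (nat set set \<Rightarrow> real) set" where
  "orbit_simplex n H R = restrict (\<lambda>t. orbit_map n H (chain_point R t)) (standard_simplex (length R - 1))"

text \<open>For a subgroup \<open>H\<close> this has one element per orbit of nonempty chains:
  chains in one orbit define the same map, and different orbits define different ones.\<close>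

definition orbit_simplices :: "nat \<Rightarrow> (nat \<Rightarrow> nat) set \<Rightarrow> (nat \<times> ((nat \<Rightarrow> real) \<Rightarrow> (nat set set \<Rightarrow> real) set)) set" where
  "orbit_simplices n H = {(k, orbit_simplex n H R) | k R. R \<in> partition_chains n \<and> length R = Suc k}"

lemma chain_point_simplical_face:
  assumes "length R = Suc (Suc k)" "i \<le> Suc k"
  shows "chain_point R (simplical_face i t) = chain_point (take i R @ drop (Suc i) R) t"
proof
  fix P
  let ?R' = "take i R @ drop (Suc i) R"
  \<comment> \<open>For each vertex \<open>P\<close> separately, the coordinates belonging to
    \<open>P\<close> are treated as a vector, so the face formula for coordinate sums
    applies.\<close>
  let ?y = "\<lambda>j. if ?R' ! j = P then t j else 0"
  have nth: "?R' ! j = (if j < i then R ! j else R ! Suc j)" if "j \<le> k" for j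
    using assms that by (auto simp: nth_append min_def)
  have "chain_point R (simplical_face i t) P = (\<Sum>j\<le>Suc k. if R ! j = P then simplical_face i t j else 0)"
    by (simp add: chain_point_def assms(1) lessThan_Suc_atMost del: sum.atMost_Suc sum.lessThan_Suc)
  also have "\<dots> = (\<Sum>j\<le>Suc k. simplical_face i ?y j)"
  proof (rule sum.cong [OF refl])
    fix j assume "j \<in> {..Suc k}"
    then show "(if R ! j = P then simplical_face i t j else 0) = simplical_face i ?y j"
      using nth [of j] nth [of "j - 1"] assms(2) by (auto simp: simplical_face_def)
  qed
  also have "\<dots> = (\<Sum>j\<le>k. ?y j)"
    by (rule sum_simplical_face [OF assms(2)])
  also have "\<dots> = chain_point ?R' t P"
    using assms by (simp add: chain_point_def lessThan_Suc_atMost)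
  finally show "chain_point R (simplical_face i t) P = chain_point ?R' t P" .
qed

lemma singular_face_orbit_simplex:
  assumes "length R = Suc (Suc k)" "i \<le> Suc k"
  shows "singular_face (Suc k) i (orbit_simplex n H R) = orbit_simplex n H (take i R @ drop (Suc i) R)"
proof -
  have "length (take i R @ drop (Suc i) R) - 1 = k" using assms by simp
  then show ?thesis
    using simplical_face_in_standard_simplex [of "Suc k" i] assms
    by (auto simp: singular_face_def orbit_simplex_def chain_point_simplical_face restrict_def fun_eq_iff)
qed

text \<open>The boundaries agree from length 2 on. On singletons they differ:
  \<open>list_boundary\<close> contains the augmentation, the singular boundary is 0.\<close>

lemma chain_boundary_orbit_simplex:
  assumes "c \<in> chains (partition_chains n) (Suc (Suc k))"
  shows "chain_boundary (Suc k) (map_frag (orbit_simplex n H) c) = map_frag (orbit_simplex n H) (frag_boundary c)"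
  using assms
proof (induction rule: chains_induct)
  case (of R)
  then show ?case
    by (simp add: chain_boundary_of list_boundary_eq_sum map_frag_sum map_frag_cmul lessThan_Suc_atMost
        singular_face_orbit_simplex del: sum.atMost_Suc sum.lessThan_Suc)
qed (simp_all add: map_frag_diff chain_boundary_diff frag_boundary_diff)

context
  fixes n :: nat and H :: "(nat \<Rightarrow> nat) set"
  assumes H: "subgroup H (sym_group n)"
begin

lemma H_permutes: "\<sigma> \<in> H \<Longrightarrow> \<sigma> permutes {1..n}"
  using subgroup.subset [OF H] by (auto simp: sym_group_carrier)

lemma finite_H: "finite H"
  using finite_subset [OF _ finite_permutations [of "{1..n}"]] H_permutes by blast

lemma orbit_map_eq_iff:
  assumes t: "t \<in> topspace (partition_complex n)" and u: "u \<in> topspace (partition_complex n)"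
  shows "orbit_map n H t = orbit_map n H u \<longleftrightarrow> (\<exists>\<sigma>\<in>H. u = partition_complex_action n \<sigma> t)"
proof -
  interpret group_action "sym_group n" "topspace (partition_complex n)" "partition_complex_action n"
    by (rule group_action_partition_complex)
  let ?a = "partition_complex_action n"
  have cH: "\<sigma> \<in> carrier (sym_group n)" if "\<sigma> \<in> H" for \<sigma>
    using subgroup.subset [OF H] that by blast
  have orb: "orbit_map n H t = (\<lambda>\<sigma>. ?a \<sigma> t) ` H" for t
    by (auto simp: orbit_def)
  have comp: "?a (\<sigma> \<circ> \<tau>) v = ?a \<sigma> (?a \<tau> v)"
    if "\<sigma> \<in> H" "\<tau> \<in> H" "v \<in> topspace (partition_complex n)" for \<sigma> \<tau> v
    using composition_rule [OF that(3) cH [OF that(1)] cH [OF that(2)]] by (simp add: sym_group_mult)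
  have mult: "\<sigma> \<circ> \<tau> \<in> H" if "\<sigma> \<in> H" "\<tau> \<in> H" for \<sigma> \<tau>
    using subgroup.m_closed [OF H that] by (simp add: sym_group_mult)
  have one: "id \<in> H" "?a id v = v" if "v \<in> topspace (partition_complex n)" for v
    using subgroup.one_closed [OF H] that
    by (simp_all add: sym_group_one partition_complex_action_def permute_partition_id)
  have inv: "inv' \<sigma> \<in> H" "inv' \<sigma> \<circ> \<sigma> = id" if "\<sigma> \<in> H" for \<sigma>
    using subgroup.m_inv_closed [OF H that] sym_group_inv_equality [OF cH [OF that]]
      permutes_inv_o(2) [OF H_permutes [OF that]] by simp_all
  have sub: "(\<lambda>\<sigma>. ?a \<sigma> (?a \<tau> v)) ` H \<subseteq> (\<lambda>\<sigma>. ?a \<sigma> v) ` H"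
    if "\<tau> \<in> H" "v \<in> topspace (partition_complex n)" for \<tau> v
  proof clarify
    fix \<sigma> assume "\<sigma> \<in> H"
    then show "?a \<sigma> (?a \<tau> v) \<in> (\<lambda>\<sigma>. ?a \<sigma> v) ` H"
      using comp [OF _ that, symmetric] mult [OF _ that(1)] by simp
  qed
  show ?thesis
  proof
    assume "orbit_map n H t = orbit_map n H u"
    moreover have "u \<in> orbit_map n H u" unfolding orb using one [OF u] by force
    ultimately show "\<exists>\<sigma>\<in>H. u = ?a \<sigma> t" unfolding orb by auto
  next
    assume "\<exists>\<sigma>\<in>H. u = ?a \<sigma> t"
    then obtain \<sigma> where \<sigma>: "\<sigma> \<in> H" "u = ?a \<sigma> t" by blast
    have "t = ?a (inv' \<sigma>) u"
      using comp [OF inv(1) [OF \<sigma>(1)] \<sigma>(1) t] inv(2) [OF \<sigma>(1)] one(2) [OF t] \<sigma>(2) by simp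
    then show "orbit_map n H t = orbit_map n H u"
      unfolding orb using sub [OF \<sigma>(1) t] sub [OF inv(1) [OF \<sigma>(1)] u] \<sigma>(2) by simp
  qed
qed

lemma quotient_map_orbit_map: "quotient_map (partition_complex n) (orbit_complex n H) (orbit_map n H)"
  unfolding orbit_space_def by (rule quotient_map_quotient_topology)

text \<open>The saturation of a closed set is a finite union of closed preimages, so the quotient
  map is closed; such images of compact Hausdorff, hence normal, spaces are Hausdorff.\<close>

lemma Hausdorff_space_orbit_complex: "Hausdorff_space (orbit_complex n H)"
proof -
  let ?K = "partition_complex n" and ?Z = "orbit_complex n H" and ?q = "orbit_map n H"
  have surj: "?q ` topspace ?K = topspace ?Z"
    using quotient_map_orbit_map by (simp add: quotient_map_def)
  have "closed_map ?K ?Z ?q"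
    unfolding closed_map_def
  proof (intro allI impI)
    fix C assume C: "closedin ?K C"
    then have CK: "C \<subseteq> topspace ?K" by (rule closedin_subset)
    have "{u \<in> topspace ?K. ?q u \<in> ?q ` C} =
        (\<Union>\<sigma>\<in>H. {u \<in> topspace ?K. partition_complex_action n \<sigma> u \<in> C})"
      using orbit_map_eq_iff CK by (fastforce simp: image_iff)
    moreover have "closedin ?K (\<Union>\<sigma>\<in>H. {u \<in> topspace ?K. partition_complex_action n \<sigma> u \<in> C})"
      using finite_H closedin_continuous_map_preimage [OF continuous_map_partition_complex_action [OF H_permutes] C]
      by (intro closedin_Union) auto
    moreover have "?q ` C \<subseteq> topspace ?Z" using CK surj by blast
    then have "closedin ?K {u \<in> topspace ?K. ?q u \<in> ?q ` C} \<longleftrightarrow> closedin ?Z (?q ` C)"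
      using quotient_map_orbit_map unfolding quotient_map_closedin by blast
    ultimately show "closedin ?Z (?q ` C)" by simp
  qed
  moreover have "normal_space ?K"
    using compact_Hausdorff_or_regular_imp_normal_space compact_space_partition_complex
      Hausdorff_space_partition_complex by blast
  ultimately show ?thesis
    using normal_Hausdorff_space_closed_continuous_map_image [of ?K ?Z ?q] surj
      Hausdorff_space_partition_complex quotient_imp_continuous_map [OF quotient_map_orbit_map] by blast
qed

text \<open>Permutations preserve refinement and so carry the simplex of a chain to that of the
  image chain without reordering coordinates. Thus no two interior points of one simplex are
  identified.\<close>

lemma orbit_simplex_interior_eq:
  assumes R: "R \<in> partition_chains n" "length R = Suc k" and R': "R' \<in> partition_chains n" "length R' = Suc l"
    and t: "t \<in> standard_simplex k" "t \<notin> simplex_frontier k"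
    and s: "s \<in> standard_simplex l" "s \<notin> simplex_frontier l"
    and eq: "orbit_simplex n H R t = orbit_simplex n H R' s"
  shows "k = l \<and> t = s \<and> (\<exists>\<sigma>\<in>H. R' = map (permute_partition \<sigma>) R)"
proof -
  have "orbit_map n H (chain_point R t) = orbit_map n H (chain_point R' s)"
    using eq R(2) R'(2) t s by (simp add: orbit_simplex_def)
  then obtain \<sigma> where \<sigma>: "\<sigma> \<in> H" "chain_point R' s = partition_complex_action n \<sigma> (chain_point R t)"
    using orbit_map_eq_iff chain_point_in_complex [OF R t(1)] chain_point_in_complex [OF R' s(1)] by auto
  interpret list_complex_group_action "partition_chains n" "permute_partition ` H"
    by (rule list_complex_group_action_partition_chains [OF H])
  have gR: "map (permute_partition \<sigma>) R \<in> partition_chains n" "length (map (permute_partition \<sigma>) R) = Suc k"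
    using map_closed [of "permute_partition \<sigma>" R] \<sigma>(1) R by auto
  have "chain_point (map (permute_partition \<sigma>) R) t = chain_point R' s"
    using partition_complex_action_chain_point [OF H_permutes [OF \<sigma>(1)] R t(1)] \<sigma>(2) by simp
  from chain_point_interior_eq [OF gR R' t s this] show ?thesis using \<sigma>(1) by blast
qed

lemma orbit_simplex_map:
  assumes "R \<in> partition_chains n" "R \<noteq> []" "\<sigma> \<in> H"
  shows "orbit_simplex n H (map (permute_partition \<sigma>) R) = orbit_simplex n H R"
proof -
  obtain k where k: "length R = Suc k" using assms(2) by (cases R) auto
  have pt: "orbit_map n H (chain_point (map (permute_partition \<sigma>) R) t) = orbit_map n H (chain_point R t)"
    if t: "t \<in> standard_simplex k" for t
  proof -
    have eq: "chain_point (map (permute_partition \<sigma>) R) t = partition_complex_action n \<sigma> (chain_point R t)"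
      using partition_complex_action_chain_point [OF H_permutes [OF assms(3)] assms(1) k t] by simp
    have "partition_complex_action n \<sigma> (chain_point R t) \<in> topspace (partition_complex n)"
      by (intro partition_complex_action_closed H_permutes assms(3) chain_point_in_complex [OF assms(1) k t])
    then show ?thesis
      unfolding eq using orbit_map_eq_iff [OF chain_point_in_complex [OF assms(1) k t]] assms(3) by blast
  qed
  show ?thesis
    unfolding orbit_simplex_def length_map k by (rule restrict_ext) (simp add: pt)
qed

lemma exists_interior_point: "\<exists>t. t \<in> standard_simplex k \<and> t \<notin> simplex_frontier k"
proof -
  let ?t = "\<lambda>j. if j \<le> k then 1 / (real k + 1) else 0"
  have "(\<Sum>j\<le>k. ?t j) = 1" by (simp add: field_simps)
  then have "?t \<in> standard_simplex k" by (simp add: standard_simplex_def)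
  moreover have "?t \<notin> simplex_frontier k" by (auto simp: simplex_frontier_def)
  ultimately show ?thesis by blast
qed

lemma orbit_simplex_eq_imp:
  assumes R: "R \<in> partition_chains n" "length R = Suc k" and R': "R' \<in> partition_chains n" "length R' = Suc k"
    and eq: "orbit_simplex n H R = orbit_simplex n H R'"
  shows "\<exists>\<sigma>\<in>H. R' = map (permute_partition \<sigma>) R"
proof -
  obtain t where t: "t \<in> standard_simplex k" "t \<notin> simplex_frontier k"
    using exists_interior_point by blast
  show ?thesis
    using orbit_simplex_interior_eq [OF R R' t t] eq by simp
qed

lemma finite_simplex_complex_orbit: "finite_simplex_complex (orbit_complex n H) (orbit_simplices n H)"
  unfolding finite_simplex_complex_def
proof (intro conjI)
  show "Hausdorff_space (orbit_complex n H)" by (rule Hausdorff_space_orbit_complex)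
  have "orbit_simplices n H \<subseteq> (\<lambda>R. (length R - 1, orbit_simplex n H R)) ` partition_chains n"
    by (force simp: orbit_simplices_def)
  then show "finite (orbit_simplices n H)"
    using finite_partition_chains finite_subset by blast
  show "\<forall>(k, \<sigma>)\<in>orbit_simplices n H. singular_simplex k (orbit_complex n H) \<sigma>"
  proof (clarsimp simp: orbit_simplices_def)
    fix k R assume R: "R \<in> partition_chains n" "length R = Suc k"
    have "continuous_map (simplex_topology k) (orbit_complex n H) (orbit_map n H \<circ> chain_point R)"
      by (rule continuous_map_compose [OF continuous_map_chain_point [OF R]
            quotient_imp_continuous_map [OF quotient_map_orbit_map]])
    then show "singular_simplex k (orbit_complex n H) (orbit_simplex n H R)"
      using R(2) by (auto simp: singular_simplex_def orbit_simplex_def topspace_standard_simplex elim: continuous_map_eq)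
  qed
  show "\<forall>(k, \<sigma>)\<in>orbit_simplices n H. 0 < k \<longrightarrow> (\<forall>i\<le>k. (k - 1, singular_face k i \<sigma>) \<in> orbit_simplices n H)"
  proof (clarsimp simp: orbit_simplices_def)
    fix k R i assume R: "R \<in> partition_chains n" "length R = Suc k" "0 < k" "i \<le> k"
    then obtain l where l: "k = Suc l" using gr0_conv_Suc by blast
    interpret list_complex_group_action "partition_chains n" "permute_partition ` H"
      by (rule list_complex_group_action_partition_chains [OF H])
    have "take i R @ R ! i # drop (Suc i) R = R"
      using R by (simp add: id_take_nth_drop [symmetric])
    then have "take i R @ drop (Suc i) R \<in> partition_chains n"
      using closed_delete [of "take i R" "R ! i" "drop (Suc i) R"] R(1) by simp
    moreover have "length (take i R @ drop (Suc i) R) = Suc l"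
      using R l by simp
    ultimately show "\<exists>R'. singular_face k i (orbit_simplex n H R) = orbit_simplex n H R' \<and>
        R' \<in> partition_chains n \<and> length R' = k"
      using singular_face_orbit_simplex [of R l i n H] R l by (intro exI [of _ "take i R @ drop (Suc i) R"]) auto
  qed
  show "\<forall>(k, \<sigma>)\<in>orbit_simplices n H. \<forall>(l, \<tau>)\<in>orbit_simplices n H. \<forall>x y.
      x \<in> standard_simplex k - simplex_frontier k \<longrightarrow> y \<in> standard_simplex l - simplex_frontier l \<longrightarrow>
      \<sigma> x = \<tau> y \<longrightarrow> k = l \<and> \<sigma> = \<tau> \<and> x = y"
  proof (clarsimp simp: orbit_simplices_def)
    fix k R l R' x y
    assume R: "R \<in> partition_chains n" "length R = Suc k" and R': "R' \<in> partition_chains n" "length R' = Suc l"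
      and x: "x \<in> standard_simplex k" "x \<notin> simplex_frontier k" and y: "y \<in> standard_simplex l" "y \<notin> simplex_frontier l"
      and eq: "orbit_simplex n H R x = orbit_simplex n H R' y"
    from orbit_simplex_interior_eq [OF R R' x y eq] obtain \<sigma> where
      *: "k = l" "x = y" "\<sigma> \<in> H" "R' = map (permute_partition \<sigma>) R" by blast
    have "R \<noteq> []" using R(2) by auto
    then show "k = l \<and> orbit_simplex n H R = orbit_simplex n H R' \<and> x = y"
      using orbit_simplex_map [OF R(1) _ *(3)] * by simp
  qed
qed

lemma complex_points_orbit_simplices: "complex_points (orbit_simplices n H) = topspace (orbit_complex n H)"
proof -
  have surj: "topspace (orbit_complex n H) = orbit_map n H ` topspace (partition_complex n)"
    using quotient_map_orbit_map by (simp add: quotient_map_def)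
  show ?thesis
  proof
    show "complex_points (orbit_simplices n H) \<subseteq> topspace (orbit_complex n H)"
      using chain_point_in_complex unfolding surj
      by (auto simp: complex_points_def orbit_simplices_def orbit_simplex_def)
    show "topspace (orbit_complex n H) \<subseteq> complex_points (orbit_simplices n H)"
    proof
      fix z assume "z \<in> topspace (orbit_complex n H)"
      then obtain u where u: "u \<in> topspace (partition_complex n)" "z = orbit_map n H u"
        unfolding surj by blast
      obtain R k t where R: "R \<in> partition_chains n" "length R = Suc k" "t \<in> standard_simplex k" "u = chain_point R t"
        using chain_point_exists [OF u(1)] by blast
      then have "(k, orbit_simplex n H R) \<in> orbit_simplices n H"
        unfolding orbit_simplices_def by blast
      moreover have "z = orbit_simplex n H R t"
        using u(2) R by (simp add: orbit_simplex_def)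
      ultimately show "z \<in> complex_points (orbit_simplices n H)"
        using R(3) unfolding complex_points_def by blast
    qed
  qed
qed

lemma chain_of_orbit_simplices:
  assumes "Poly_Mapping.keys w \<subseteq> complex_simplices (orbit_simplices n H) k"
  shows "\<exists>c\<in>chains (partition_chains n) (Suc k). map_frag (orbit_simplex n H) c = w"
  using assms
proof (induction w rule: frag_induction)
  case (one \<sigma>)
  then obtain R where "R \<in> partition_chains n" "length R = Suc k" "\<sigma> = orbit_simplex n H R"
    by (auto simp: orbit_simplices_def)
  then show ?case by (intro bexI [of _ "frag_of R"]) (auto simp: chains_of)
next
  case (diff a b)
  then show ?case by (metis chains_diff map_frag_diff)
qed (intro bexI [of _ 0]; simp)

lemma keys_map_frag_orbit_simplex:
  assumes "c \<in> chains (partition_chains n) (Suc k)"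
  shows "Poly_Mapping.keys (map_frag (orbit_simplex n H) c) \<subseteq> complex_simplices (orbit_simplices n H) k"
  using keys_map_frag [of "orbit_simplex n H" c] assms by (auto simp: chains_def orbit_simplices_def)

lemma orbit_cycle_homologous_chain:
  assumes "singular_relcycle k (orbit_complex n H) {} z"
  shows "\<exists>c\<in>chains (partition_chains n) (Suc k).
    homologous_rel k (orbit_complex n H) {} z (map_frag (orbit_simplex n H) c)"
  using simplicial_homology_complex [OF finite_simplex_complex_orbit] assms chain_of_orbit_simplices
  unfolding complex_points_orbit_simplices subtopology_topspace by metis

text \<open>Simplicial comparison turns a singular filling into a chain of lists. Passing between
  equality of images and nullity uses that \<open>orbit_simplex\<close> separates orbits in one
  direction and is constant on them in the other.\<close>

lemma singular_relboundary_orbit_simplex_iff: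
  assumes c: "c \<in> chains (partition_chains n) (Suc k)"
  shows "singular_relboundary k (orbit_complex n H) {} (map_frag (orbit_simplex n H) c) \<longleftrightarrow>
    (\<exists>b\<in>chains (partition_chains n) (Suc (Suc k)).
      c - frag_boundary b \<in> coinv_null (permute_partition ` H) (partition_chains n) (Suc k))"
proof -
  interpret list_complex_group_action "partition_chains n" "permute_partition ` H"
    by (rule list_complex_group_action_partition_chains [OF H])
  let ?f = "map_frag (orbit_simplex n H)"
  show ?thesis
  proof
    assume "singular_relboundary k (orbit_complex n H) {} (?f c)"
    then obtain w where w: "Poly_Mapping.keys w \<subseteq> complex_simplices (orbit_simplices n H) (Suc k)"
        "chain_boundary (Suc k) w = ?f c"
      using simplicial_homology_complex [OF finite_simplex_complex_orbit] keys_map_frag_orbit_simplex [OF c]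
      unfolding complex_points_orbit_simplices subtopology_topspace by blast
    obtain b where b: "b \<in> chains (partition_chains n) (Suc (Suc k))" "?f b = w"
      using chain_of_orbit_simplices [OF w(1)] by blast
    have "?f (c - frag_boundary b) = 0"
      using w(2) chain_boundary_orbit_simplex [OF b(1), of H] b(2) by (simp add: map_frag_diff)
    then have "c - frag_boundary b \<in> coinv_null (permute_partition ` H) (partition_chains n) (Suc k)"
      using orbit_simplex_eq_imp c b(1)
      by (intro coinv_null_if_map_frag_eq_0 [where f = "orbit_simplex n H"] chains_diff frag_boundary_chains) auto
    then show "\<exists>b\<in>chains (partition_chains n) (Suc (Suc k)).
        c - frag_boundary b \<in> coinv_null (permute_partition ` H) (partition_chains n) (Suc k)"
      using b(1) by blast
  next
    assume "\<exists>b\<in>chains (partition_chains n) (Suc (Suc k)).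
        c - frag_boundary b \<in> coinv_null (permute_partition ` H) (partition_chains n) (Suc k)"
    then obtain b where b: "b \<in> chains (partition_chains n) (Suc (Suc k))"
        "c - frag_boundary b \<in> coinv_null (permute_partition ` H) (partition_chains n) (Suc k)"
      by blast
    have "?f (c - frag_boundary b) = 0"
      by (rule map_frag_coinv_null [OF _ b(2)]) (use orbit_simplex_map in force)
    then have "chain_boundary (Suc k) (?f b) = ?f c"
      using chain_boundary_orbit_simplex [OF b(1), of H] by (simp add: map_frag_diff)
    moreover have "singular_chain (Suc k) (orbit_complex n H) (?f b)"
      using singular_chain_complex [OF finite_simplex_complex_orbit keys_map_frag_orbit_simplex [OF b(1)]]
      unfolding complex_points_orbit_simplices subtopology_topspace .
    ultimately show "singular_relboundary k (orbit_complex n H) {} (?f c)"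
      by (auto simp: singular_boundary)
  qed
qed

end

section \<open>Torsion classes of the orbit space\<close>

lemma homology_group_pow:
  assumes "singular_relcycle k X {} z"
  shows "homologous_rel_set k X {} z [^]\<^bsub>homology_group (int k) X\<^esub> (m::nat) =
    homologous_rel_set k X {} (frag_cmul (int m) z)"
proof (induction m)
  case 0
  show ?case
    using homologous_rel_set_eq_relboundary [of k X "{}" 0] by simp
next
  case (Suc m)
  have "homologous_rel_set k X {} a \<otimes>\<^bsub>homology_group (int k) X\<^esub> homologous_rel_set k X {} b =
      homologous_rel_set k X {} (a + b)" for a b
  proof -
    have "\<exists>r s. homologous_rel k X {} a r \<and> homologous_rel k X {} b s \<and> c = r + s"
      if "homologous_rel k X {} (a + b) c" for c
      using that by (intro exI [of _ a] exI [of _ "c - a"]) (simp add: homologous_rel_def algebra_simps)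
    then show ?thesis
      unfolding mult_relative_homology_group using homologous_rel_add by fastforce
  qed
  then show ?case
    by (simp add: Suc frag_cmul_distrib add.commute)
qed

theorem lemma10p8:
  fixes ns :: "nat list" and n p :: nat and i :: int
  assumes "\<forall>m \<in> set ns. 0 < m"
    and "n = sum_list ns"
    and "2 \<le> n"
    and "prime p"
    and "primary_torsion p
           (reduced_homology_group i
              (orbit_space (young_group ns) (partition_complex_action n) (partition_complex n)))
         \<noteq> {\<one>\<^bsub>reduced_homology_group i
              (orbit_space (young_group ns) (partition_complex_action n) (partition_complex n))\<^esub>}"
  shows "p \<le> Gcd (set ns)"
proof (rule ccontr)
  assume not_le: "\<not> p \<le> Gcd (set ns)"
  have "Gcd (set ns) \<noteq> 0"
  proof
    assume "Gcd (set ns) = 0"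
    then have "set ns \<subseteq> {0}" by (simp add: Gcd_0_iff)
    then have "sum_list ns = 0" by (auto simp: sum_list_eq_0_iff)
    then show False using assms(2,3) by linarith
  qed
  \<comment> \<open>A divisor of a positive gcd cannot exceed it, so some part is not divisible by
    \<open>p\<close>.\<close>
  then have "\<not> p dvd Gcd (set ns)"
    using not_le by (metis dvd_imp_le neq0_conv)
  then obtain m where m: "m \<in> set ns" "\<not> p dvd m"
    by (meson Gcd_greatest)
  then obtain j where j: "j < length ns" "ns ! j = m" by (metis in_set_conv_nth)
  let ?Z = "orbit_space (young_group ns) (partition_complex_action n) (partition_complex n)"
  have Z: "?Z = orbit_complex n (young_subgroup ns)"
    by (simp add: young_group_def assms(2))
  have sY: "subgroup (young_subgroup ns) (sym_group n)"
    unfolding assms(2) by (rule subgroup_young_subgroup)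
  let ?G = "reduced_homology_group i ?Z"
  have "\<one>\<^bsub>?G\<^esub> \<in> primary_torsion p ?G"
    using group.is_monoid [OF group_reduced_homology_group]
    by (auto simp: primary_torsion_def monoid.nat_pow_one monoid.one_closed)
  then obtain x where x: "x \<in> primary_torsion p ?G" "x \<noteq> \<one>\<^bsub>?G\<^esub>"
    using assms(5) by blast
  \<comment> \<open>Reduced homology is a subgroup with the same unit and powers, so the torsion
    class can be handled in unreduced homology.\<close>
  have xc: "x \<in> carrier (homology_group i ?Z)"
    using x(1) carrier_reduced_homology_group_subset by (auto simp: primary_torsion_def)
  obtain e :: nat where "x [^]\<^bsub>?G\<^esub> (p ^ e) = \<one>\<^bsub>?G\<^esub>"
    using x(1) by (auto simp: primary_torsion_def)
  then have pow: "x [^]\<^bsub>homology_group i ?Z\<^esub> (p ^ e) = \<one>\<^bsub>homology_group i ?Z\<^esub>"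
    by (simp add: reduced_homology_group_def pow_subgroup_generated)
  have x1: "x \<noteq> \<one>\<^bsub>homology_group i ?Z\<^esub>"
    using x(2) by (simp add: one_reduced_homology_group)
  have "0 \<le> i"
  proof (rule ccontr)
    assume "\<not> 0 \<le> i"
    then have "trivial_group (homology_group i ?Z)" by simp
    then show False using xc x1 by (auto simp: trivial_group_def)
  qed
  then obtain k where k: "i = int k" using nonneg_int_cases by blast
  obtain z where z: "singular_relcycle k ?Z {} z" "x = homologous_rel_set k ?Z {} z"
    using xc unfolding k carrier_relative_homology_group by blast
  let ?f = "map_frag (orbit_simplex n (young_subgroup ns))"
  obtain c where c: "c \<in> chains (partition_chains n) (Suc k)" "homologous_rel k ?Z {} z (?f c)"
    using orbit_cycle_homologous_chain [OF sY z(1) [unfolded Z]] unfolding Z by blast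
  have zf: "singular_relcycle k ?Z {} (?f c)"
    using homologous_rel_singular_relcycle_1 [OF c(2) z(1)] .
  have xf: "x = homologous_rel_set k ?Z {} (?f c)"
    using c(2) z(2) homologous_rel_set_eq by metis
  let ?q = "int (p ^ e)"
  have "homologous_rel_set k ?Z {} (frag_cmul ?q (?f c)) = singular_relboundary_set k ?Z {}"
    using pow homology_group_pow [OF zf, of "p ^ e"] unfolding xf k one_relative_homology_group by simp
  then have "singular_relboundary k ?Z {} (?f (frag_cmul ?q c))"
    unfolding homologous_rel_set_eq_relboundary map_frag_cmul .
  then obtain b where b: "b \<in> chains (partition_chains n) (Suc (Suc k))"
      "frag_cmul ?q c - frag_boundary b
        \<in> coinv_null (permute_partition ` young_subgroup ns) (partition_chains n) (Suc k)"
    using singular_relboundary_orbit_simplex_iff [OF sY chains_cmul [OF c(1)]] unfolding Z by blast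
  have "coprime p m" using m(2) assms(4) prime_imp_coprime by blast
  then have cop: "coprime ?q (int (ns ! j))"
    using j(2) by (simp add: coprime_int_iff)
  have q0: "?q \<noteq> 0" using assms(4) by (simp add: prime_gt_0_nat)
  have "\<exists>b\<in>chains (partition_chains n) (Suc (Suc k)). c - frag_boundary b
      \<in> coinv_null (permute_partition ` young_subgroup ns) (partition_chains n) (Suc k)"
    using young_no_torsion [OF j(1) _ cop q0] assms(1-3) m(1) j(2) c(1) b by auto
  then have "singular_relboundary k ?Z {} (?f c)"
    using singular_relboundary_orbit_simplex_iff [OF sY c(1)] unfolding Z by blast
  then have "x = \<one>\<^bsub>homology_group i ?Z\<^esub>"
    unfolding xf k one_relative_homology_group homologous_rel_set_eq_relboundary .
  then show False using x1 by simp
qed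

end
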